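(* Let $\Omega\subset\mathbb{R}^n$ be a bounded $C^2$-smooth domain and let $\varphi\in H^2(\Omega)$. Let $u$ be a minimiser of $F$ on $\mathscr{N}$, or a minimiser of $F$ on $\mathscr{D}$. Then $u\in C^{1,\alpha}(\Omega)$ for every $\alpha\in(0,1)$, the set $\Omega\setminus\{x\in\Omega: u(x)=0 \text{ and } \nabla u(x)=0\}$ is open, and $u$ is smooth and biharmonic (i.e. $\Delta^2u=0$) on this set.
   Context: For $u\in H^2(\Omega)$ set $F(u)=\int_\Omega\left(|\Delta u(x)|^2+1_{\{u\neq 0\}}(x)\right)\,\mathrm{d}x$, where $1_{\{u\ne 0\}}$ is the indicator function of $\{x\in\Omega: u(x)\neq 0\}$. The admissible sets are $\mathscr{N}=\{v\in H^2(\Omega): v-\varphi\in H^1_0(\Omega)\}$ (Navier boundary conditions) and $\mathscr{D}=\{v\in H^2(\Omega): v-\varphi\in H^2_0(\Omega)\}$ (Dirichlet boundary conditions). The regularity statement is an interior one: $C^{1,\alpha}(\Omega)$ means that $u$ has a $C^1$ representative whose gradient is locally $\alpha$-H\"older continuous in $\Omega$. *)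

theory Defs
  imports "HOL-Analysis.Analysis"
begin

section \<open>Classical derivatives\<close>

definition partial_deriv :: "'a::euclidean_space \<Rightarrow> ('a \<Rightarrow> real) \<Rightarrow> 'a \<Rightarrow> real" where
  "partial_deriv i f x = frechet_derivative f (at x) i"

definition grad :: "('a::euclidean_space \<Rightarrow> real) \<Rightarrow> 'a \<Rightarrow> 'a" where
  "grad f x = (\<Sum>i\<in>Basis. partial_deriv i f x *\<^sub>R i)"

definition laplacian :: "('a::euclidean_space \<Rightarrow> real) \<Rightarrow> 'a \<Rightarrow> real" where
  "laplacian f x = (\<Sum>i\<in>Basis. partial_deriv i (partial_deriv i f) x)"

text \<open>
  \<open>Ck_on k S f\<close> is meant for open \<open>S\<close> only, since derivatives are taken in the full space.
\<close>

primrec Ck_on :: "nat \<Rightarrow> 'a::euclidean_space set \<Rightarrow> ('a \<Rightarrow> real) \<Rightarrow> bool" where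
  "Ck_on 0 S f \<longleftrightarrow> continuous_on S f"
| "Ck_on (Suc k) S f \<longleftrightarrow>
     (\<forall>x\<in>S. f differentiable (at x)) \<and> (\<forall>i\<in>Basis. Ck_on k S (partial_deriv i f))"

definition smooth_on :: "'a::euclidean_space set \<Rightarrow> ('a \<Rightarrow> real) \<Rightarrow> bool" where
  "smooth_on S f \<longleftrightarrow> (\<forall>k. Ck_on k S f)"

definition biharmonic_on :: "'a::euclidean_space set \<Rightarrow> ('a \<Rightarrow> real) \<Rightarrow> bool" where
  "biharmonic_on S f \<longleftrightarrow> Ck_on 4 S f \<and> (\<forall>x\<in>S. laplacian (laplacian f) x = 0)"

definition locally_holder_on ::
    "real \<Rightarrow> 'a::euclidean_space set \<Rightarrow> ('a \<Rightarrow> 'b::real_normed_vector) \<Rightarrow> bool" where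
  "locally_holder_on \<alpha> S g \<longleftrightarrow>
     (\<forall>K. compact K \<and> K \<subseteq> S \<longrightarrow>
        (\<exists>C. \<forall>x\<in>K. \<forall>y\<in>K. norm (g x - g y) \<le> C * norm (x - y) powr \<alpha>))"

definition C1_holder_on :: "real \<Rightarrow> 'a::euclidean_space set \<Rightarrow> ('a \<Rightarrow> real) \<Rightarrow> bool" where
  "C1_holder_on \<alpha> S f \<longleftrightarrow> Ck_on 1 S f \<and> locally_holder_on \<alpha> S (grad f)"

section \<open>Bounded domains of class \<open>C\<^sup>2\<close>\<close>

text \<open>
  Near each boundary point the domain is, in a suitable orthonormal coordinate system with last
  axis \<open>\<nu>\<close>, the region strictly above the graph of a \<open>C\<^sup>2\<close> function on the hyperplane orthogonal
  to \<open>\<nu>\<close>. The function \<open>\<gamma>\<close> is defined on the whole space, but only evaluated on that hyperplane.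
\<close>

definition C2_boundary :: "'a::euclidean_space set \<Rightarrow> bool" where
  "C2_boundary \<Omega> \<longleftrightarrow>
     (\<forall>p\<in>frontier \<Omega>. \<exists>r>0. \<exists>\<nu> \<gamma>. norm \<nu> = 1 \<and> Ck_on 2 UNIV \<gamma> \<and>
        \<Omega> \<inter> ball p r = {y \<in> ball p r. y \<bullet> \<nu> > \<gamma> (y - (y \<bullet> \<nu>) *\<^sub>R \<nu>)})"

definition bounded_C2_domain :: "'a::euclidean_space set \<Rightarrow> bool" where
  "bounded_C2_domain \<Omega> \<longleftrightarrow>
     open \<Omega> \<and> connected \<Omega> \<and> \<Omega> \<noteq> {} \<and> bounded \<Omega> \<and> C2_boundary \<Omega>"

section \<open>Sobolev spaces\<close>

text \<open>
  Elements of function spaces over \<open>\<Omega>\<close> are represented by total functions; only their values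
  almost everywhere in \<open>\<Omega>\<close> matter.
\<close>

definition ae_eq_on :: "'a::euclidean_space set \<Rightarrow> ('a \<Rightarrow> real) \<Rightarrow> ('a \<Rightarrow> real) \<Rightarrow> bool" where
  "ae_eq_on \<Omega> u w \<longleftrightarrow> (AE x in lebesgue. x \<in> \<Omega> \<longrightarrow> u x = w x)"

definition test_function :: "'a::euclidean_space set \<Rightarrow> ('a \<Rightarrow> real) \<Rightarrow> bool" where
  "test_function \<Omega> \<psi> \<longleftrightarrow>
     smooth_on UNIV \<psi> \<and> compact (closure {x. \<psi> x \<noteq> 0}) \<and> closure {x. \<psi> x \<noteq> 0} \<subseteq> \<Omega>"

definition L2_on :: "'a::euclidean_space set \<Rightarrow> ('a \<Rightarrow> real) \<Rightarrow> bool" where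
  "L2_on \<Omega> u \<longleftrightarrow>
     set_borel_measurable lebesgue \<Omega> u \<and> set_integrable lebesgue \<Omega> (\<lambda>x. (u x)\<^sup>2)"

definition locally_integrable_on :: "'a::euclidean_space set \<Rightarrow> ('a \<Rightarrow> real) \<Rightarrow> bool" where
  "locally_integrable_on \<Omega> u \<longleftrightarrow>
     (\<forall>K. compact K \<and> K \<subseteq> \<Omega> \<longrightarrow> set_integrable lebesgue K u)"

definition has_weak_partial ::
    "'a::euclidean_space set \<Rightarrow> 'a \<Rightarrow> ('a \<Rightarrow> real) \<Rightarrow> ('a \<Rightarrow> real) \<Rightarrow> bool" where
  "has_weak_partial \<Omega> i u g \<longleftrightarrow>
     locally_integrable_on \<Omega> u \<and> locally_integrable_on \<Omega> g \<and>
     (\<forall>\<psi>. test_function \<Omega> \<psi> \<longrightarrow>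
        (LINT x:\<Omega>|lebesgue. u x * partial_deriv i \<psi> x) = - (LINT x:\<Omega>|lebesgue. g x * \<psi> x))"

text \<open>
  A weak derivative is unique up to null sets, so any choice of representative will do, and all
  integrals below are independent of it.
\<close>

definition weak_partial ::
    "'a::euclidean_space set \<Rightarrow> 'a \<Rightarrow> ('a \<Rightarrow> real) \<Rightarrow> 'a \<Rightarrow> real" where
  "weak_partial \<Omega> i u = (SOME g. has_weak_partial \<Omega> i u g)"

definition weak_laplacian :: "'a::euclidean_space set \<Rightarrow> ('a \<Rightarrow> real) \<Rightarrow> 'a \<Rightarrow> real" where
  "weak_laplacian \<Omega> u x = (\<Sum>i\<in>Basis. weak_partial \<Omega> i (weak_partial \<Omega> i u) x)"

text \<open>\<open>H k \<Omega>\<close> is the Sobolev space \<open>H\<^sup>k(\<Omega>) = W\<^sup>k\<^sup>,\<^sup>2(\<Omega>)\<close>.\<close>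

primrec H :: "nat \<Rightarrow> 'a::euclidean_space set \<Rightarrow> ('a \<Rightarrow> real) set" where
  "H 0 \<Omega> = {u. L2_on \<Omega> u}"
| "H (Suc k) \<Omega> =
     {u. L2_on \<Omega> u \<and> (\<forall>i\<in>Basis. \<exists>g. has_weak_partial \<Omega> i u g \<and> g \<in> H k \<Omega>)}"

text \<open>
  The squared norm of \<open>H\<^sup>k(\<Omega>)\<close>: for \<open>k = 2\<close> it is the sum of the integrals over \<open>\<Omega>\<close> of \<open>u\<^sup>2\<close>,
  of \<open>(D\<^sub>i u)\<^sup>2\<close> over all \<open>i\<close> and of \<open>(D\<^sub>j D\<^sub>i u)\<^sup>2\<close> over all ordered pairs \<open>(i, j)\<close>.
\<close>

primrec H_norm_sq :: "nat \<Rightarrow> 'a::euclidean_space set \<Rightarrow> ('a \<Rightarrow> real) \<Rightarrow> real" where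
  "H_norm_sq 0 \<Omega> u = (LINT x:\<Omega>|lebesgue. (u x)\<^sup>2)"
| "H_norm_sq (Suc k) \<Omega> u =
     (LINT x:\<Omega>|lebesgue. (u x)\<^sup>2) + (\<Sum>i\<in>Basis. H_norm_sq k \<Omega> (weak_partial \<Omega> i u))"

definition H_norm :: "nat \<Rightarrow> 'a::euclidean_space set \<Rightarrow> ('a \<Rightarrow> real) \<Rightarrow> real" where
  "H_norm k \<Omega> u = sqrt (H_norm_sq k \<Omega> u)"

text \<open>\<open>H0 k \<Omega>\<close> is the closure of the test functions in \<open>H\<^sup>k(\<Omega>)\<close>.\<close>

definition H0 :: "nat \<Rightarrow> 'a::euclidean_space set \<Rightarrow> ('a \<Rightarrow> real) set" where
  "H0 k \<Omega> = {u \<in> H k \<Omega>. \<forall>\<epsilon>>0. \<exists>\<psi>. test_function \<Omega> \<psi> \<and> H_norm k \<Omega> (\<lambda>x. u x - \<psi> x) < \<epsilon>}"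

section \<open>The variational problem\<close>

definition F :: "'a::euclidean_space set \<Rightarrow> ('a \<Rightarrow> real) \<Rightarrow> real" where
  "F \<Omega> u = (LINT x:\<Omega>|lebesgue. \<bar>weak_laplacian \<Omega> u x\<bar>\<^sup>2 + indicator {x\<in>\<Omega>. u x \<noteq> 0} x)"

definition navier_class ::
    "'a::euclidean_space set \<Rightarrow> ('a \<Rightarrow> real) \<Rightarrow> ('a \<Rightarrow> real) set" where
  "navier_class \<Omega> \<phi> = {v \<in> H 2 \<Omega>. (\<lambda>x. v x - \<phi> x) \<in> H0 1 \<Omega>}"

definition dirichlet_class ::
    "'a::euclidean_space set \<Rightarrow> ('a \<Rightarrow> real) \<Rightarrow> ('a \<Rightarrow> real) set" where
  "dirichlet_class \<Omega> \<phi> = {v \<in> H 2 \<Omega>. (\<lambda>x. v x - \<phi> x) \<in> H0 2 \<Omega>}"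

end

theory Submission
  imports Defs
begin

text \<open>
  Comparing \<open>F (u + t \<phi>)\<close> with \<open>F u\<close> for all real \<open>t\<close> shows that a minimiser satisfies
  \<open>(\<integral> u \<Delta>\<^sup>2\<phi>)\<^sup>2 \<le> |{u = 0, \<phi> \<noteq> 0}| \<integral> (\<Delta>\<phi>)\<^sup>2\<close> for every test function \<open>\<phi>\<close>, and this inequality is all
  that is used about it. Let \<open>m\<close> be a radial kernel with \<open>n m + y \<sqdot> \<nabla>m = \<Delta>\<^sup>2\<psi>\<close> for a compactly supported
  \<open>\<psi>\<close>. Then the radius derivative of \<open>m\<^sub>r(y) = r\<^sup>-\<^sup>n m(y / r)\<close> is the bilaplacian of a function supported in
  a ball of radius \<open>r\<close>, so the inequality bounds the radius derivatives of \<open>u * m\<^sub>r\<close>, of its gradient and of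
  its Hessian by multiples of \<open>r\<close>, \<open>1\<close> and \<open>1 / r\<close>. Hence \<open>u * m\<^sub>r\<close> converges in \<open>C\<^sup>1\<close> as \<open>r\<close> tends to \<open>0\<close>,
  and since its Hessian grows only like \<open>- ln r\<close>, the gradient of the limit has modulus of continuity
  \<open>- \<rho> ln \<rho>\<close>. Where \<open>u\<close> and \<open>\<nabla>u\<close> do not both vanish, the zero set of \<open>u\<close> is a null set and the inequality
  becomes \<open>\<integral> u \<Delta>\<^sup>2\<phi> = 0\<close>. There \<open>u * m\<^sub>r\<close> does not depend on \<open>r\<close>, so \<open>u\<close> is a multiple of \<open>u * m\<^sub>r\<close> for a
  fixed \<open>r\<close>, which is smooth and biharmonic.
\<close>

section \<open>Calculus of partial derivatives\<close>

text \<open>Replacing u by u + t phi enlarges the set where the function is nonzero by at most {u =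
  0, phi nonzero}, whatever t is. The comparison therefore leaves a quadratic polynomial in t that
  is nonnegative everywhere, and the inequality is its discriminant condition. The powers of r come
  from scaling. For phi(z) = kappa((x - z) / r) the measure is O(r^n), the integral of the squared
  Laplacian is O(r^(n - 4)), and the bilaplacian carries r^(-4); so the integral of U(z) against the
  bilaplacian of kappa, evaluated at (x - z) / r, is O(r^(n + 2)). The radius derivative of the
  mollification divides this by r^(n + 1), and each derivative in x by one more r. The Hessian is
  the borderline case: 1 / r is integrable up to a logarithm only. Taking the radius |x - y| when
  gradients at x and y are compared then reaches every exponent below 1. The regularity argument
  needs no estimate for second derivatives of u, only pointwise bounds for smooth convolutions. The
  kernel must have nonzero integral, since u is recovered after division by it.\<close>

lemma partial_deriv_eq:
  "(f has_derivative f') (at x) \<Longrightarrow> partial_deriv i f x = f' i"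
  unfolding partial_deriv_def using frechet_derivative_at by metis

lemma has_derivative_partial:
  fixes f :: "'a::euclidean_space \<Rightarrow> real"
  assumes "f differentiable (at x)"
  shows "(f has_derivative (\<lambda>h. \<Sum>i\<in>Basis. (h \<bullet> i) * partial_deriv i f x)) (at x)"
proof -
  obtain f' where f': "(f has_derivative f') (at x)"
    using assms unfolding differentiable_def by auto
  have lin: "linear f'"
    using f' has_derivative_linear by blast
  have "f' h = (\<Sum>i\<in>Basis. (h \<bullet> i) * partial_deriv i f x)" for h
  proof -
    have "f' h = f' (\<Sum>i\<in>Basis. (h \<bullet> i) *\<^sub>R i)"
      by (simp add: euclidean_representation)
    also have "\<dots> = (\<Sum>i\<in>Basis. (h \<bullet> i) * f' i)"
      using lin by (simp add: linear_sum linear_cmul)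
    finally show ?thesis
      using partial_deriv_eq[OF f'] by simp
  qed
  then have "f' = (\<lambda>h. \<Sum>i\<in>Basis. (h \<bullet> i) * partial_deriv i f x)" by (rule ext)
  then show ?thesis
    using f' by metis
qed

lemma partial_deriv_cong:
  assumes "open S" "x \<in> S" "\<And>y. y \<in> S \<Longrightarrow> f y = g y" "f differentiable (at x)"
  shows "partial_deriv i g x = partial_deriv i f x"
proof -
  obtain f' where f': "(f has_derivative f') (at x)"
    using assms unfolding differentiable_def by auto
  have "(g has_derivative f') (at x)"
    using has_derivative_transform_within_open[OF f' assms(1,2)] assms(3) by auto
  then show ?thesis
    using f' partial_deriv_eq by metis
qed

lemma differentiable_cong_open:
  assumes "open S" "x \<in> S" "\<And>y. y \<in> S \<Longrightarrow> f y = g y" "f differentiable (at x)"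
  shows "g differentiable (at x)"
  using assms has_derivative_transform_within_open unfolding differentiable_def by metis

lemma Ck_on_SucD: "Ck_on (Suc k) S f \<Longrightarrow> Ck_on k S f"
proof (induction k arbitrary: f)
  case 0
  then show ?case
    by (auto intro!: continuous_at_imp_continuous_on differentiable_imp_continuous_within)
qed auto

lemma Ck_on_subset: "Ck_on k S f \<Longrightarrow> T \<subseteq> S \<Longrightarrow> Ck_on k T f"
  by (induction k arbitrary: f) (auto intro: continuous_on_subset)

text \<open>Needed because the representative of the minimiser is given by a different smooth
  formula near each point.\<close>

lemma Ck_on_local:
  assumes "\<And>x. x \<in> S \<Longrightarrow> \<exists>T. open T \<and> x \<in> T \<and> Ck_on k T f"
  shows "Ck_on k S f"
  using assms
proof (induction k arbitrary: f)
  case 0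
  have "continuous (at x) f" if "x \<in> S" for x
    using 0[OF that] continuous_on_eq_continuous_at by auto
  then show ?case
    by (auto intro: continuous_at_imp_continuous_on)
next
  case (Suc k)
  then show ?case by fastforce
qed

lemma Ck_on_cong:
  assumes "open S" "\<And>y. y \<in> S \<Longrightarrow> f y = g y" "Ck_on k S f"
  shows "Ck_on k S g"
  using assms(2,3)
proof (induction k arbitrary: f g)
  case 0
  then show ?case by (simp cong: continuous_on_cong)
next
  case (Suc k)
  have d: "f differentiable (at x)" if "x \<in> S" for x
    using Suc.prems(2) that by auto
  have "Ck_on k S (partial_deriv i g)" if "i \<in> Basis" for i
  proof (rule Suc.IH)
    show "partial_deriv i f y = partial_deriv i g y" if "y \<in> S" for y
      using partial_deriv_cong[OF assms(1) that Suc.prems(1) d[OF that]] by simp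
    show "Ck_on k S (partial_deriv i f)"
      using Suc.prems(2) that by auto
  qed
  then show ?case
    using differentiable_cong_open[OF assms(1) _ Suc.prems(1) d] by auto
qed

lemma partial_deriv_const [simp]: "partial_deriv i (\<lambda>x. c) x = 0"
  by (rule partial_deriv_eq[of _ "\<lambda>h. 0"]) simp

lemma partial_deriv_add:
  assumes "f differentiable (at x)" "g differentiable (at x)"
  shows "partial_deriv i (\<lambda>x. f x + g x) x = partial_deriv i f x + partial_deriv i g x"
  using has_derivative_add[OF assms[unfolded frechet_derivative_works]]
  by (subst partial_deriv_eq) (auto simp: partial_deriv_def)

lemma partial_deriv_mult:
  fixes f g :: "'a::euclidean_space \<Rightarrow> real"
  assumes "f differentiable (at x)" "g differentiable (at x)"
  shows "partial_deriv i (\<lambda>x. f x * g x) x = f x * partial_deriv i g x + partial_deriv i f x * g x"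
  using has_derivative_mult[OF assms[unfolded frechet_derivative_works]]
  by (subst partial_deriv_eq) (auto simp: partial_deriv_def)

lemma partial_deriv_cmult:
  "f differentiable (at x) \<Longrightarrow> partial_deriv i (\<lambda>x. c * f x) x = c * partial_deriv i f x"
  by (subst partial_deriv_mult) auto

lemma partial_deriv_sum:
  "finite I \<Longrightarrow> (\<And>k. k \<in> I \<Longrightarrow> f k differentiable (at x)) \<Longrightarrow>
    partial_deriv i (\<lambda>x. \<Sum>k\<in>I. f k x) x = (\<Sum>k\<in>I. partial_deriv i (f k) x)"
  by (induction I rule: finite_induct) (auto simp: partial_deriv_add)

lemma partial_deriv_inner:
  "partial_deriv i (\<lambda>x. x \<bullet> b) x = i \<bullet> b"
  by (rule partial_deriv_eq[of _ "\<lambda>h. h \<bullet> b"]) (auto intro!: derivative_eq_intros)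

lemma partial_deriv_affine:
  assumes "f differentiable (at (a + c *\<^sub>R x))"
  shows "partial_deriv i (\<lambda>x. f (a + c *\<^sub>R x)) x = c * partial_deriv i f (a + c *\<^sub>R x)"
proof -
  obtain f' where f': "(f has_derivative f') (at (a + c *\<^sub>R x))"
    using assms unfolding differentiable_def by auto
  have "((\<lambda>x. f (a + c *\<^sub>R x)) has_derivative (\<lambda>h. f' (c *\<^sub>R h))) (at x)"
    by (rule has_derivative_compose[where f="\<lambda>x. a + c *\<^sub>R x" and g=f]) (auto intro!: derivative_eq_intros f')
  moreover have "f' (c *\<^sub>R i) = c * f' i"
    using has_derivative_linear[OF f'] by (simp add: linear_cmul)
  ultimately show ?thesis
    using f' partial_deriv_eq by metis
qed

lemma partial_deriv_compose_real:
  assumes "(\<phi> has_real_derivative d) (at (q x))" "q differentiable (at x)"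
  shows "partial_deriv i (\<lambda>x. \<phi> (q x)) x = d * partial_deriv i q x"
proof -
  obtain q' where q': "(q has_derivative q') (at x)"
    using assms unfolding differentiable_def by auto
  have "((\<lambda>x. \<phi> (q x)) has_derivative (\<lambda>h. d * q' h)) (at x)"
    using has_derivative_compose[OF q' assms(1)[unfolded has_field_derivative_def]] .
  then show ?thesis
    using q' partial_deriv_eq by metis
qed

lemma Ck_on_const [simp]: "Ck_on k S (\<lambda>x. c)"
proof (induction k arbitrary: c)
  case (Suc k)
  have "partial_deriv i (\<lambda>x. c) = (\<lambda>x. 0)" for i :: 'a
    by auto
  then show ?case using Suc by simp
qed auto

lemma Ck_on_inner [simp]: "Ck_on k S (\<lambda>x. x \<bullet> b)"
proof (cases k)
  case (Suc k)
  have "partial_deriv i (\<lambda>x. x \<bullet> b) = (\<lambda>x. i \<bullet> b)" for i :: 'a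
    by (auto simp: partial_deriv_inner)
  then show ?thesis using Suc by (simp add: bounded_linear_imp_differentiable[OF bounded_linear_inner_left])
qed (auto intro!: continuous_intros)

lemma Ck_on_add:
  assumes "open S" "Ck_on k S f" "Ck_on k S g"
  shows "Ck_on k S (\<lambda>x. f x + g x)"
  using assms(2,3)
proof (induction k arbitrary: f g)
  case 0
  then show ?case by (auto intro: continuous_intros)
next
  case (Suc k)
  have "Ck_on k S (partial_deriv i (\<lambda>x. f x + g x))" if "i \<in> Basis" for i
    by (rule Ck_on_cong[OF assms(1) _ Suc.IH[of "partial_deriv i f" "partial_deriv i g"]])
      (use Suc.prems that in \<open>auto simp: partial_deriv_add\<close>)
  then show ?case
    using Suc.prems by auto
qed

lemma Ck_on_mult:
  assumes "open S" "Ck_on k S f" "Ck_on k S g"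
  shows "Ck_on k S (\<lambda>x. f x * g x)"
  using assms(2,3)
proof (induction k arbitrary: f g)
  case 0
  then show ?case by (auto intro: continuous_intros)
next
  case (Suc k)
  have "Ck_on k S (partial_deriv i (\<lambda>x. f x * g x))" if "i \<in> Basis" for i
  proof (rule Ck_on_cong[OF assms(1)])
    show "Ck_on k S (\<lambda>x. f x * partial_deriv i g x + partial_deriv i f x * g x)"
      using Suc.prems that Ck_on_SucD[of k S f] Ck_on_SucD[of k S g]
      by (intro Ck_on_add[OF assms(1)] Suc.IH) auto
    show "f x * partial_deriv i g x + partial_deriv i f x * g x = partial_deriv i (\<lambda>x. f x * g x) x"
      if "x \<in> S" for x
      using Suc.prems that by (auto simp: partial_deriv_mult)
  qed
  then show ?case
    using Suc.prems by auto
qed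

lemma Ck_on_sum:
  "finite I \<Longrightarrow> open S \<Longrightarrow> (\<And>k. k \<in> I \<Longrightarrow> Ck_on m S (f k)) \<Longrightarrow> Ck_on m S (\<lambda>x. \<Sum>k\<in>I. f k x)"
  by (induct I rule: finite_induct) (auto intro: Ck_on_add)

lemma Ck_on_prod:
  "finite I \<Longrightarrow> open S \<Longrightarrow> (\<And>k. k \<in> I \<Longrightarrow> Ck_on m S (f k)) \<Longrightarrow> Ck_on m S (\<lambda>x. \<Prod>k\<in>I. f k x)"
  by (induct I rule: finite_induct) (auto intro: Ck_on_mult)

lemma Ck_on_affine:
  "Ck_on k UNIV f \<Longrightarrow> Ck_on k UNIV (\<lambda>x. f (a + c *\<^sub>R x))"
proof (induction k arbitrary: f)
  case 0
  have "continuous_on UNIV (\<lambda>x. a + c *\<^sub>R x)"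
    by (intro continuous_intros)
  then show ?case
    using 0 continuous_on_compose2[of UNIV f UNIV "\<lambda>x. a + c *\<^sub>R x"] by simp
next
  case (Suc k)
  have d: "f differentiable (at y)" for y
    using Suc.prems by simp
  have "(\<lambda>x. a + c *\<^sub>R x) differentiable (at x)" for x
    by (intro derivative_intros)
  then have "(\<lambda>x. f (a + c *\<^sub>R x)) differentiable (at x)" for x
    using differentiable_compose[OF d] by blast
  moreover have "partial_deriv i (\<lambda>x. f (a + c *\<^sub>R x)) = (\<lambda>x. c * partial_deriv i f (a + c *\<^sub>R x))" for i
    using partial_deriv_affine[OF d] by blast
  moreover have "Ck_on k UNIV (\<lambda>x. c * partial_deriv i f (a + c *\<^sub>R x))" if "i \<in> Basis" for i
    using Suc that by (intro Ck_on_mult Ck_on_const Suc.IH) auto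
  ultimately show ?case
    by simp
qed

text \<open>Smoothness of the outer function is encoded by a family closed under differentiation:
  the chain rule produces another member of the family, so the induction on k never leaves
  it.\<close>

lemma Ck_on_compose_real:
  assumes "open S"
    and fam: "\<And>\<phi>. \<phi> \<in> \<F> \<Longrightarrow> \<exists>\<phi>'\<in>\<F>. \<forall>t. (\<phi> has_real_derivative \<phi>' t) (at t)"
    and "\<phi> \<in> \<F>" "Ck_on k S q"
  shows "Ck_on k S (\<lambda>x. \<phi> (q x))"
  using assms(3,4)
proof (induction k arbitrary: \<phi>)
  case 0
  from fam[OF 0(1)] obtain \<phi>' where "\<And>t. (\<phi> has_real_derivative \<phi>' t) (at t)"
    by blast
  then have "continuous_on UNIV \<phi>"
    by (meson DERIV_isCont continuous_at_imp_continuous_on)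
  then show ?case
    using 0 continuous_on_compose2[of UNIV \<phi> S q] by simp
next
  case (Suc k)
  from fam[OF Suc.prems(1)] obtain \<phi>' where \<phi>': "\<phi>' \<in> \<F>" "\<forall>t. (\<phi> has_real_derivative \<phi>' t) (at t)"
    by (elim bexE)
  have d: "(\<lambda>x. \<phi> (q x)) differentiable (at x)" if x: "x \<in> S" for x
  proof -
    obtain q' where q': "(q has_derivative q') (at x)"
      using Suc.prems(2) x by (auto simp: differentiable_def)
    show ?thesis
      by (rule differentiableI[OF has_derivative_compose[OF q' \<phi>'(2)[rule_format, of "q x", unfolded has_field_derivative_def]]])
  qed
  have "Ck_on k S (partial_deriv i (\<lambda>x. \<phi> (q x)))" if i: "i \<in> Basis" for i
  proof (rule Ck_on_cong[OF assms(1)])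
    have "Ck_on k S q" "Ck_on k S (partial_deriv i q)"
      using Ck_on_SucD[OF Suc.prems(2)] Suc.prems(2) i by simp_all
    then show "Ck_on k S (\<lambda>x. \<phi>' (q x) * partial_deriv i q x)"
      using Ck_on_mult[OF assms(1)] Suc.IH[OF \<phi>'(1)] by blast
    show "\<phi>' (q x) * partial_deriv i q x = partial_deriv i (\<lambda>x. \<phi> (q x)) x" if "x \<in> S" for x
      using partial_deriv_compose_real[of \<phi> "\<phi>' (q x)" q x i] \<phi>'(2) Suc.prems(2) that by simp
  qed
  then show ?case
    using d by simp
qed

lemma has_real_derivative_along_line:
  fixes f :: "'a::euclidean_space \<Rightarrow> real"
  assumes "f differentiable (at (y + t *\<^sub>R k))"
  shows "((\<lambda>t. f (y + t *\<^sub>R k)) has_real_derivative partial_deriv k f (y + t *\<^sub>R k)) (at t)"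
proof -
  obtain f' where f': "(f has_derivative f') (at (y + t *\<^sub>R k))"
    using assms unfolding differentiable_def by auto
  have "((\<lambda>t. f (y + t *\<^sub>R k)) has_derivative (\<lambda>h. f' (h *\<^sub>R k))) (at t)"
    by (rule has_derivative_compose[where f="\<lambda>t. y + t *\<^sub>R k" and g=f and g'=f'])
      (auto intro!: derivative_eq_intros f')
  moreover have "f' (h *\<^sub>R k) = partial_deriv k f (y + t *\<^sub>R k) * h" for h
    using partial_deriv_eq[OF f'] has_derivative_linear[OF f'] by (simp add: linear_cmul)
  ultimately show ?thesis
    by (simp add: has_field_derivative_def)
qed

text \<open>The second difference quotient \<open>Q\<close> is symmetric in i and j. Two
  applications of the mean value theorem, in either order, write it as a mixed derivative at an
  intermediate point, so both mixed derivatives are its limit at s = 0.\<close>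

lemma partial_deriv_commute:
  fixes f :: "'a::euclidean_space \<Rightarrow> real"
  assumes C2: "Ck_on 2 UNIV f" and i: "i \<in> Basis" and j: "j \<in> Basis"
  shows "partial_deriv i (partial_deriv j f) x = partial_deriv j (partial_deriv i f) x"
proof -
  define Q where "Q s = (f (x + s *\<^sub>R i + s *\<^sub>R j) - f (x + s *\<^sub>R i) - f (x + s *\<^sub>R j) + f x) / s\<^sup>2" for s
  have f1: "f differentiable (at x)" for x
    using C2 by (auto simp: numeral_2_eq_2)
  have lim: "(Q \<longlongrightarrow> partial_deriv k (partial_deriv l f) x) (at_right 0)"
    if k: "k \<in> Basis" and l: "l \<in> Basis" and kl: "{k, l} = {i, j}" for k l
  proof -
    have f2: "partial_deriv l f differentiable (at x)" for x
      using C2 l by (auto simp: numeral_2_eq_2)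
    have cont: "continuous_on UNIV (partial_deriv k (partial_deriv l f))"
      using C2 k l by (auto simp: numeral_2_eq_2)
    have Qeq: "Q s = (f (x + s *\<^sub>R l + s *\<^sub>R k) - f (x + s *\<^sub>R l) - f (x + s *\<^sub>R k) + f x) / s\<^sup>2" for s
      using kl unfolding doubleton_eq_iff Q_def by (elim disjE) (simp_all add: add_ac)
    have ex: "\<exists>a b. 0 < a \<and> a < s \<and> 0 < b \<and> b < s \<and>
        Q s = partial_deriv k (partial_deriv l f) (x + a *\<^sub>R l + b *\<^sub>R k)" if s: "s > 0" for s
    proof -
      define \<phi> where "\<phi> a = f (x + s *\<^sub>R k + a *\<^sub>R l) - f (x + a *\<^sub>R l)" for a
      have "(\<phi> has_real_derivative (partial_deriv l f (x + s *\<^sub>R k + a *\<^sub>R l) - partial_deriv l f (x + a *\<^sub>R l))) (at a)" for a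
        unfolding \<phi>_def by (rule DERIV_diff[OF has_real_derivative_along_line[OF f1] has_real_derivative_along_line[OF f1]])
      from MVT2[OF s this] obtain a where a: "0 < a" "a < s"
        "\<phi> s - \<phi> 0 = (s - 0) * (partial_deriv l f (x + s *\<^sub>R k + a *\<^sub>R l) - partial_deriv l f (x + a *\<^sub>R l))"
        by blast
      from MVT2[OF s has_real_derivative_along_line[OF f2]] obtain b where b: "0 < b" "b < s"
        "partial_deriv l f (x + a *\<^sub>R l + s *\<^sub>R k) - partial_deriv l f (x + a *\<^sub>R l + 0 *\<^sub>R k) =
         (s - 0) * partial_deriv k (partial_deriv l f) (x + a *\<^sub>R l + b *\<^sub>R k)"
        by blast
      have "Q s * s\<^sup>2 = \<phi> s - \<phi> 0"
        using s by (simp add: Qeq \<phi>_def add_ac)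
      also have "\<dots> = s * (s * partial_deriv k (partial_deriv l f) (x + a *\<^sub>R l + b *\<^sub>R k))"
        using a(3) b(3) by (simp add: add_ac)
      finally have "Q s = partial_deriv k (partial_deriv l f) (x + a *\<^sub>R l + b *\<^sub>R k)"
        using s by (simp add: power2_eq_square)
      then show ?thesis using a b by blast
    qed
    show ?thesis
    proof (rule tendstoI)
      fix e :: real assume "e > 0"
      then obtain d where d: "d > 0"
        "\<And>y. dist y x < d \<Longrightarrow> dist (partial_deriv k (partial_deriv l f) y) (partial_deriv k (partial_deriv l f) x) < e"
        using cont unfolding continuous_on_iff by (metis UNIV_I)
      \<comment> \<open>The intermediate point is at distance at most a + b < 2 s from x, hence the
        bound d / 2.\<close>
      have "dist (Q s) (partial_deriv k (partial_deriv l f) x) < e" if s: "0 < s" "s < d / 2" for s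
      proof -
        obtain a b where ab: "0 < a" "a < s" "0 < b" "b < s"
          "Q s = partial_deriv k (partial_deriv l f) (x + a *\<^sub>R l + b *\<^sub>R k)"
          using ex[OF s(1)] by blast
        have "norm (a *\<^sub>R l + b *\<^sub>R k) \<le> a + b"
          using ab k l by (intro norm_triangle_le) simp
        then have "dist (x + a *\<^sub>R l + b *\<^sub>R k) x < d"
          using ab s by (simp add: dist_norm)
        then show ?thesis using d ab by simp
      qed
      then show "eventually (\<lambda>s. dist (Q s) (partial_deriv k (partial_deriv l f) x) < e) (at_right 0)"
        unfolding eventually_at_right_field using d(1) by (intro exI[of _ "d/2"]) auto
    qed
  qed
  show ?thesis
    by (rule tendsto_unique[OF _ lim[OF i j] lim[OF j i]]) auto
qed

section \<open>Algebra of smooth functions and of the Laplacian\<close>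

lemma smooth_onD: "smooth_on S f \<Longrightarrow> Ck_on k S f"
  by (simp add: smooth_on_def)

lemma smooth_on_partial: "smooth_on S f \<Longrightarrow> i \<in> Basis \<Longrightarrow> smooth_on S (partial_deriv i f)"
  unfolding smooth_on_def by (meson Ck_on.simps(2))

lemma smooth_on_differentiable: "smooth_on S f \<Longrightarrow> x \<in> S \<Longrightarrow> f differentiable (at x)"
  unfolding smooth_on_def by (meson Ck_on.simps(2))

lemma smooth_on_continuous: "smooth_on S f \<Longrightarrow> continuous_on S f"
  unfolding smooth_on_def by (meson Ck_on.simps(1))

lemma smooth_on_const [simp]: "smooth_on S (\<lambda>x. c)"
  by (simp add: smooth_on_def)

lemma smooth_on_inner [simp]: "smooth_on S (\<lambda>x. x \<bullet> b)"
  by (simp add: smooth_on_def)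

lemma smooth_on_add: "smooth_on UNIV f \<Longrightarrow> smooth_on UNIV g \<Longrightarrow> smooth_on UNIV (\<lambda>x. f x + g x)"
  by (simp add: smooth_on_def Ck_on_add)

lemma smooth_on_mult: "smooth_on UNIV f \<Longrightarrow> smooth_on UNIV g \<Longrightarrow> smooth_on UNIV (\<lambda>x. f x * g x)"
  by (simp add: smooth_on_def Ck_on_mult)

lemma smooth_on_diff: "smooth_on UNIV f \<Longrightarrow> smooth_on UNIV g \<Longrightarrow> smooth_on UNIV (\<lambda>x. f x - g x)"
  using smooth_on_add[of f "\<lambda>x. (-1) * g x"] smooth_on_mult[of "\<lambda>x. -1" g] by simp

lemma smooth_on_sum:
  "finite I \<Longrightarrow> (\<And>k. k \<in> I \<Longrightarrow> smooth_on UNIV (f k)) \<Longrightarrow> smooth_on UNIV (\<lambda>x. \<Sum>k\<in>I. f k x)"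
  by (simp add: smooth_on_def Ck_on_sum)

lemma smooth_on_prod:
  "finite I \<Longrightarrow> (\<And>k. k \<in> I \<Longrightarrow> smooth_on UNIV (f k)) \<Longrightarrow> smooth_on UNIV (\<lambda>x. \<Prod>k\<in>I. f k x)"
  by (simp add: smooth_on_def Ck_on_prod)

lemma smooth_on_affine: "smooth_on UNIV f \<Longrightarrow> smooth_on UNIV (\<lambda>x. f (a + c *\<^sub>R x))"
  by (simp add: smooth_on_def Ck_on_affine)

lemma smooth_on_laplacian: "smooth_on UNIV f \<Longrightarrow> smooth_on UNIV (laplacian f)"
  unfolding laplacian_def[abs_def] by (intro smooth_on_sum smooth_on_partial) auto

lemma partial_deriv_laplacian_commute:
  assumes f: "smooth_on UNIV f" and i: "i \<in> Basis"
  shows "partial_deriv i (laplacian f) = laplacian (partial_deriv i f)"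
proof
  fix x
  have comm: "partial_deriv i (partial_deriv k g) = partial_deriv k (partial_deriv i g)"
    if "k \<in> Basis" "smooth_on UNIV g" for k g
    using partial_deriv_commute[OF smooth_onD[OF that(2)] i that(1)] by auto
  have "partial_deriv i (laplacian f) x = (\<Sum>k\<in>Basis. partial_deriv i (partial_deriv k (partial_deriv k f)) x)"
    unfolding laplacian_def[abs_def]
    by (rule partial_deriv_sum) (auto intro!: smooth_on_differentiable[of UNIV] smooth_on_partial f)
  also have "\<dots> = (\<Sum>k\<in>Basis. partial_deriv k (partial_deriv k (partial_deriv i f)) x)"
    using f by (intro sum.cong) (auto simp: comm smooth_on_partial)
  finally show "partial_deriv i (laplacian f) x = laplacian (partial_deriv i f) x"
    by (simp add: laplacian_def)
qed

lemma laplacian_cong: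
  fixes f g :: "'a::euclidean_space \<Rightarrow> real"
  assumes S: "open S" "x \<in> S" and eq: "\<And>y. y \<in> S \<Longrightarrow> f y = g y" and f: "Ck_on 2 S f"
  shows "laplacian g x = laplacian f x"
  unfolding laplacian_def
proof (rule sum.cong[OF refl])
  fix i :: 'a assume i: "i \<in> Basis"
  show "partial_deriv i (partial_deriv i g) x = partial_deriv i (partial_deriv i f) x"
  proof (rule partial_deriv_cong[OF S])
    show "partial_deriv i f y = partial_deriv i g y" if "y \<in> S" for y
      using partial_deriv_cong[OF S(1) that eq, where i = i] f that by (simp add: numeral_2_eq_2)
    show "partial_deriv i f differentiable at x"
      using f S i by (simp add: numeral_2_eq_2)
  qed
qed

lemma laplacian_cmult:
  fixes f :: "'a::euclidean_space \<Rightarrow> real"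
  assumes "smooth_on UNIV f"
  shows "laplacian (\<lambda>y. c * f y) x = c * laplacian f x"
proof -
  have p: "partial_deriv i (\<lambda>y. c * f y) = (\<lambda>y. c * partial_deriv i f y)" if "smooth_on UNIV f" for i and f :: "'a \<Rightarrow> real"
    by (rule ext) (rule partial_deriv_cmult[OF smooth_on_differentiable[OF that UNIV_I]])
  show ?thesis
    using assms smooth_on_partial[OF assms] by (simp add: laplacian_def p sum_distrib_left)
qed

lemma grad_eq_0_iff: "grad f x = 0 \<longleftrightarrow> (\<forall>i\<in>Basis. partial_deriv i f x = 0)"
proof -
  have "grad f x \<bullet> j = partial_deriv j f x" if "j \<in> Basis" for j
    using that by (simp add: grad_def inner_sum_left inner_Basis if_distrib cong: if_cong)
  then show ?thesis by (metis euclidean_all_zero_iff)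
qed

section \<open>Smooth cut-off functions\<close>

text \<open>The derivatives of exp(-1/t), extended by zero to t <= 0, all have this form. Carrying
  the polynomial as a parameter makes the family closed under differentiation.\<close>

definition expinv :: "real poly \<Rightarrow> real \<Rightarrow> real" where
  "expinv p t = (if t > 0 then poly p (1 / t) * exp (- (1 / t)) else 0)"

text \<open>With \<open>s = 1 / t\<close> one has \<open>d / dt = - s\<^sup>2 d / ds\<close>.\<close>

definition dexpinv :: "real poly \<Rightarrow> real poly" where
  "dexpinv p = [:0, 0, 1:] * (p - pderiv p)"

lemma tendsto_poly_exp_minus: "((\<lambda>s. poly q s * exp (- s)) \<longlongrightarrow> (0::real)) at_top"
proof -
  have "((\<lambda>s::real. \<Sum>k\<le>degree q. coeff q k * (s ^ k / exp s)) \<longlongrightarrow> (\<Sum>k\<le>degree q. coeff q k * 0)) at_top"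
    by (intro tendsto_sum tendsto_mult tendsto_const tendsto_power_div_exp_0)
  then show ?thesis
    by (simp add: poly_altdef sum_distrib_right exp_minus divide_inverse mult.assoc)
qed

lemma expinv_nonpos [simp]: "t \<le> 0 \<Longrightarrow> expinv p t = 0"
  by (simp add: expinv_def)

lemma expinv_has_derivative: "(expinv p has_real_derivative expinv (dexpinv p) t) (at t)"
proof -
  consider "t > 0" | "t < 0" | "t = 0" by linarith
  then show ?thesis
  proof cases
    case 1
    have "((\<lambda>t. poly p (1 / t) * exp (- (1 / t))) has_real_derivative expinv (dexpinv p) t) (at t)"
      using 1 by (auto intro!: derivative_eq_intros DERIV_chain2[OF poly_DERIV]
          simp: expinv_def dexpinv_def field_simps power2_eq_square)
    then show ?thesis
      by (rule has_field_derivative_transform_within_open[of _ _ _ "{0<..}"]) (use 1 in \<open>auto simp: expinv_def\<close>)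
  next
    case 2
    have "((\<lambda>t. 0) has_real_derivative expinv (dexpinv p) t) (at t)"
      using 2 by (simp add: expinv_def)
    then show ?thesis
      by (rule has_field_derivative_transform_within_open[of _ _ _ "{..<0}"]) (use 2 in \<open>auto simp: expinv_def\<close>)
  next
    case 3
    have "((\<lambda>h. expinv p h / h) \<longlongrightarrow> 0) (at_right 0)"
    proof -
      \<comment> \<open>Dividing by h multiplies by s = 1 / h, and \<open>pCons 0 p\<close> is the
        polynomial s p(s).\<close>
      have "((\<lambda>h. poly (pCons 0 p) (inverse h) * exp (- inverse h)) \<longlongrightarrow> (0::real)) (at_right 0)"
        by (rule filterlim_compose[OF tendsto_poly_exp_minus filterlim_inverse_at_top_right])
      moreover have "eventually (\<lambda>h::real. poly (pCons 0 p) (inverse h) * exp (- inverse h) = expinv p h / h) (at_right 0)"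
        unfolding eventually_at_right_field
        by (intro exI[of _ 1]) (auto simp: expinv_def divide_inverse)
      ultimately show ?thesis
        by (rule Lim_transform_eventually)
    qed
    moreover have "((\<lambda>h. expinv p h / h) \<longlongrightarrow> 0) (at_left 0)"
    proof -
      have "eventually (\<lambda>h::real. 0 = expinv p h / h) (at_left 0)"
        unfolding eventually_at_left_field
        by (intro exI[of _ "-1"]) (auto simp: expinv_def)
      then show ?thesis
        by (rule Lim_transform_eventually[OF tendsto_const])
    qed
    ultimately have "((\<lambda>h. expinv p h / h) \<longlongrightarrow> 0) (at 0)"
      by (simp add: filterlim_split_at)
    then show ?thesis
      using 3 by (simp add: DERIV_def)
  qed
qed

lemma Ck_on_expinv:
  assumes "open S" "Ck_on k S q"
  shows "Ck_on k S (\<lambda>x. expinv p (q x))"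
  by (rule Ck_on_compose_real[of S "range expinv"]) (use assms expinv_has_derivative in auto)

lemma smooth_on_expinv: "smooth_on UNIV q \<Longrightarrow> smooth_on UNIV (\<lambda>x. expinv p (q x))"
  by (simp add: smooth_on_def Ck_on_expinv)

section \<open>Test functions\<close>

lemma test_functionI:
  fixes \<psi> :: "'a::euclidean_space \<Rightarrow> real"
  assumes "smooth_on UNIV \<psi>" "compact K" "K \<subseteq> \<Omega>" "\<And>x. x \<notin> K \<Longrightarrow> \<psi> x = 0"
  shows "test_function \<Omega> \<psi>"
proof -
  have "closure {x. \<psi> x \<noteq> 0} \<subseteq> K"
    using assms(2,4) by (intro closure_minimal compact_imp_closed) auto
  moreover have "compact (closure {x. \<psi> x \<noteq> 0})"
    using calculation assms(2) by (meson bounded_subset closed_closure compact_eq_bounded_closed)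
  ultimately show ?thesis
    using assms by (auto simp: test_function_def)
qed

lemma test_functionE:
  assumes "test_function \<Omega> \<psi>"
  obtains K where "compact K" "K \<subseteq> \<Omega>" "\<And>x. x \<notin> K \<Longrightarrow> \<psi> x = 0"
proof
  show "compact (closure {x. \<psi> x \<noteq> 0})" "closure {x. \<psi> x \<noteq> 0} \<subseteq> \<Omega>"
    using assms by (auto simp: test_function_def)
  show "\<psi> x = 0" if "x \<notin> closure {x. \<psi> x \<noteq> 0}" for x
    using that closure_subset[of "{x. \<psi> x \<noteq> 0}"] by auto
qed

lemma test_function_smooth: "test_function \<Omega> \<psi> \<Longrightarrow> smooth_on UNIV \<psi>"
  by (simp add: test_function_def)

lemma test_function_mono: "test_function \<Omega> \<psi> \<Longrightarrow> \<Omega> \<subseteq> \<Omega>' \<Longrightarrow> test_function \<Omega>' \<psi>"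
  by (auto simp: test_function_def)

lemma test_function_UNIV: "test_function \<Omega> \<psi> \<Longrightarrow> test_function UNIV \<psi>"
  by (auto simp: test_function_def)

lemma test_function_differentiable: "test_function \<Omega> \<psi> \<Longrightarrow> \<psi> differentiable (at x)"
  using smooth_on_differentiable test_function_smooth by blast

lemma test_function_zero_outside: "test_function \<Omega> \<psi> \<Longrightarrow> x \<notin> \<Omega> \<Longrightarrow> \<psi> x = 0"
  by (elim test_functionE) blast

lemma partial_deriv_zero_outside:
  assumes "compact K" "\<And>x. x \<notin> K \<Longrightarrow> \<psi> x = 0" "x \<notin> K"
  shows "partial_deriv i \<psi> x = 0"
proof -
  have "open (- K)"
    using assms(1) by (simp add: compact_imp_closed open_Compl)
  then show ?thesis
    using partial_deriv_cong[of "- K" x "\<lambda>_. 0" \<psi> i] assms by simp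
qed

lemma test_function_partial:
  assumes "test_function \<Omega> \<psi>" "i \<in> Basis"
  shows "test_function \<Omega> (partial_deriv i \<psi>)"
proof -
  obtain K where K: "compact K" "K \<subseteq> \<Omega>" "\<And>x. x \<notin> K \<Longrightarrow> \<psi> x = 0"
    using assms(1) by (rule test_functionE) blast
  show ?thesis
  proof (rule test_functionI[OF _ K(1,2)])
    show "smooth_on UNIV (partial_deriv i \<psi>)"
      using assms test_function_smooth smooth_on_partial by blast
    show "partial_deriv i \<psi> x = 0" if "x \<notin> K" for x
      using partial_deriv_zero_outside[OF K(1), of \<psi> x i] K(3) that by simp
  qed
qed

lemma test_function_sum:
  assumes "finite I" "\<And>k. k \<in> I \<Longrightarrow> test_function \<Omega> (f k)"
  shows "test_function \<Omega> (\<lambda>x. \<Sum>k\<in>I. f k x)"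
proof (rule test_functionI)
  show "smooth_on UNIV (\<lambda>x. \<Sum>k\<in>I. f k x)"
    using assms by (intro smooth_on_sum test_function_smooth) auto
  show "compact (\<Union>k\<in>I. closure {x. f k x \<noteq> 0})" "(\<Union>k\<in>I. closure {x. f k x \<noteq> 0}) \<subseteq> \<Omega>"
    using assms by (auto simp: test_function_def intro!: compact_UN)
  show "(\<Sum>k\<in>I. f k x) = 0" if "x \<notin> (\<Union>k\<in>I. closure {x. f k x \<noteq> 0})" for x
  proof (intro sum.neutral ballI)
    fix k assume "k \<in> I"
    then show "f k x = 0"
      using that closure_subset[of "{x. f k x \<noteq> 0}"] by auto
  qed
qed

lemma test_function_laplacian: "test_function \<Omega> \<psi> \<Longrightarrow> test_function \<Omega> (laplacian \<psi>)"
  unfolding laplacian_def[abs_def] by (intro test_function_sum test_function_partial) auto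

lemma test_function_mult:
  assumes "test_function \<Omega> \<psi>" "smooth_on UNIV g"
  shows "test_function \<Omega> (\<lambda>x. g x * \<psi> x)"
proof -
  obtain K where K: "compact K" "K \<subseteq> \<Omega>" "\<And>x. x \<notin> K \<Longrightarrow> \<psi> x = 0"
    using assms(1) by (rule test_functionE) blast
  show ?thesis
    by (rule test_functionI[OF _ K(1,2)]) (use K(3) assms in \<open>auto intro: smooth_on_mult test_function_smooth\<close>)
qed

lemma test_function_cmult: "test_function \<Omega> \<psi> \<Longrightarrow> test_function \<Omega> (\<lambda>x. c * \<psi> x)"
  by (rule test_function_mult) auto

lemma test_function_add:
  assumes "test_function \<Omega> f" "test_function \<Omega> g"
  shows "test_function \<Omega> (\<lambda>x. f x + g x)"
proof -
  obtain K L where K: "compact K" "K \<subseteq> \<Omega>" "\<And>x. x \<notin> K \<Longrightarrow> f x = 0"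
    and L: "compact L" "L \<subseteq> \<Omega>" "\<And>x. x \<notin> L \<Longrightarrow> g x = 0"
    using assms by (meson test_functionE)
  show ?thesis
    by (rule test_functionI[of _ "K \<union> L"])
      (use K L assms in \<open>auto intro: smooth_on_add test_function_smooth\<close>)
qed

lemma test_function_continuous: "test_function \<Omega> \<psi> \<Longrightarrow> continuous_on S \<psi>"
  using smooth_on_continuous test_function_smooth continuous_on_subset by blast

lemma test_function_measurable [measurable_dest]: "test_function \<Omega> \<psi> \<Longrightarrow> \<psi> \<in> borel_measurable borel"
  by (intro borel_measurable_continuous_onI test_function_continuous)

lemma test_function_bounded:
  assumes "test_function \<Omega> \<psi>"
  obtains C where "C > 0" "\<And>x. \<bar>\<psi> x\<bar> \<le> C"
proof -
  obtain K where K: "compact K" "K \<subseteq> \<Omega>" "\<And>x. x \<notin> K \<Longrightarrow> \<psi> x = 0"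
    using assms(1) by (rule test_functionE) blast
  have "bounded (\<psi> ` K)"
    using assms K(1) by (intro compact_imp_bounded compact_continuous_image test_function_continuous)
  then obtain C where C: "\<And>x. x \<in> K \<Longrightarrow> \<bar>\<psi> x\<bar> \<le> C"
    by (auto simp: bounded_iff)
  show thesis
  proof (rule that[of "max C 1"])
    show "\<bar>\<psi> x\<bar> \<le> max C 1" for x
      using C[of x] K(3)[of x] by (cases "x \<in> K") auto
  qed simp
qed

lemma integrable_mult_bounded:
  fixes U g :: "'c \<Rightarrow> real"
  assumes U: "integrable M U" and g: "g \<in> borel_measurable M" and C: "\<And>x. \<bar>g x\<bar> \<le> C"
  shows "integrable M (\<lambda>x. U x * g x)"
proof (rule Bochner_Integration.integrable_bound)
  show "integrable M (\<lambda>x. C * \<bar>U x\<bar>)" using U by simp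
  show "(\<lambda>x. U x * g x) \<in> borel_measurable M"
    using borel_measurable_integrable[OF U] g by measurable
  have "norm (U x * g x) \<le> C * \<bar>U x\<bar>" for x
    using mult_right_mono[OF C, of "\<bar>U x\<bar>" x] by (simp add: abs_mult mult.commute)
  then show "AE x in M. norm (U x * g x) \<le> norm (C * \<bar>U x\<bar>)"
    unfolding real_norm_def by (intro AE_I2) (rule order_trans[OF _ abs_ge_self])
qed

lemma test_function_integrable_mult:
  assumes \<psi>: "test_function \<Omega> \<psi>" and U: "integrable lborel U"
  shows "integrable lborel (\<lambda>x. U x * \<psi> x)"
proof -
  obtain C where C: "\<And>x. \<bar>\<psi> x\<bar> \<le> C"
    using \<psi> by (rule test_function_bounded) blast
  show ?thesis
    by (rule integrable_mult_bounded[OF U _ C]) (use test_function_measurable[OF \<psi>] in simp)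
qed

lemma integrable_indicator_compact:
  assumes "compact K"
  shows "integrable lborel (indicator K :: 'a::euclidean_space \<Rightarrow> real)"
  using assms emeasure_bounded_finite[OF compact_imp_bounded[OF assms]]
  by (intro integrable_real_indicator) (auto simp: compact_imp_closed)

lemma test_function_integrable:
  assumes "test_function \<Omega> \<psi>"
  shows "integrable lborel \<psi>"
proof -
  obtain K where K: "compact K" "K \<subseteq> \<Omega>" "\<And>x. x \<notin> K \<Longrightarrow> \<psi> x = 0"
    using assms(1) by (rule test_functionE) blast
  have "integrable lborel (\<lambda>x. indicator K x :: real)"
    using K(1) by (rule integrable_indicator_compact)
  then have "integrable lborel (\<lambda>x. indicator K x * \<psi> x)"
    using assms test_function_integrable_mult by blast
  moreover have "(\<lambda>x. indicator K x * \<psi> x) = \<psi>"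
    using K(3) by (auto simp: fun_eq_iff indicator_def)
  ultimately show ?thesis by simp
qed

section \<open>Differentiation under the integral\<close>

text \<open>The bound on \<open>f'\<close> makes f Lipschitz in the parameter, uniformly in z, so
  the remainder of the difference quotient is dominated by 2 C |U|. The parameter space is left
  general because both the centre and the radius of a convolution are differentiated.\<close>

lemma has_derivative_integral_mult:
  fixes U :: "'c \<Rightarrow> real" and f :: "'b::real_normed_vector \<Rightarrow> 'c \<Rightarrow> real"
  assumes U: "integrable M U" and e: "e > 0"
    and der: "\<And>x z. x \<in> ball x0 e \<Longrightarrow> ((\<lambda>x. f x z) has_derivative f' x z) (at x)"
    and bd': "\<And>x z h. x \<in> ball x0 e \<Longrightarrow> \<bar>f' x z h\<bar> \<le> C * norm h"
    and bd: "\<And>x z. x \<in> ball x0 e \<Longrightarrow> \<bar>f x z\<bar> \<le> C0"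
    and meas: "\<And>x. x \<in> ball x0 e \<Longrightarrow> f x \<in> borel_measurable M"
      "\<And>h. (\<lambda>z. f' x0 z h) \<in> borel_measurable M"
  shows "((\<lambda>x. \<integral>z. U z * f x z \<partial>M) has_derivative (\<lambda>h. \<integral>z. U z * f' x0 z h \<partial>M)) (at x0)"
proof -
  have [measurable]: "U \<in> borel_measurable M" using U by auto
  have x0: "x0 \<in> ball x0 e" using e by simp
  have int1: "integrable M (\<lambda>z. U z * f x z)" if x: "x \<in> ball x0 e" for x
    by (rule integrable_mult_bounded[OF U meas(1)[OF x] bd[OF x]])
  have int2: "integrable M (\<lambda>z. U z * f' x0 z h)" for h
    by (rule integrable_mult_bounded[OF U meas(2) bd'[OF x0]])
  have lin: "linear (f' x0 z)" for z
    using der[OF x0] has_derivative_linear by blast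
  have "bounded_linear (\<lambda>h. \<integral>z. U z * f' x0 z h \<partial>M)"
  proof (rule bounded_linear_intro[where K="C * (\<integral>z. \<bar>U z\<bar> \<partial>M)"])
    show "(\<integral>z. U z * f' x0 z (h + k) \<partial>M) = (\<integral>z. U z * f' x0 z h \<partial>M) + (\<integral>z. U z * f' x0 z k \<partial>M)" for h k
      using int2 by (simp add: linear_add[OF lin] distrib_left)
    show "(\<integral>z. U z * f' x0 z (r *\<^sub>R h) \<partial>M) = r *\<^sub>R (\<integral>z. U z * f' x0 z h \<partial>M)" for r h
      by (simp add: linear_cmul[OF lin] mult.left_commute)
    show "norm (\<integral>z. U z * f' x0 z h \<partial>M) \<le> norm h * (C * (\<integral>z. \<bar>U z\<bar> \<partial>M))" for h
    proof -
      have "norm (\<integral>z. U z * f' x0 z h \<partial>M) \<le> (\<integral>z. norm (U z * f' x0 z h) \<partial>M)"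
        by (rule integral_norm_bound)
      also have "\<dots> \<le> (\<integral>z. (C * norm h) * \<bar>U z\<bar> \<partial>M)"
      proof (rule integral_mono)
        show "integrable M (\<lambda>z. norm (U z * f' x0 z h))" using int2 by simp
        show "integrable M (\<lambda>z. (C * norm h) * \<bar>U z\<bar>)" using U by simp
        show "norm (U z * f' x0 z h) \<le> (C * norm h) * \<bar>U z\<bar>" for z
          using mult_left_mono[OF bd'[OF x0, of z h], of "\<bar>U z\<bar>"] by (simp add: abs_mult mult_ac)
      qed
      finally show ?thesis by (simp add: mult_ac)
    qed
  qed
  moreover have "((\<lambda>y. norm ((\<integral>z. U z * f y z \<partial>M) - (\<integral>z. U z * f x0 z \<partial>M) - (\<integral>z. U z * f' x0 z (y - x0) \<partial>M)) / norm (y - x0)) \<longlongrightarrow> 0) (at x0)"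
    unfolding tendsto_at_iff_sequentially
  proof (intro allI impI)
    fix X :: "nat \<Rightarrow> 'b" assume X: "\<forall>i. X i \<in> UNIV - {x0}" "X \<longlonglongrightarrow> x0"
    define q where "q y z = (f y z - f x0 z - f' x0 z (y - x0)) / norm (y - x0)" for y z
    \<comment> \<open>The bounds hold only in the ball, so the sequence is set to zero while
      \<open>X n\<close> is still outside; this affects finitely many n.\<close>
    define s where "s n z = (if X n \<in> ball x0 e then U z * q (X n) z else 0)" for n z
    have ev: "eventually (\<lambda>n. X n \<in> ball x0 e) sequentially"
      using X(2) e by (auto simp: tendsto_iff dist_commute)
    have "(\<lambda>n. \<integral>z. s n z \<partial>M) \<longlonglongrightarrow> (\<integral>z. 0 \<partial>M)"
    proof (rule integral_dominated_convergence[where w="\<lambda>z. 2 * C * \<bar>U z\<bar>"])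
      show "s n \<in> borel_measurable M" for n
      proof (cases "X n \<in> ball x0 e")
        case True
        then have [measurable]: "f (X n) \<in> borel_measurable M" "f x0 \<in> borel_measurable M"
          "(\<lambda>z. f' x0 z (X n - x0)) \<in> borel_measurable M"
          using meas x0 by auto
        show ?thesis using True unfolding s_def[abs_def] q_def by simp
      qed (simp add: s_def[abs_def])
      show "AE z in M. (\<lambda>n. s n z) \<longlonglongrightarrow> 0"
      proof (intro AE_I2)
        fix z
        have "((\<lambda>y. norm (q y z)) \<longlongrightarrow> 0) (at x0)"
          using der[OF x0, of z] by (simp add: has_derivative_iff_norm q_def)
        then have "(\<lambda>n. norm (q (X n) z)) \<longlonglongrightarrow> 0"
          using X unfolding tendsto_at_iff_sequentially by (auto simp: o_def)
        then have "(\<lambda>n. U z * q (X n) z) \<longlonglongrightarrow> 0"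
          by (intro tendsto_mult_right_zero) (simp only: tendsto_norm_zero_iff)
        then show "(\<lambda>n. s n z) \<longlonglongrightarrow> 0"
          by (rule Lim_transform_eventually) (use ev in \<open>eventually_elim, simp add: s_def\<close>)
      qed
      show "AE z in M. norm (s n z) \<le> 2 * C * \<bar>U z\<bar>" for n
      proof (intro AE_I2)
        fix z
        \<comment> \<open>Nonnegativity of C follows from the bound on \<open>f'\<close> in a
          nonzero direction.\<close>
        have C: "C * norm (X n - x0) \<ge> 0"
          using bd'[OF x0, of z "X n - x0"] by linarith
        have pos: "norm (X n - x0) > 0" using X(1) by auto
        then have C0: "C \<ge> 0" using C by (simp add: zero_le_mult_iff)
        show "norm (s n z) \<le> 2 * C * \<bar>U z\<bar>"
        proof (cases "X n \<in> ball x0 e")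
          case True
          have "norm (f (X n) z - f x0 z) \<le> C * norm (X n - x0)"
          proof (rule differentiable_bound[OF convex_ball _ _ True x0])
            show "((\<lambda>x. f x z) has_derivative f' x z) (at x within ball x0 e)" if "x \<in> ball x0 e" for x
              using der[OF that] has_derivative_at_withinI by blast
            show "onorm (f' x z) \<le> C" if "x \<in> ball x0 e" for x
              using bd'[OF that] C0 by (intro onorm_bound) auto
          qed
          then have "\<bar>f (X n) z - f x0 z - f' x0 z (X n - x0)\<bar> \<le> 2 * C * norm (X n - x0)"
            using bd'[OF x0, of z "X n - x0"] by simp
          then have "\<bar>q (X n) z\<bar> \<le> 2 * C"
            using pos by (simp add: q_def abs_divide divide_le_eq)
          then show ?thesis
            using True mult_left_mono[of "\<bar>q (X n) z\<bar>" "2 * C" "\<bar>U z\<bar>"] by (simp add: s_def abs_mult mult_ac)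
        qed (simp add: s_def C0)
      qed
      show "integrable M (\<lambda>z. 2 * C * \<bar>U z\<bar>)" using U by simp
    qed simp
    then have "(\<lambda>n. norm (\<integral>z. s n z \<partial>M)) \<longlonglongrightarrow> 0"
      unfolding tendsto_norm_zero_iff by simp
    moreover have "eventually (\<lambda>n. norm (\<integral>z. s n z \<partial>M) =
        ((\<lambda>y. norm ((\<integral>z. U z * f y z \<partial>M) - (\<integral>z. U z * f x0 z \<partial>M) - (\<integral>z. U z * f' x0 z (y - x0) \<partial>M)) / norm (y - x0)) \<circ> X) n) sequentially"
      using ev
    proof eventually_elim
      case (elim n)
      have "(\<integral>z. s n z \<partial>M) = (\<integral>z. (U z * f (X n) z - U z * f x0 z - U z * f' x0 z (X n - x0)) / norm (X n - x0) \<partial>M)"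
        using elim by (intro Bochner_Integration.integral_cong) (auto simp: s_def q_def algebra_simps)
      also have "\<dots> = ((\<integral>z. U z * f (X n) z \<partial>M) - (\<integral>z. U z * f x0 z \<partial>M) - (\<integral>z. U z * f' x0 z (X n - x0) \<partial>M)) / norm (X n - x0)"
        using int1[OF elim] int1[OF x0] int2[of "X n - x0"] by simp
      finally show ?case by simp
    qed
    ultimately show "((\<lambda>y. norm ((\<integral>z. U z * f y z \<partial>M) - (\<integral>z. U z * f x0 z \<partial>M) - (\<integral>z. U z * f' x0 z (y - x0) \<partial>M)) / norm (y - x0)) \<circ> X) \<longlonglongrightarrow> 0"
      by (rule Lim_transform_eventually)
  qed
  ultimately show ?thesis
    by (simp add: has_derivative_iff_norm)
qed

lemma integral_lborel_translate:
  fixes f :: "'a::euclidean_space \<Rightarrow> real"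
  assumes [measurable]: "f \<in> borel_measurable borel"
  shows "(LBINT z. f (a + z)) = (LBINT z. f z)"
proof -
  have "(\<integral>z. f z \<partial>distr lborel borel ((+) a)) = (LBINT z. f (a + z))"
    by (rule integral_distr) auto
  then show ?thesis
    by (simp add: lborel_distr_plus)
qed

text \<open>By translation invariance the integral of psi(t i + z) over z does not depend on t, and
  its derivative at t = 0 is the integral in question.\<close>

lemma integral_partial_deriv_test:
  fixes \<psi> :: "'a::euclidean_space \<Rightarrow> real"
  assumes \<psi>: "test_function \<Omega> \<psi>" and i: "i \<in> Basis"
  shows "(LBINT x. partial_deriv i \<psi> x) = 0"
proof -
  obtain K where K: "compact K" "K \<subseteq> \<Omega>" "\<And>x. x \<notin> K \<Longrightarrow> \<psi> x = 0"
    using \<psi> by (rule test_functionE) blast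
  obtain R where R: "\<And>x. x \<in> K \<Longrightarrow> norm x \<le> R"
    using K(1) compact_imp_bounded bounded_iff by metis
  have \<psi>i: "test_function \<Omega> (partial_deriv i \<psi>)"
    using \<psi> i by (rule test_function_partial)
  obtain C0 where C0: "\<And>x. \<bar>\<psi> x\<bar> \<le> C0"
    using \<psi> by (rule test_function_bounded) blast
  obtain C where C: "\<And>x. \<bar>partial_deriv i \<psi> x\<bar> \<le> C"
    using \<psi>i by (rule test_function_bounded) blast
  note [measurable] = test_function_measurable[OF \<psi>] test_function_measurable[OF \<psi>i]
  \<comment> \<open>An integrable weight is required for differentiation under the integral. The
    margin 1 beyond R keeps the weight equal to 1 on the support of all translates with |t| <
    1.\<close>
  define U where "U x = (indicator (cball 0 (R + 1)) x :: real)" for x :: 'a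
  have U: "integrable lborel U"
    unfolding U_def[abs_def] by (rule integrable_indicator_compact) simp
  have "((\<lambda>t. LBINT z. U z * \<psi> (t *\<^sub>R i + z)) has_derivative
      (\<lambda>h. LBINT z. U z * (partial_deriv i \<psi> (0 *\<^sub>R i + z) * h))) (at (0::real))"
  proof (rule has_derivative_integral_mult[OF U zero_less_one, where C=C and ?C0.0=C0])
    show "((\<lambda>t. \<psi> (t *\<^sub>R i + z)) has_derivative (*) (partial_deriv i \<psi> (t *\<^sub>R i + z))) (at t)" for t z
      using has_real_derivative_along_line[OF test_function_differentiable[OF \<psi>], where y = z and t = t and k = i]
      by (simp add: has_field_derivative_def add.commute)
    show "\<bar>partial_deriv i \<psi> (t *\<^sub>R i + z) * h\<bar> \<le> C * norm h" for t z h
      using C by (simp add: abs_mult mult_right_mono)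
  qed (use C0 in auto)
  then have "((\<lambda>t. LBINT z. U z * \<psi> (t *\<^sub>R i + z)) has_derivative
      (\<lambda>h. LBINT z. U z * (partial_deriv i \<psi> z * h))) (at 0)"
    by simp
  moreover have "((\<lambda>t. LBINT z. U z * \<psi> (t *\<^sub>R i + z)) has_derivative (\<lambda>h. 0)) (at 0)"
  proof (rule has_derivative_transform_within_open[of "\<lambda>t. LBINT z. \<psi> z" _ _ _ "ball 0 1"])
    fix t :: real assume t: "t \<in> ball 0 1"
    have "U z * \<psi> (t *\<^sub>R i + z) = \<psi> (t *\<^sub>R i + z)" for z
    proof (cases "t *\<^sub>R i + z \<in> K")
      case True
      have "norm z \<le> norm (t *\<^sub>R i + z) + norm (t *\<^sub>R i)"
        using norm_triangle_ineq4[of "t *\<^sub>R i + z" "t *\<^sub>R i"] by simp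
      also have "\<dots> \<le> R + 1"
        using R[OF True] t i by simp
      finally show ?thesis by (simp add: U_def)
    qed (simp add: K)
    then show "(LBINT z. \<psi> z) = (LBINT z. U z * \<psi> (t *\<^sub>R i + z))"
      using test_function_measurable[OF \<psi>] by (simp only: integral_lborel_translate)
  qed auto
  ultimately have "(\<lambda>h. LBINT z. U z * (partial_deriv i \<psi> z * h)) = (\<lambda>h. 0)"
    by (rule has_derivative_unique)
  then have "(LBINT z. U z * (partial_deriv i \<psi> z * 1)) = 0"
    by metis
  moreover have "U z * (partial_deriv i \<psi> z * 1) = partial_deriv i \<psi> z" for z
  proof (cases "norm z \<le> R")
    case False
    then have "z \<notin> K" using R by blast
    then have "partial_deriv i \<psi> z = 0"
      using partial_deriv_zero_outside[OF K(1), of \<psi> z i] K(3) by simp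
    then show ?thesis by simp
  qed (simp add: U_def)
  ultimately show ?thesis by (simp only:)
qed

section \<open>The fundamental lemma of the calculus of variations\<close>

text \<open>Boxes form an intersection-stable generator of the Borel sets, and the sets over which G
  integrates to zero are closed under complements and disjoint unions. Complements need the total
  integral to vanish, which holds because G lives in a single box.\<close>

lemma AE_zero_of_box_integrals:
  fixes G :: "'a::euclidean_space \<Rightarrow> real"
  assumes G: "integrable lborel G"
    and box0: "\<And>l u. (LINT x:box l u|lborel. G x) = 0"
    and outside: "\<And>x. x \<notin> box a b \<Longrightarrow> G x = 0"
  shows "AE x in lborel. G x = 0"
proof -
  let ?E = "range (\<lambda>(a, b). box a b :: 'a set)"
  have borelE: "sets borel = sigma_sets UNIV ?E"
    by (simp add: borel_eq_box)
  have "(LINT x:UNIV|lborel. G x) = (LINT x:box a b|lborel. G x)"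
    unfolding set_lebesgue_integral_def
    by (intro Bochner_Integration.integral_cong) (auto simp: indicator_def outside)
  then have total: "(LINT x:UNIV|lborel. G x) = 0"
    using box0 by simp
  have setint: "set_integrable lborel A G" if "A \<in> sets borel" for A
    using G that unfolding set_integrable_def by (intro integrable_mult_indicator) auto
  have zero: "(LINT x:A|lborel. G x) = 0" if A: "A \<in> sets borel" for A
  proof -
    have "Int_stable ?E" "?E \<subseteq> Pow UNIV" "A \<in> sigma_sets UNIV ?E"
      using A borelE by (auto simp: Int_stable_def box_Int_box)
    then show ?thesis
    proof (induction rule: sigma_sets_induct_disjoint)
      case (basic A)
      then show ?case using box0 by auto
    next
      case empty
      show ?case by (simp add: set_lebesgue_integral_def)
    next
      case (compl A)
      then have [measurable]: "A \<in> sets borel" using borelE by blast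
      have "(LINT x:UNIV|lborel. G x) = (LINT x:A \<union> (UNIV - A)|lborel. G x)"
        by (simp add: Un_absorb1)
      also have "\<dots> = (LINT x:A|lborel. G x) + (LINT x:UNIV - A|lborel. G x)"
        by (rule set_integral_Un) (auto intro!: setint)
      finally show ?case using total compl by simp
    next
      case (union A)
      then have A: "A i \<in> sets borel" for i using borelE by blast
      have "(LINT x:(\<Union>i. A i)|lborel. G x) = (\<Sum>i. (LINT x:A i|lborel. G x))"
      proof (rule lebesgue_integral_countable_add)
        show "set_integrable lborel (\<Union>i. A i) G"
          using A by (intro setint) auto
        show "A i \<inter> A j = {}" if "i \<noteq> j" for i j
          using union(1) that by (auto simp: disjoint_family_on_def)
      qed (use A in auto)
      then show ?case using union by simp
    qed
  qed
  show ?thesis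
    by (rule density_unique_real[OF G]) (auto simp: zero)
qed

text \<open>A smooth approximation of the indicator of \<open>box a b\<close>: each factor exp(-1 /
  ((k + 1) s)) tends to 1 for s > 0 and is cut to 0 for s <= 0.\<close>

definition box_cutoff :: "'a::euclidean_space \<Rightarrow> 'a \<Rightarrow> nat \<Rightarrow> 'a \<Rightarrow> real" where
  "box_cutoff a b k x =
     (\<Prod>i\<in>Basis. expinv 1 (real (Suc k) * (x \<bullet> i - a \<bullet> i)) * expinv 1 (real (Suc k) * (b \<bullet> i - x \<bullet> i)))"

lemma expinv_1_bounds: "0 \<le> expinv 1 t" "expinv 1 t \<le> 1"
  by (auto simp: expinv_def)

lemma box_cutoff_bounds: "0 \<le> box_cutoff a b k x" "box_cutoff a b k x \<le> 1"
  unfolding box_cutoff_def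
  by (auto intro!: prod_nonneg prod_le_1 mult_le_one simp: expinv_1_bounds)

lemma box_cutoff_outside:
  assumes "x \<notin> box a b"
  shows "box_cutoff a b k x = 0"
proof -
  obtain i where i: "i \<in> Basis" "\<not> (a \<bullet> i < x \<bullet> i \<and> x \<bullet> i < b \<bullet> i)"
    using assms by (auto simp: mem_box)
  then have "real (Suc k) * (x \<bullet> i - a \<bullet> i) \<le> 0 \<or> real (Suc k) * (b \<bullet> i - x \<bullet> i) \<le> 0"
    by (auto simp: mult_le_0_iff)
  then have "expinv 1 (real (Suc k) * (x \<bullet> i - a \<bullet> i)) * expinv 1 (real (Suc k) * (b \<bullet> i - x \<bullet> i)) = 0"
    using expinv_nonpos mult_eq_0_iff by blast
  then show ?thesis
    unfolding box_cutoff_def using i(1) by (intro prod_zero) auto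
qed

lemma box_cutoff_tendsto: "(\<lambda>k. box_cutoff a b k x) \<longlonglongrightarrow> indicator (box a b) x"
proof (cases "x \<in> box a b")
  case True
  have "(\<lambda>k. expinv 1 (real (Suc k) * t)) \<longlonglongrightarrow> 1" if "t > 0" for t
  proof -
    have "(\<lambda>k. exp (- (1 / t * inverse (real (Suc k))))) \<longlonglongrightarrow> exp (- (1 / t * 0))"
      by (intro tendsto_intros LIMSEQ_inverse_real_of_nat)
    then show ?thesis
      using that by (simp add: expinv_def divide_inverse mult.commute)
  qed
  then have "(\<lambda>k. box_cutoff a b k x) \<longlonglongrightarrow> (\<Prod>i::'a\<in>Basis. 1 * 1)"
    unfolding box_cutoff_def using True by (intro tendsto_prod tendsto_mult) (auto simp: mem_box)
  then show ?thesis using True by simp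
qed (simp add: box_cutoff_outside)

lemma test_function_box_cutoff:
  assumes "closure (box a b) \<subseteq> \<Omega>"
  shows "test_function \<Omega> (box_cutoff a b k)"
proof (rule test_functionI)
  show "smooth_on UNIV (box_cutoff a b k)"
    unfolding box_cutoff_def[abs_def]
    by (intro smooth_on_prod smooth_on_mult smooth_on_expinv smooth_on_diff) auto
  show "compact (closure (box a b))"
    by (simp add: compact_eq_bounded_closed bounded_closure)
  show "box_cutoff a b k x = 0" if "x \<notin> closure (box a b)" for x
    using that closure_subset[of "box a b"] by (intro box_cutoff_outside) auto
qed fact

lemma AE_lebesgue_iff_negligible: "(AE x in lebesgue. P x) \<longleftrightarrow> negligible {x. \<not> P x}"
  using completion.AE_iff_null_sets[of P lborel] by (simp add: negligible_iff_null_sets)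

text \<open>Since g is only Lebesgue measurable, it is first replaced by a Borel function G
  supported in the box. Testing with cut-offs of smaller boxes and passing to the limit by dominated
  convergence makes all box integrals of G vanish.\<close>

lemma AE_zero_on_box_of_test_functions:
  fixes g :: "'a::euclidean_space \<Rightarrow> real"
  assumes g: "locally_integrable_on \<Omega> g"
    and zero: "\<And>\<psi>. test_function \<Omega> \<psi> \<Longrightarrow> (LINT x:\<Omega>|lebesgue. g x * \<psi> x) = 0"
    and ab: "cbox a b \<subseteq> \<Omega>"
  shows "AE x in lebesgue. x \<in> box a b \<longrightarrow> g x = 0"
proof -
  define Gl where "Gl x = indicator (box a b) x * g x" for x
  have "set_integrable lebesgue (cbox a b) g"
    using g ab by (auto simp: locally_integrable_on_def)
  then have "set_integrable lebesgue (box a b) g"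
    by (rule set_integrable_subset) (auto simp: box_subset_cbox)
  then have Gl: "integrable lebesgue Gl"
    by (simp add: set_integrable_def Gl_def[abs_def])
  then obtain G0 where G0 [measurable]: "G0 \<in> borel_measurable borel" and aeG0: "AE x in lborel. Gl x = G0 x"
    using completion_ex_borel_measurable_real[of Gl lborel] by auto
  define G where "G x = indicator (box a b) x * G0 x" for x
  have Gm [measurable]: "G \<in> borel_measurable borel"
    unfolding G_def[abs_def] by measurable
  have ae: "AE x in lborel. Gl x = G x"
    using aeG0 by eventually_elim (auto simp: G_def Gl_def indicator_def)
  have "integrable lebesgue G"
    using Gl by (rule integrable_cong_AE_imp) (use ae in \<open>auto intro!: AE_completion measurable_completion\<close>)
  then have G: "integrable lborel G"
    using integrable_completion[of G lborel] by simp
  have "AE x in lborel. G x = 0"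
  proof (rule AE_zero_of_box_integrals[OF G])
    show "G x = 0" if "x \<notin> box a b" for x
      using that by (simp add: G_def)
    fix l u :: 'a
    \<comment> \<open>An arbitrary box may leave \<Omega>. Its intersection with
      \<open>box a b\<close> is again a box, whose cut-offs are test functions in \<Omega>, and G
      does not see the rest.\<close>
    obtain l' u' where lu: "box l u \<inter> box a b = box l' u'"
      using box_Int_box by blast
    have "closure (box l' u') \<subseteq> cbox a b"
      using lu box_subset_cbox[of a b] by (intro closure_minimal) auto
    then have test: "test_function \<Omega> (box_cutoff l' u' k)" for k
      using ab by (intro test_function_box_cutoff) auto
    note [measurable] = test_function_measurable[OF test]
    have z: "(LBINT x. G x * box_cutoff l' u' k x) = 0" for k
    proof -
      have "0 = (\<integral>x. indicator \<Omega> x * (g x * box_cutoff l' u' k x) \<partial>lebesgue)"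
        using zero[OF test] by (simp add: set_lebesgue_integral_def)
      also have "\<dots> = (\<integral>x. Gl x * box_cutoff l' u' k x \<partial>lebesgue)"
      proof (rule Bochner_Integration.integral_cong[OF refl])
        fix x
        show "indicator \<Omega> x * (g x * box_cutoff l' u' k x) = Gl x * box_cutoff l' u' k x"
        proof (cases "x \<in> box l' u'")
          case True
          then have "x \<in> box a b" using lu by blast
          then show ?thesis using ab box_subset_cbox[of a b] by (auto simp: Gl_def)
        qed (simp add: box_cutoff_outside)
      qed
      also have "\<dots> = (\<integral>x. G x * box_cutoff l' u' k x \<partial>lebesgue)"
      proof (rule integral_cong_AE)
        have "box_cutoff l' u' k \<in> borel_measurable lebesgue"
          by (intro measurable_completion) measurable
        then show "(\<lambda>x. Gl x * box_cutoff l' u' k x) \<in> borel_measurable lebesgue"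
          using Gl by auto
        show "(\<lambda>x. G x * box_cutoff l' u' k x) \<in> borel_measurable lebesgue"
          by (intro measurable_completion) measurable
        show "AE x in lebesgue. Gl x * box_cutoff l' u' k x = G x * box_cutoff l' u' k x"
          using AE_completion[OF ae] by eventually_elim simp
      qed
      also have "\<dots> = (LBINT x. G x * box_cutoff l' u' k x)"
        by (rule integral_completion) measurable
      finally show ?thesis by simp
    qed
    have "(\<lambda>k. LBINT x. G x * box_cutoff l' u' k x) \<longlonglongrightarrow> (LBINT x. G x * indicator (box l' u') x)"
    proof (rule integral_dominated_convergence[where w="\<lambda>x. \<bar>G x\<bar>"])
      show "AE x in lborel. (\<lambda>k. G x * box_cutoff l' u' k x) \<longlonglongrightarrow> G x * indicator (box l' u') x"
        by (intro AE_I2 tendsto_mult tendsto_const box_cutoff_tendsto)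
      show "AE x in lborel. norm (G x * box_cutoff l' u' k x) \<le> \<bar>G x\<bar>" for k
        by (intro AE_I2) (simp add: abs_mult box_cutoff_bounds mult_left_le)
      show "integrable lborel (\<lambda>x. \<bar>G x\<bar>)"
        using G by simp
    qed measurable
    then have "(LBINT x. G x * indicator (box l' u') x) = 0"
      unfolding z using LIMSEQ_unique tendsto_const by metis
    moreover have "G x * indicator (box l' u') x = indicator (box l u) x *\<^sub>R G x" for x
      unfolding lu[symmetric] by (auto simp: G_def indicator_def)
    ultimately show "(LINT x:box l u|lborel. G x) = 0"
      by (simp only: set_lebesgue_integral_def)
  qed
  then have "AE x in lborel. Gl x = 0"
    using ae by eventually_elim simp
  then have "AE x in lebesgue. Gl x = 0"
    by (rule AE_completion)
  then show ?thesis
    by eventually_elim (auto simp: Gl_def indicator_def split: if_splits)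
qed

text \<open>Being negligible is a local property, so boxes around the individual points
  suffice.\<close>

lemma AE_zero_of_test_functions:
  fixes g :: "'a::euclidean_space \<Rightarrow> real"
  assumes "open \<Omega>" "locally_integrable_on \<Omega> g"
    and "\<And>\<psi>. test_function \<Omega> \<psi> \<Longrightarrow> (LINT x:\<Omega>|lebesgue. g x * \<psi> x) = 0"
  shows "AE x in lebesgue. x \<in> \<Omega> \<longrightarrow> g x = 0"
proof -
  define N where "N = {x \<in> \<Omega>. g x \<noteq> 0}"
  have "negligible N"
  proof (rule locally_negligible_alt[THEN iffD2], intro ballI)
    fix x assume x: "x \<in> N"
    then obtain a b where ab: "x \<in> box a b" "cbox a b \<subseteq> \<Omega>"
      using open_contains_cbox[OF assms(1), of x thesis] by (auto simp: N_def)
    have "AE y in lebesgue. y \<in> box a b \<longrightarrow> g y = 0"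
      by (rule AE_zero_on_box_of_test_functions[OF assms(2) _ ab(2)]) (rule assms(3))
    then have "negligible {y. \<not> (y \<in> box a b \<longrightarrow> g y = 0)}"
      by (simp only: AE_lebesgue_iff_negligible)
    then have "negligible (N \<inter> box a b)"
      by (rule negligible_subset) (auto simp: N_def)
    moreover have "openin (top_of_set N) (N \<inter> box a b)"
      by (rule openin_open_Int[OF open_box])
    ultimately show "\<exists>V. openin (top_of_set N) V \<and> x \<in> V \<and> negligible V"
      using x ab(1) by blast
  qed
  moreover have "N = {x. \<not> (x \<in> \<Omega> \<longrightarrow> g x = 0)}"
    by (auto simp: N_def)
  ultimately show ?thesis
    using AE_lebesgue_iff_negligible by metis
qed

section \<open>Rescaled convolutions\<close>

text \<open>The normalising factor r^(-n) is left out: the kernel and its derivatives are divided by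
  different powers of r, which are written explicitly where they occur.\<close>

definition rconv :: "('a::euclidean_space \<Rightarrow> real) \<Rightarrow> ('a \<Rightarrow> real) \<Rightarrow> real \<Rightarrow> 'a \<Rightarrow> real" where
  "rconv U \<kappa> r x = (LBINT z. U z * \<kappa> ((1 / r) *\<^sub>R (x - z)))"

text \<open>The generator of dilations, y . grad. It appears whenever a rescaled kernel is
  differentiated with respect to its radius.\<close>

definition euler :: "('a::euclidean_space \<Rightarrow> real) \<Rightarrow> 'a \<Rightarrow> real" where
  "euler \<kappa> y = (\<Sum>k\<in>Basis. (y \<bullet> k) * partial_deriv k \<kappa> y)"

lemma test_function_euler: "test_function \<Omega> \<kappa> \<Longrightarrow> test_function \<Omega> (euler \<kappa>)"
  unfolding euler_def[abs_def] by (intro test_function_sum test_function_mult test_function_partial) auto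

lemma test_function_rescaled_measurable:
  "test_function \<Omega> \<kappa> \<Longrightarrow> (\<lambda>z. \<kappa> (c *\<^sub>R (x - z))) \<in> borel_measurable borel"
  by (rule measurable_compose[OF _ test_function_measurable]) measurable

lemma rconv_integrable:
  assumes U: "integrable lborel U" and \<kappa>: "test_function \<Omega> \<kappa>"
  shows "integrable lborel (\<lambda>z. U z * \<kappa> (c *\<^sub>R (x - z)))"
proof -
  obtain C where C: "\<And>y. \<bar>\<kappa> y\<bar> \<le> C"
    using \<kappa> by (rule test_function_bounded) blast
  show ?thesis
    by (rule integrable_mult_bounded[OF U _ C]) (use test_function_rescaled_measurable[OF \<kappa>] in simp)
qed

lemma rconv_cmult: "rconv U (\<lambda>y. c * \<kappa> y) r x = c * rconv U \<kappa> r x"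
  by (simp add: rconv_def mult.left_commute)

lemma rconv_sum:
  assumes "integrable lborel U" "\<And>k. k \<in> I \<Longrightarrow> test_function UNIV (f k)"
  shows "rconv U (\<lambda>y. \<Sum>k\<in>I. f k y) r x = (\<Sum>k\<in>I. rconv U (f k) r x)"
  unfolding rconv_def sum_distrib_left
  by (rule Bochner_Integration.integral_sum) (rule rconv_integrable[OF assms])

lemma rconv_add:
  assumes "integrable lborel U" "test_function UNIV f" "test_function UNIV g"
  shows "rconv U (\<lambda>y. f y + g y) r x = rconv U f r x + rconv U g r x"
  unfolding rconv_def distrib_left
  by (rule Bochner_Integration.integral_add) (rule rconv_integrable[OF assms(1)], fact)+

lemma rconv_bound:
  assumes U: "integrable lborel U" and C: "\<And>y. \<bar>\<kappa> y\<bar> \<le> C" and \<kappa>: "test_function UNIV \<kappa>"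
  shows "\<bar>rconv U \<kappa> r x\<bar> \<le> C * (LBINT z. \<bar>U z\<bar>)"
proof -
  have "\<bar>rconv U \<kappa> r x\<bar> \<le> (LBINT z. norm (U z * \<kappa> ((1 / r) *\<^sub>R (x - z))))"
    unfolding rconv_def using integral_norm_bound[of lborel "\<lambda>z. U z * \<kappa> ((1 / r) *\<^sub>R (x - z))"] by simp
  also have "\<dots> \<le> (LBINT z. C * \<bar>U z\<bar>)"
  proof (rule integral_mono)
    show "integrable lborel (\<lambda>z. norm (U z * \<kappa> ((1 / r) *\<^sub>R (x - z))))"
      using rconv_integrable[OF U \<kappa>] by simp
    show "integrable lborel (\<lambda>z. C * \<bar>U z\<bar>)"
      using U by simp
    show "norm (U z * \<kappa> ((1 / r) *\<^sub>R (x - z))) \<le> C * \<bar>U z\<bar>" for z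
      using mult_right_mono[OF C, of "\<bar>U z\<bar>" "(1 / r) *\<^sub>R (x - z)"] by (simp add: abs_mult mult.commute)
  qed
  finally show ?thesis by simp
qed

lemma partial_derivs_bounded:
  fixes \<kappa> :: "'a::euclidean_space \<Rightarrow> real"
  assumes \<kappa>: "test_function \<Omega> \<kappa>"
  obtains C where "\<And>x h. \<bar>\<Sum>i\<in>Basis. (h \<bullet> i) * partial_deriv i \<kappa> x\<bar> \<le> C * norm h"
proof -
  have "\<exists>C. \<forall>x. \<bar>partial_deriv i \<kappa> x\<bar> \<le> C" if "i \<in> Basis" for i
    using test_function_bounded[OF test_function_partial[OF \<kappa> that]] by metis
  then obtain C where C: "\<And>i x. i \<in> Basis \<Longrightarrow> \<bar>partial_deriv i \<kappa> x\<bar> \<le> C i"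
    by metis
  have "\<bar>\<Sum>i\<in>Basis. (h \<bullet> i) * partial_deriv i \<kappa> x\<bar> \<le> (\<Sum>i\<in>Basis. C i) * norm h" for x h
  proof -
    have "\<bar>\<Sum>i\<in>Basis. (h \<bullet> i) * partial_deriv i \<kappa> x\<bar> \<le> (\<Sum>i\<in>Basis. \<bar>(h \<bullet> i) * partial_deriv i \<kappa> x\<bar>)"
      by (rule sum_abs)
    also have "\<dots> \<le> (\<Sum>i\<in>Basis. norm h * C i)"
      unfolding abs_mult by (intro sum_mono mult_mono Basis_le_norm C) auto
    finally show ?thesis
      by (simp add: sum_distrib_left mult.commute)
  qed
  then show thesis using that by blast
qed

lemma rconv_has_derivative:
  fixes U \<kappa> :: "'a::euclidean_space \<Rightarrow> real"
  assumes U: "integrable lborel U" and \<kappa>: "test_function UNIV \<kappa>"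
  shows "(rconv U \<kappa> r has_derivative
      (\<lambda>h. \<Sum>i\<in>Basis. (h \<bullet> i) * (1 / r * rconv U (partial_deriv i \<kappa>) r x))) (at x)"
proof -
  obtain C where C: "\<And>x h. \<bar>\<Sum>i\<in>Basis. (h \<bullet> i) * partial_deriv i \<kappa> x\<bar> \<le> C * norm h"
    using partial_derivs_bounded[OF \<kappa>] by blast
  obtain C0 where C0: "\<And>x. \<bar>\<kappa> x\<bar> \<le> C0"
    using \<kappa> by (rule test_function_bounded) blast
  define f' where "f' x z h = (\<Sum>i\<in>Basis. (((1 / r) *\<^sub>R h) \<bullet> i) * partial_deriv i \<kappa> ((1 / r) *\<^sub>R (x - z)))" for x z h
  have "((\<lambda>x. LBINT z. U z * \<kappa> ((1 / r) *\<^sub>R (x - z))) has_derivative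
      (\<lambda>h. LBINT z. U z * f' x z h)) (at x)"
  proof (rule has_derivative_integral_mult[OF U zero_less_one, where C="C * \<bar>1 / r\<bar>" and ?C0.0=C0])
    show "((\<lambda>x. \<kappa> ((1 / r) *\<^sub>R (x - z))) has_derivative f' y z) (at y)" for y z
      unfolding f'_def
      by (rule has_derivative_compose[where f="\<lambda>x. (1 / r) *\<^sub>R (x - z)" and g=\<kappa>,
            OF _ has_derivative_partial[OF test_function_differentiable[OF \<kappa>]]])
        (auto intro!: derivative_eq_intros)
    show "\<bar>f' y z h\<bar> \<le> C * \<bar>1 / r\<bar> * norm h" for y z h
      using C[of "(1 / r) *\<^sub>R h" "(1 / r) *\<^sub>R (y - z)"] by (simp add: f'_def mult_ac)
    show "(\<lambda>z. f' x z h) \<in> borel_measurable lborel" for h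
      unfolding f'_def using test_function_rescaled_measurable[OF test_function_partial[OF \<kappa>]] by simp
    show "(\<lambda>z. \<kappa> ((1 / r) *\<^sub>R (x - z))) \<in> borel_measurable lborel" for x
      using test_function_rescaled_measurable[OF \<kappa>] by simp
  qed (rule C0)
  moreover have "(LBINT z. U z * f' x z h) = (\<Sum>i\<in>Basis. (h \<bullet> i) * (1 / r * rconv U (partial_deriv i \<kappa>) r x))" for h
  proof -
    have "(LBINT z. U z * f' x z h) =
        (LBINT z. (\<Sum>i\<in>Basis. (h \<bullet> i * (1 / r)) * (U z * partial_deriv i \<kappa> ((1 / r) *\<^sub>R (x - z)))))"
      by (simp add: f'_def sum_distrib_left mult_ac)
    also have "\<dots> = (\<Sum>i\<in>Basis. LBINT z. (h \<bullet> i * (1 / r)) * (U z * partial_deriv i \<kappa> ((1 / r) *\<^sub>R (x - z))))"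
      by (intro Bochner_Integration.integral_sum integrable_mult_right rconv_integrable[OF U test_function_partial[OF \<kappa>]])
    finally show ?thesis
      by (simp add: rconv_def mult.assoc)
  qed
  ultimately show ?thesis
    by (simp add: rconv_def[abs_def])
qed

lemma partial_deriv_rconv:
  fixes U \<kappa> :: "'a::euclidean_space \<Rightarrow> real"
  assumes U: "integrable lborel U" and \<kappa>: "test_function UNIV \<kappa>" and j: "j \<in> Basis"
  shows "partial_deriv j (rconv U \<kappa> r) x = 1 / r * rconv U (partial_deriv j \<kappa>) r x"
proof -
  have "partial_deriv j (rconv U \<kappa> r) x = (\<Sum>i\<in>Basis. (j \<bullet> i) * (1 / r * rconv U (partial_deriv i \<kappa>) r x))"
    by (rule partial_deriv_eq[OF rconv_has_derivative[OF U \<kappa>]])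
  also have "\<dots> = (\<Sum>i\<in>Basis. if i = j then 1 / r * rconv U (partial_deriv i \<kappa>) r x else 0)"
    using j by (intro sum.cong) (auto simp: inner_Basis)
  finally show ?thesis
    using j by simp
qed

lemma smooth_on_rconv:
  fixes U \<kappa> :: "'a::euclidean_space \<Rightarrow> real"
  assumes U: "integrable lborel U" and \<kappa>: "test_function UNIV \<kappa>"
  shows "smooth_on UNIV (rconv U \<kappa> r)"
proof -
  have diff: "rconv U \<kappa> r differentiable (at x)" if "test_function UNIV \<kappa>" for \<kappa> x
    using rconv_has_derivative[OF U that] by (rule differentiableI)
  have "Ck_on k UNIV (rconv U \<kappa> r)" for k
    using \<kappa>
  proof (induction k arbitrary: \<kappa>)
    case 0
    then show ?case
      using diff by (auto intro!: continuous_at_imp_continuous_on differentiable_imp_continuous_within)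
  next
    case (Suc k)
    have "Ck_on k UNIV (partial_deriv i (rconv U \<kappa> r))" if "i \<in> Basis" for i
    proof -
      have "partial_deriv i (rconv U \<kappa> r) = (\<lambda>x. 1 / r * rconv U (partial_deriv i \<kappa>) r x)"
        using partial_deriv_rconv[OF U Suc.prems that] by (rule ext)
      then show ?thesis
        using Suc.IH[OF test_function_partial[OF Suc.prems that]] Ck_on_mult[OF open_UNIV Ck_on_const] by metis
    qed
    then show ?case using diff[OF Suc.prems] by simp
  qed
  then show ?thesis by (simp add: smooth_on_def)
qed

lemma laplacian_rconv:
  fixes U \<kappa> :: "'a::euclidean_space \<Rightarrow> real"
  assumes U: "integrable lborel U" and \<kappa>: "test_function UNIV \<kappa>"
  shows "laplacian (rconv U \<kappa> r) x = (1 / r)\<^sup>2 * rconv U (laplacian \<kappa>) r x"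
proof -
  have "partial_deriv i (partial_deriv i (rconv U \<kappa> r)) x = (1 / r)\<^sup>2 * rconv U (partial_deriv i (partial_deriv i \<kappa>)) r x"
    if i: "i \<in> Basis" for i
  proof -
    have \<kappa>i: "test_function UNIV (partial_deriv i \<kappa>)"
      using \<kappa> i by (rule test_function_partial)
    have "partial_deriv i (rconv U \<kappa> r) = (\<lambda>x. 1 / r * rconv U (partial_deriv i \<kappa>) r x)"
      using partial_deriv_rconv[OF U \<kappa> i] by (rule ext)
    then have "partial_deriv i (partial_deriv i (rconv U \<kappa> r)) x = 1 / r * partial_deriv i (rconv U (partial_deriv i \<kappa>) r) x"
      using partial_deriv_cmult smooth_on_differentiable[OF smooth_on_rconv[OF U \<kappa>i]] by (metis UNIV_I)
    then show ?thesis
      using partial_deriv_rconv[OF U \<kappa>i i] by (simp add: power2_eq_square)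
  qed
  moreover have "rconv U (laplacian \<kappa>) r x = (\<Sum>i\<in>Basis. rconv U (partial_deriv i (partial_deriv i \<kappa>)) r x)"
    unfolding laplacian_def[abs_def]
    by (rule rconv_sum[OF U]) (intro test_function_partial \<kappa>)
  ultimately show ?thesis
    by (simp add: laplacian_def sum_distrib_left)
qed

lemma rconv_has_derivative_radius:
  fixes U \<kappa> :: "'a::euclidean_space \<Rightarrow> real"
  assumes U: "integrable lborel U" and \<kappa>: "test_function UNIV \<kappa>" and r: "r > 0"
  shows "((\<lambda>r. rconv U \<kappa> r x) has_real_derivative - (1 / r) * rconv U (euler \<kappa>) r x) (at r)"
proof -
  have e: "test_function UNIV (euler \<kappa>)" using \<kappa> by (rule test_function_euler)
  obtain C where C: "C > 0" "\<And>x. \<bar>euler \<kappa> x\<bar> \<le> C"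
    using e by (rule test_function_bounded) blast
  obtain C0 where C0: "\<And>x. \<bar>\<kappa> x\<bar> \<le> C0"
    using \<kappa> by (rule test_function_bounded) blast
  define f' where "f' s z h = - (1 / s) * euler \<kappa> ((1 / s) *\<^sub>R (x - z)) * h" for s z h
  have pos: "s > r / 2" if "s \<in> ball r (r / 2)" for s :: real
    using that unfolding mem_ball dist_real_def by linarith
  have "((\<lambda>s. rconv U \<kappa> s x) has_derivative (\<lambda>h. LBINT z. U z * f' r z h)) (at r)"
    unfolding rconv_def
  \<comment> \<open>On this neighbourhood of r the radius s stays above r / 2, so 1 / s <= 2 / r
    gives a uniform bound for the derivative.\<close>
  proof (rule has_derivative_integral_mult[OF U, where e="r / 2" and C="2 / r * C" and ?C0.0=C0])
    fix s z assume "s \<in> ball r (r / 2)"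
    then have s: "s > r / 2" "s > 0" using pos[of s] r by auto
    have "((\<lambda>s. \<kappa> ((1 / s) *\<^sub>R (x - z))) has_derivative
       (\<lambda>h. \<Sum>i\<in>Basis. (((- (1 / s\<^sup>2) * h) *\<^sub>R (x - z)) \<bullet> i) * partial_deriv i \<kappa> ((1 / s) *\<^sub>R (x - z)))) (at s)"
      by (rule has_derivative_compose[where f="\<lambda>s. (1 / s) *\<^sub>R (x - z)" and g=\<kappa>,
            OF _ has_derivative_partial[OF test_function_differentiable[OF \<kappa>]]])
        (use s in \<open>auto intro!: derivative_eq_intros simp: power2_eq_square field_simps\<close>)
    moreover have "(\<Sum>i\<in>Basis. (((- (1 / s\<^sup>2) * h) *\<^sub>R (x - z)) \<bullet> i) * partial_deriv i \<kappa> ((1 / s) *\<^sub>R (x - z))) = f' s z h" for h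
    proof -
      have "(((- (1 / s\<^sup>2) * h) *\<^sub>R (x - z)) \<bullet> i) * p = - (1 / s) * ((((1 / s) *\<^sub>R (x - z)) \<bullet> i) * p) * h" for i p
        by (simp add: power2_eq_square)
      then show ?thesis
        unfolding f'_def euler_def sum_distrib_left sum_distrib_right by simp
    qed
    ultimately show "((\<lambda>s. \<kappa> ((1 / s) *\<^sub>R (x - z))) has_derivative f' s z) (at s)"
      by simp
    show "\<bar>f' s z h\<bar> \<le> 2 / r * C * norm h" for h
    proof -
      have "1 / s \<le> 2 / r" using s r by (simp add: field_simps)
      then have "(1 / s) * \<bar>euler \<kappa> ((1 / s) *\<^sub>R (x - z))\<bar> \<le> 2 / r * C"
        using C s r by (intro mult_mono) auto
      then have "(1 / s) * \<bar>euler \<kappa> ((1 / s) *\<^sub>R (x - z))\<bar> * \<bar>h\<bar> \<le> 2 / r * C * \<bar>h\<bar>"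
        by (rule mult_right_mono) simp
      moreover have "\<bar>f' s z h\<bar> = (1 / s) * \<bar>euler \<kappa> ((1 / s) *\<^sub>R (x - z))\<bar> * \<bar>h\<bar>"
        using s by (simp add: f'_def abs_mult)
      ultimately show ?thesis
        by simp
    qed
  next
    show "(\<lambda>z. f' r z h) \<in> borel_measurable lborel" for h
      unfolding f'_def using test_function_rescaled_measurable[OF e] by simp
    show "(\<lambda>z. \<kappa> ((1 / r) *\<^sub>R (x - z))) \<in> borel_measurable lborel" for r
      using test_function_rescaled_measurable[OF \<kappa>] by simp
  qed (use C0 r in auto)
  moreover have "(LBINT z. U z * f' r z h) = - (1 / r) * rconv U (euler \<kappa>) r x * h" for h
  proof -
    have "(LBINT z. U z * f' r z h) = (LBINT z. (- (1 / r) * h) * (U z * euler \<kappa> ((1 / r) *\<^sub>R (x - z))))"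
      by (simp add: f'_def mult_ac)
    also have "\<dots> = (- (1 / r) * h) * rconv U (euler \<kappa>) r x"
      unfolding rconv_def by (rule integral_mult_right_zero)
    finally show ?thesis by simp
  qed
  ultimately show ?thesis
    unfolding has_field_derivative_def by (simp only:)
qed

section \<open>The kernel\<close>

text \<open>Positive exactly on the open unit ball, so composing with \<open>expinv p\<close> gives
  smooth radial functions supported in the closed unit ball.\<close>

definition qker :: "'a::euclidean_space \<Rightarrow> real" where
  "qker y = (1 - y \<bullet> y) / 2"

definition rker :: "'a::euclidean_space \<Rightarrow> real" where
  "rker y = expinv 1 (qker y)"

text \<open>With E = \<open>expinv 1\<close>, the Laplacian of \<open>rker\<close> is |y|^2 E'' - n
  E', evaluated at \<open>qker y\<close>. As the gradient of \<open>qker\<close> is -y,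
  differentiating once more gives y_i ((n + 2) E'' - |y|^2 E'''), and \<open>mker\<close> is the
  factor next to y_i.\<close>

definition mker :: "'a::euclidean_space \<Rightarrow> real" where
  "mker y = (real DIM('a) + 2) * expinv (dexpinv (dexpinv 1)) (qker y)
     + (- (y \<bullet> y)) * expinv (dexpinv (dexpinv (dexpinv 1))) (qker y)"

lemma smooth_on_inner_self: "smooth_on UNIV (\<lambda>y. y \<bullet> y :: real)"
proof -
  have "(\<lambda>y::'a. y \<bullet> y) = (\<lambda>y. \<Sum>i\<in>Basis. (y \<bullet> i) * (y \<bullet> i))"
    by (rule ext) (rule euclidean_inner)
  then show ?thesis
    by (simp add: smooth_on_sum smooth_on_mult)
qed

lemma smooth_on_qker: "smooth_on UNIV (qker :: 'a::euclidean_space \<Rightarrow> real)"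
proof -
  have "smooth_on UNIV (\<lambda>y::'a. (1 / 2) * (1 - y \<bullet> y))"
    by (intro smooth_on_mult smooth_on_const smooth_on_diff smooth_on_inner_self)
  then show ?thesis
    by (simp add: qker_def[abs_def])
qed

lemma partial_deriv_qker: "partial_deriv i qker y = - (y \<bullet> i)"
  unfolding qker_def[abs_def]
  by (rule partial_deriv_eq[where f'="\<lambda>h. - (y \<bullet> h)"])
    (auto intro!: derivative_eq_intros simp: inner_commute)

lemma partial_deriv_expinv_qker:
  "partial_deriv i (\<lambda>y. expinv p (qker y)) y = - (y \<bullet> i) * expinv (dexpinv p) (qker y)"
  using partial_deriv_compose_real[OF expinv_has_derivative smooth_on_differentiable[OF smooth_on_qker UNIV_I],
      where i = i and x = y]
  by (simp add: partial_deriv_qker)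

lemma expinv_qker_outside: "y \<notin> cball 0 1 \<Longrightarrow> expinv p (qker y) = 0"
proof (rule expinv_nonpos)
  assume "y \<notin> cball 0 1"
  then have "1 < norm y" by simp
  then have "1 < (norm y)\<^sup>2" by (simp add: power2_eq_square less_1_mult)
  then show "qker y \<le> 0" by (simp add: qker_def dot_square_norm)
qed

lemma test_function_expinv_qker: "test_function UNIV (\<lambda>y. expinv p (qker y))"
proof (rule test_functionI[where K="cball 0 1"])
  show "smooth_on UNIV (\<lambda>y. expinv p (qker y))"
    by (intro smooth_on_expinv smooth_on_qker)
  show "expinv p (qker y) = 0" if "y \<notin> cball 0 1" for y :: 'a
    by (rule expinv_qker_outside[OF that])
qed auto

lemma test_function_rker: "test_function UNIV rker"
  unfolding rker_def[abs_def] by (rule test_function_expinv_qker)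

lemma test_function_mker: "test_function UNIV mker"
  unfolding mker_def[abs_def]
  using smooth_on_diff[OF smooth_on_const[of UNIV 0] smooth_on_inner_self]
  by (intro test_function_add test_function_mult test_function_expinv_qker) auto

lemma rker_outside: "y \<notin> cball 0 1 \<Longrightarrow> rker y = 0"
  unfolding rker_def by (rule expinv_qker_outside)

lemma mker_outside: "y \<notin> cball 0 1 \<Longrightarrow> mker y = 0"
  by (simp add: mker_def expinv_qker_outside)

lemma expinv_qker_differentiable: "(\<lambda>y. expinv p (qker y)) differentiable (at y)"
  by (rule test_function_differentiable[OF test_function_expinv_qker])

lemma partial_deriv_inner_expinv_qker:
  fixes y :: "'a::euclidean_space"
  assumes i: "i \<in> Basis"
  shows "partial_deriv i (\<lambda>y. (y \<bullet> i) * expinv p (qker y)) y =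
     expinv p (qker y) - (y \<bullet> i)\<^sup>2 * expinv (dexpinv p) (qker y)"
  using i
  by (subst partial_deriv_mult)
    (auto simp: partial_deriv_expinv_qker partial_deriv_inner expinv_qker_differentiable
      power2_eq_square inner_Basis intro!: smooth_on_differentiable[of UNIV])

lemma laplacian_rker:
  "laplacian rker (y::'a::euclidean_space) =
     (y \<bullet> y) * expinv (dexpinv (dexpinv 1)) (qker y) - real DIM('a) * expinv (dexpinv 1) (qker y)"
proof -
  let ?E1 = "\<lambda>y::'a. expinv (dexpinv 1) (qker y)"
  let ?E2 = "\<lambda>y::'a. expinv (dexpinv (dexpinv 1)) (qker y)"
  have "partial_deriv i (partial_deriv i rker) y = - ?E1 y + (y \<bullet> i)\<^sup>2 * ?E2 y" if i: "i \<in> Basis" for i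
  proof -
    have eq: "partial_deriv i rker = (\<lambda>y. (-1) * ((y \<bullet> i) * ?E1 y))"
      by (rule ext) (simp add: rker_def[abs_def] partial_deriv_expinv_qker)
    have d: "(\<lambda>y. (y \<bullet> i) * ?E1 y) differentiable (at y)"
      by (rule smooth_on_differentiable[OF smooth_on_mult[OF smooth_on_inner
            test_function_smooth[OF test_function_expinv_qker]] UNIV_I])
    have "partial_deriv i (partial_deriv i rker) y = (-1) * partial_deriv i (\<lambda>y. (y \<bullet> i) * ?E1 y) y"
      unfolding eq by (rule partial_deriv_cmult[OF d])
    then show ?thesis
      using partial_deriv_inner_expinv_qker[OF i] by simp
  qed
  then have "laplacian rker y = (\<Sum>i\<in>Basis. - ?E1 y + (y \<bullet> i)\<^sup>2 * ?E2 y)"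
    by (simp add: laplacian_def)
  also have "\<dots> = - real DIM('a) * ?E1 y + (\<Sum>i\<in>Basis. (y \<bullet> i)\<^sup>2) * ?E2 y"
    by (simp add: sum_subtractf sum_distrib_right)
  also have "(\<Sum>i\<in>Basis. (y \<bullet> i)\<^sup>2) = y \<bullet> y"
    by (simp add: power2_eq_square euclidean_inner[of y y])
  finally show ?thesis by simp
qed

text \<open>
  The point of \<open>rker\<close> and \<open>mker\<close>: since \<open>D\<^sub>i (\<Delta> rker) = y\<^sub>i mker\<close>, the derivative of \<open>r\<^sup>-\<^sup>n mker (y / r)\<close>
  with respect to the radius is a bilaplacian of a compactly supported function.
\<close>

lemma partial_deriv_laplacian_rker:
  fixes y :: "'a::euclidean_space"
  assumes i: "i \<in> Basis"
  shows "partial_deriv i (laplacian rker) y = (y \<bullet> i) * mker y"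
proof -
  let ?E1 = "\<lambda>y::'a. expinv (dexpinv 1) (qker y)"
  let ?E2 = "\<lambda>y::'a. expinv (dexpinv (dexpinv 1)) (qker y)"
  have d: "(\<lambda>y::'a. y \<bullet> y) differentiable (at y)"
    using smooth_on_differentiable[OF smooth_on_inner_self] by blast
  have p: "partial_deriv i (\<lambda>y. y \<bullet> y) y = 2 * (y \<bullet> i)"
    by (rule partial_deriv_eq[where f'="\<lambda>h. 2 * (y \<bullet> h)"])
      (auto intro!: derivative_eq_intros simp: inner_commute)
  have eq: "laplacian rker = (\<lambda>y::'a. (y \<bullet> y) * ?E2 y + (- real DIM('a)) * ?E1 y)"
    by (rule ext) (simp add: laplacian_rker)
  have dd: "(\<lambda>y. (y \<bullet> y) * ?E2 y) differentiable (at y)" "(\<lambda>y. (- real DIM('a)) * ?E1 y) differentiable (at y)"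
    by (intro derivative_intros d expinv_qker_differentiable)+
  show ?thesis
    unfolding eq partial_deriv_add[OF dd] partial_deriv_mult[OF d expinv_qker_differentiable]
      partial_deriv_cmult[OF expinv_qker_differentiable] p partial_deriv_expinv_qker mker_def
    by (simp add: algebra_simps)
qed

text \<open>The left side is the divergence of the field y \<open>mker\<close>, and that field is
  the gradient of \<open>laplacian rker\<close>.\<close>

lemma bilaplacian_rker:
  "real DIM('a) * mker y + euler mker y = laplacian (laplacian rker) (y::'a::euclidean_space)"
proof -
  have "partial_deriv i (partial_deriv i (laplacian rker)) y = mker y + (y \<bullet> i) * partial_deriv i mker y"
    if i: "i \<in> Basis" for i
  proof -
    have "partial_deriv i (laplacian rker) = (\<lambda>y::'a. (y \<bullet> i) * mker y)"
      using partial_deriv_laplacian_rker[OF i] by (rule ext)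
    then have "partial_deriv i (partial_deriv i (laplacian rker)) y = partial_deriv i (\<lambda>y. (y \<bullet> i) * mker y) y"
      by (rule arg_cong)
    also have "\<dots> = (y \<bullet> i) * partial_deriv i mker y + partial_deriv i (\<lambda>y. y \<bullet> i) y * mker y"
      by (rule partial_deriv_mult)
        (auto intro: test_function_differentiable[OF test_function_mker] smooth_on_differentiable[of UNIV])
    finally show ?thesis
      using i by (simp add: partial_deriv_inner)
  qed
  then show ?thesis
    by (simp add: laplacian_def[of "laplacian rker"] euler_def sum.distrib)
qed

lemma poly_dexpinv2: "poly (dexpinv (dexpinv 1)) (s::real) = s ^ 3 * (s - 2)"
  by (simp add: dexpinv_def pderiv_mult pderiv_pCons algebra_simps power2_eq_square power3_eq_cube numeral_eq_Suc)

text \<open>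
  Let \<open>E''\<close> be the second derivative of \<open>expinv 1\<close>. The divergence of \<open>y E''(qker y)\<close> integrates to zero,
  which leaves \<open>2 \<integral> E''(qker y)\<close>. The factor \<open>1 / 2\<close> in \<open>qker\<close> keeps its values in the region \<open>t \<le> 1 / 2\<close>,
  where \<open>E''\<close> is nonnegative.
\<close>

lemma integral_mker_pos: "(LBINT y. mker (y::'a::euclidean_space)) > (0::real)"
proof -
  let ?E2 = "\<lambda>y::'a. expinv (dexpinv (dexpinv 1)) (qker y)"
  let ?E3 = "\<lambda>y::'a. expinv (dexpinv (dexpinv (dexpinv 1))) (qker y)"
  have int2: "integrable lborel ?E2"
    by (rule test_function_integrable[OF test_function_expinv_qker])
  have int3: "integrable lborel (\<lambda>y. (y \<bullet> y) * ?E3 y)"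
    by (rule test_function_integrable[OF test_function_mult[OF test_function_expinv_qker smooth_on_inner_self]])
  have int3': "integrable lborel (\<lambda>y. (y \<bullet> i)\<^sup>2 * ?E3 y)" for i :: 'a
    unfolding power2_eq_square
    by (rule test_function_integrable[OF test_function_mult[OF test_function_expinv_qker]]) (intro smooth_on_mult, auto)
  have "(LBINT y. ?E2 y - (y \<bullet> i)\<^sup>2 * ?E3 y) = 0" if i: "i \<in> Basis" for i
  proof -
    have "test_function UNIV (\<lambda>y::'a. (y \<bullet> i) * ?E2 y)"
      by (rule test_function_mult[OF test_function_expinv_qker]) auto
    from integral_partial_deriv_test[OF this i] show ?thesis
      by (simp add: partial_deriv_inner_expinv_qker[OF i])
  qed
  then have "0 = (\<Sum>i\<in>Basis. LBINT y. ?E2 y - (y \<bullet> i)\<^sup>2 * ?E3 y)"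
    by simp
  also have "\<dots> = (LBINT y. (\<Sum>i\<in>Basis. ?E2 y - (y \<bullet> i)\<^sup>2 * ?E3 y))"
    by (rule Bochner_Integration.integral_sum[symmetric]) (intro Bochner_Integration.integrable_diff int2 int3')
  also have "\<dots> = (LBINT y. real DIM('a) * ?E2 y - (y \<bullet> y) * ?E3 y)"
  proof (rule Bochner_Integration.integral_cong[OF refl])
    fix y :: 'a
    have "(\<Sum>i\<in>Basis. (y \<bullet> i)\<^sup>2) = y \<bullet> y"
      by (simp add: power2_eq_square euclidean_inner[of y y])
    then show "(\<Sum>i\<in>Basis. ?E2 y - (y \<bullet> i)\<^sup>2 * ?E3 y) = real DIM('a) * ?E2 y - (y \<bullet> y) * ?E3 y"
      by (simp add: sum_subtractf sum_distrib_right[symmetric])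
  qed
  also have "\<dots> = real DIM('a) * (LBINT y. ?E2 y) - (LBINT y. (y \<bullet> y) * ?E3 y)"
    using int2 int3 by simp
  finally have "(LBINT y. (y \<bullet> y) * ?E3 y) = real DIM('a) * (LBINT y. ?E2 y)"
    by simp
  moreover have "(LBINT y. mker (y::'a)) = (real DIM('a) + 2) * (LBINT y. ?E2 y) - (LBINT y. (y \<bullet> y) * ?E3 y)"
    unfolding mker_def using int2 int3 by simp
  ultimately have eq: "(LBINT y. mker (y::'a)) = 2 * (LBINT y. ?E2 y)"
    by (simp add: algebra_simps)
  have nonneg: "?E2 y \<ge> 0" for y
  proof (cases "qker y > 0")
    case True
    have "qker y \<le> 1 / 2" by (simp add: qker_def)
    then have "1 / qker y \<ge> 2" using True by (simp add: field_simps)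
    then show ?thesis using True by (simp add: expinv_def poly_dexpinv2)
  qed simp
  have "(LBINT y. ?E2 y) \<noteq> 0"
  proof
    assume "(LBINT y. ?E2 y) = 0"
    then have "AE y in lborel. ?E2 y = 0"
      using integral_nonneg_eq_0_iff_AE[OF int2] nonneg by simp
    then have ae: "AE y in lebesgue. y \<in> {y. ?E2 y = 0}"
      by (simp add: AE_completion)
    have "closed {y. ?E2 y = 0}"
      using test_function_continuous[OF test_function_expinv_qker] by (intro closed_Collect_eq) auto
    then have zero: "y \<in> {y. ?E2 y = 0}" for y
      using mem_closed_if_AE_lebesgue ae by blast
    obtain b :: 'a where b: "b \<in> Basis" using nonempty_Basis by blast
    \<comment> \<open>One point with a strictly positive value contradicts vanishing: here s = 8 / 3
      exceeds 2, so s^3 (s - 2) > 0.\<close>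
    have q: "qker ((1 / 2) *\<^sub>R b) = 3 / 8" using b by (simp add: qker_def)
    have "?E2 ((1 / 2) *\<^sub>R b) > 0"
      unfolding q expinv_def poly_dexpinv2 by simp
    then show False using zero[of "(1 / 2) *\<^sub>R b"] by simp
  qed
  moreover have "(LBINT y. ?E2 y) \<ge> 0"
    using nonneg by (simp add: integral_nonneg_AE)
  ultimately show ?thesis using eq by simp
qed

section \<open>Interior estimates for almost biharmonic functions\<close>

definition unit_kernel :: "('a::euclidean_space \<Rightarrow> real) \<Rightarrow> bool" where
  "unit_kernel \<kappa> \<longleftrightarrow> test_function UNIV \<kappa> \<and> (\<forall>y. y \<notin> cball 0 1 \<longrightarrow> \<kappa> y = 0)"

lemma unit_kernel_test: "unit_kernel \<kappa> \<Longrightarrow> test_function UNIV \<kappa>"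
  by (simp add: unit_kernel_def)

lemma unit_kernel_partial: "unit_kernel \<kappa> \<Longrightarrow> i \<in> Basis \<Longrightarrow> unit_kernel (partial_deriv i \<kappa>)"
  using partial_deriv_zero_outside[OF compact_cball, of 0 1 \<kappa>]
  by (simp add: unit_kernel_def test_function_partial)

lemma rescaled_eq_affine:
  fixes x :: "'a::real_vector"
  shows "(\<lambda>z. \<kappa> (c *\<^sub>R (x - z))) = (\<lambda>z. \<kappa> (c *\<^sub>R x + (- c) *\<^sub>R z))"
  by (intro ext arg_cong[of _ _ \<kappa>]) (simp add: scaleR_diff_right)

lemma test_function_rescaled:
  fixes \<kappa> :: "'a::euclidean_space \<Rightarrow> real"
  assumes \<kappa>: "unit_kernel \<kappa>" and r: "r > 0" and x: "cball x r \<subseteq> \<Omega>"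
  shows "test_function \<Omega> (\<lambda>z. \<kappa> ((1 / r) *\<^sub>R (x - z)))"
proof (rule test_functionI[OF _ compact_cball x])
  show "smooth_on UNIV (\<lambda>z. \<kappa> ((1 / r) *\<^sub>R (x - z)))"
    unfolding rescaled_eq_affine
    by (rule smooth_on_affine[OF test_function_smooth[OF unit_kernel_test[OF \<kappa>]]])
  show "\<kappa> ((1 / r) *\<^sub>R (x - z)) = 0" if "z \<notin> cball x r" for z
  proof -
    have "norm ((1 / r) *\<^sub>R (x - z)) > 1"
      using that r by (simp add: dist_norm)
    then show ?thesis using \<kappa> by (simp add: unit_kernel_def)
  qed
qed

lemma laplacian_rescaled:
  fixes \<kappa> :: "'a::euclidean_space \<Rightarrow> real"
  assumes \<kappa>: "test_function UNIV \<kappa>"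
  shows "laplacian (\<lambda>z. \<kappa> (c *\<^sub>R (x - z))) z = c\<^sup>2 * laplacian \<kappa> (c *\<^sub>R (x - z))"
proof -
  have p: "partial_deriv i (\<lambda>z. \<kappa> (c *\<^sub>R (x - z))) = (\<lambda>z. - c * partial_deriv i \<kappa> (c *\<^sub>R (x - z)))"
    if "test_function UNIV \<kappa>" for i \<kappa>
    unfolding rescaled_eq_affine
    by (rule ext, subst partial_deriv_affine[OF test_function_differentiable[OF that]])
      (simp add: scaleR_diff_right)
  have "partial_deriv i (partial_deriv i (\<lambda>z. \<kappa> (c *\<^sub>R (x - z)))) z = c\<^sup>2 * partial_deriv i (partial_deriv i \<kappa>) (c *\<^sub>R (x - z))"
    if i: "i \<in> Basis" for i
  proof -
    have \<kappa>i: "test_function UNIV (partial_deriv i \<kappa>)"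
      using \<kappa> i by (rule test_function_partial)
    have d: "(\<lambda>z. partial_deriv i \<kappa> (c *\<^sub>R (x - z))) differentiable (at z)"
      unfolding rescaled_eq_affine
      by (rule smooth_on_differentiable[OF smooth_on_affine[OF test_function_smooth[OF \<kappa>i]] UNIV_I])
    have "partial_deriv i (partial_deriv i (\<lambda>z. \<kappa> (c *\<^sub>R (x - z)))) z = - c * partial_deriv i (\<lambda>z. partial_deriv i \<kappa> (c *\<^sub>R (x - z))) z"
      unfolding p[OF \<kappa>] by (rule partial_deriv_cmult[OF d])
    then show ?thesis
      unfolding p[OF \<kappa>i] by (simp add: power2_eq_square)
  qed
  then show ?thesis
    by (simp add: laplacian_def sum_distrib_left)
qed

lemma bilaplacian_rescaled:
  assumes \<kappa>: "test_function UNIV \<kappa>"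
  shows "laplacian (laplacian (\<lambda>z. \<kappa> (c *\<^sub>R (x - z)))) z = c ^ 4 * laplacian (laplacian \<kappa>) (c *\<^sub>R (x - z))"
proof -
  have \<kappa>': "test_function UNIV (\<lambda>y. c\<^sup>2 * laplacian \<kappa> y)"
    by (intro test_function_cmult test_function_laplacian \<kappa>)
  have "laplacian (\<lambda>z. \<kappa> (c *\<^sub>R (x - z))) = (\<lambda>z. c\<^sup>2 * laplacian \<kappa> (c *\<^sub>R (x - z)))"
    by (rule ext) (rule laplacian_rescaled[OF \<kappa>])
  then have "laplacian (laplacian (\<lambda>z. \<kappa> (c *\<^sub>R (x - z)))) z = c\<^sup>2 * laplacian (\<lambda>y. c\<^sup>2 * laplacian \<kappa> y) (c *\<^sub>R (x - z))"
    using laplacian_rescaled[OF \<kappa>', of c x z] by simp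
  also have "laplacian (\<lambda>y. c\<^sup>2 * laplacian \<kappa> y) y = c\<^sup>2 * laplacian (laplacian \<kappa>) y" for y
    by (rule laplacian_cmult[OF test_function_smooth[OF test_function_laplacian[OF \<kappa>]]])
  finally show ?thesis
    by (simp add: power2_eq_square power4_eq_xxxx)
qed

text \<open>
  The identity says that \<open>- r\<^sup>-\<^sup>c\<^sup>-\<^sup>1 (\<Delta>\<^sup>2\<zeta>)(y / r)\<close> is the derivative of \<open>r\<^sup>-\<^sup>c \<kappa>(y / r)\<close> with respect to \<open>r\<close>.
\<close>

definition mollifier_pair :: "nat \<Rightarrow> ('a::euclidean_space \<Rightarrow> real) \<Rightarrow> ('a \<Rightarrow> real) \<Rightarrow> bool" where
  "mollifier_pair c \<kappa> \<zeta> \<longleftrightarrow> unit_kernel \<kappa> \<and> unit_kernel \<zeta> \<and>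
     (\<forall>y. real c * \<kappa> y + euler \<kappa> y = laplacian (laplacian \<zeta>) y)"

lemma mollifier_pair_kernel: "mollifier_pair DIM('a) (mker :: 'a::euclidean_space \<Rightarrow> real) rker"
  by (simp add: mollifier_pair_def unit_kernel_def test_function_mker test_function_rker
      mker_outside rker_outside bilaplacian_rker)

lemma partial_deriv_euler:
  fixes \<kappa> :: "'a::euclidean_space \<Rightarrow> real"
  assumes \<kappa>: "test_function UNIV \<kappa>" and i: "i \<in> Basis"
  shows "partial_deriv i (euler \<kappa>) y = partial_deriv i \<kappa> y + euler (partial_deriv i \<kappa>) y"
proof -
  have d: "partial_deriv k \<kappa> differentiable (at y)" if "k \<in> Basis" for k
    by (rule test_function_differentiable[OF test_function_partial[OF \<kappa> that]])
  have d': "(\<lambda>y. y \<bullet> k) differentiable (at y)" for k :: 'a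
    by (rule smooth_on_differentiable[of UNIV]) auto
  have "partial_deriv i (euler \<kappa>) y = (\<Sum>k\<in>Basis. partial_deriv i (\<lambda>y. (y \<bullet> k) * partial_deriv k \<kappa> y) y)"
    unfolding euler_def[abs_def] by (rule partial_deriv_sum) (auto intro!: differentiable_mult d d')
  also have "\<dots> = (\<Sum>k\<in>Basis. (y \<bullet> k) * partial_deriv k (partial_deriv i \<kappa>) y + (if k = i then partial_deriv k \<kappa> y else 0))"
  proof (rule sum.cong[OF refl])
    fix k :: 'a assume k: "k \<in> Basis"
    have "partial_deriv i (partial_deriv k \<kappa>) y = partial_deriv k (partial_deriv i \<kappa>) y"
      by (rule partial_deriv_commute[OF smooth_onD[OF test_function_smooth[OF \<kappa>]] i k])
    then show "partial_deriv i (\<lambda>y. (y \<bullet> k) * partial_deriv k \<kappa> y) y =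
       (y \<bullet> k) * partial_deriv k (partial_deriv i \<kappa>) y + (if k = i then partial_deriv k \<kappa> y else 0)"
      using partial_deriv_mult[OF d' d[OF k], of i k] i k
      by (simp add: partial_deriv_inner inner_Basis)
  qed
  also have "\<dots> = partial_deriv i \<kappa> y + euler (partial_deriv i \<kappa>) y"
    using i by (simp add: sum.distrib euler_def)
  finally show ?thesis .
qed

text \<open>Partial derivatives commute with the bilaplacian, while the commutator of D_i with
  \<open>euler\<close> is D_i itself. That extra term raises c by one, in step with the factor 1 / r
  produced by differentiating a rescaled kernel.\<close>

lemma mollifier_pair_partial:
  fixes \<kappa> \<zeta> :: "'a::euclidean_space \<Rightarrow> real"
  assumes p: "mollifier_pair c \<kappa> \<zeta>" and i: "i \<in> Basis"
  shows "mollifier_pair (Suc c) (partial_deriv i \<kappa>) (partial_deriv i \<zeta>)"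
proof -
  have \<kappa>: "test_function UNIV \<kappa>" and \<zeta>: "test_function UNIV \<zeta>"
    using p by (auto simp: mollifier_pair_def unit_kernel_def)
  have eq: "(\<lambda>y. real c * \<kappa> y + euler \<kappa> y) = laplacian (laplacian \<zeta>)"
    using p by (auto simp: mollifier_pair_def)
  have "real (Suc c) * partial_deriv i \<kappa> y + euler (partial_deriv i \<kappa>) y = laplacian (laplacian (partial_deriv i \<zeta>)) y" for y
  proof -
    have "real (Suc c) * partial_deriv i \<kappa> y + euler (partial_deriv i \<kappa>) y =
        real c * partial_deriv i \<kappa> y + partial_deriv i (euler \<kappa>) y"
      by (simp add: partial_deriv_euler[OF \<kappa> i] algebra_simps)
    also have "\<dots> = partial_deriv i (\<lambda>y. real c * \<kappa> y + euler \<kappa> y) y"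
    proof -
      have "(\<lambda>y. real c * \<kappa> y) differentiable (at y)"
        by (rule test_function_differentiable[OF test_function_cmult[OF \<kappa>]])
      from partial_deriv_add[OF this test_function_differentiable[OF test_function_euler[OF \<kappa>]]]
      show ?thesis
        using partial_deriv_cmult[OF test_function_differentiable[OF \<kappa>]] by simp
    qed
    also have "\<dots> = partial_deriv i (laplacian (laplacian \<zeta>)) y"
      by (simp only: eq)
    also have "\<dots> = laplacian (laplacian (partial_deriv i \<zeta>)) y"
      using partial_deriv_laplacian_commute[OF smooth_on_laplacian[OF test_function_smooth[OF \<zeta>]] i]
        partial_deriv_laplacian_commute[OF test_function_smooth[OF \<zeta>] i] by simp
    finally show ?thesis .
  qed
  then show ?thesis
    using p i unit_kernel_partial by (auto simp: mollifier_pair_def)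
qed

lemma rconv_quotient_has_derivative:
  fixes U \<kappa> :: "'a::euclidean_space \<Rightarrow> real"
  assumes U: "integrable lborel U" and \<kappa>: "test_function UNIV \<kappa>"
  shows "((\<lambda>x. rconv U \<kappa> r x / r ^ c) has_derivative
      (\<lambda>h. \<Sum>i\<in>Basis. (h \<bullet> i) * (rconv U (partial_deriv i \<kappa>) r x / r ^ Suc c))) (at x)"
proof -
  have "((\<lambda>x. rconv U \<kappa> r x * (1 / r ^ c)) has_derivative
      (\<lambda>h. (\<Sum>i\<in>Basis. (h \<bullet> i) * (1 / r * rconv U (partial_deriv i \<kappa>) r x)) * (1 / r ^ c))) (at x)"
    by (rule has_derivative_mult_left[OF rconv_has_derivative[OF U \<kappa>]])
  then show ?thesis
    by (simp add: sum_distrib_right sum_divide_distrib)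
qed

text \<open>The power r^(-c) contributes c times the kernel and the dilation contributes
  \<open>euler\<close>; together they are the bilaplacian on the right of the pair identity.\<close>

lemma rconv_pair_has_derivative:
  fixes U \<kappa> :: "'a::euclidean_space \<Rightarrow> real"
  assumes U: "integrable lborel U" and p: "mollifier_pair c \<kappa> \<zeta>" and r: "r > 0"
  shows "((\<lambda>r. rconv U \<kappa> r x / r ^ c) has_real_derivative
      - rconv U (laplacian (laplacian \<zeta>)) r x / r ^ Suc c) (at r)"
proof -
  have \<kappa>: "test_function UNIV \<kappa>"
    using p by (simp add: mollifier_pair_def unit_kernel_def)
  have eq: "laplacian (laplacian \<zeta>) = (\<lambda>y. real c * \<kappa> y + euler \<kappa> y)"
    using p by (auto simp: mollifier_pair_def)
  have sum: "rconv U (laplacian (laplacian \<zeta>)) r x = real c * rconv U \<kappa> r x + rconv U (euler \<kappa>) r x"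
    unfolding eq rconv_add[OF U test_function_cmult[OF \<kappa>] test_function_euler[OF \<kappa>]] rconv_cmult ..
  have "((\<lambda>r. rconv U \<kappa> r x / r ^ c) has_real_derivative
     ((- (1 / r) * rconv U (euler \<kappa>) r x) * r ^ c - rconv U \<kappa> r x * (real c * r ^ (c - Suc 0))) / (r ^ c * r ^ c)) (at r)"
    by (rule DERIV_divide[OF rconv_has_derivative_radius[OF U \<kappa> r] DERIV_pow]) (use r in auto)
  \<comment> \<open>For c = 0 the exponent \<open>c - Suc 0\<close> is truncated, but it is
    multiplied by \<open>real c\<close> = 0; the case distinction on c serves this.\<close>
  moreover have "((- (1 / r) * rconv U (euler \<kappa>) r x) * r ^ c - rconv U \<kappa> r x * (real c * r ^ (c - Suc 0))) / (r ^ c * r ^ c) =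
      - rconv U (laplacian (laplacian \<zeta>)) r x / r ^ Suc c"
    unfolding sum using r by (cases c) (simp_all add: field_simps)
  ultimately show ?thesis by (simp only:)
qed

text \<open>The Lipschitz bound is uniform down to 0, so the values along 1 / (k + 1) form a Cauchy
  sequence; letting s tend to 0 in the bound estimates the distance to the limit.\<close>

lemma limit_at_zero_of_Lipschitz:
  fixes f :: "real \<Rightarrow> real"
  assumes R: "R > 0" and K: "K \<ge> 0"
    and lip: "\<And>s r. 0 < s \<Longrightarrow> s \<le> r \<Longrightarrow> r \<le> R \<Longrightarrow> \<bar>f r - f s\<bar> \<le> K * (r - s)"
  obtains L where "(\<lambda>k. f (inverse (real (Suc k)))) \<longlonglongrightarrow> L" "\<bar>f R - L\<bar> \<le> K * R"
proof -
  let ?r = "\<lambda>k. inverse (real (Suc k))"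
  have r0: "?r \<longlonglongrightarrow> 0" by (rule LIMSEQ_inverse_real_of_nat)
  have rmono: "?r m \<le> ?r k" if "k \<le> m" for k m
    using that by (simp add: le_imp_inverse_le)
  have "Cauchy (\<lambda>k. f (?r k))"
  proof (rule metric_CauchyI)
    fix e :: real assume e: "e > 0"
    have "(\<lambda>k. K * ?r k) \<longlonglongrightarrow> K * 0" by (intro tendsto_intros r0)
    then have "eventually (\<lambda>k. K * ?r k < e) sequentially"
      using e by (intro order_tendstoD) simp_all
    moreover have "eventually (\<lambda>k. ?r k < R) sequentially"
      using r0 R by (rule order_tendstoD)
    ultimately have "eventually (\<lambda>k. K * ?r k < e \<and> ?r k < R) sequentially"
      by eventually_elim simp
    then obtain N where N: "K * ?r N < e" "?r N < R"
      by (auto simp: eventually_sequentially)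
    have *: "dist (f (?r k)) (f (?r m)) < e" if "N \<le> k" "k \<le> m" for k m
    proof -
      have "\<bar>f (?r k) - f (?r m)\<bar> \<le> K * (?r k - ?r m)"
      proof (rule lip)
        show "?r m \<le> ?r k" by (rule rmono[OF that(2)])
        show "?r k \<le> R" using rmono[OF that(1)] N(2) by linarith
      qed simp
      also have "\<dots> \<le> K * ?r N"
      proof (rule mult_left_mono[OF _ K])
        have "0 < ?r m" by simp
        then show "?r k - ?r m \<le> ?r N" using rmono[OF that(1)] by linarith
      qed
      finally show ?thesis using N(1) by (simp add: dist_real_def)
    qed
    show "\<exists>M. \<forall>m\<ge>M. \<forall>n\<ge>M. dist (f (?r m)) (f (?r n)) < e"
    proof (intro exI[of _ N] allI impI)
      fix m n assume "N \<le> m" "N \<le> n"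
      then show "dist (f (?r m)) (f (?r n)) < e"
        using *[of m n] *[of n m] by (cases "m \<le> n") (auto simp: dist_commute)
    qed
  qed
  then obtain L where L: "(\<lambda>k. f (?r k)) \<longlonglongrightarrow> L"
    using Cauchy_convergent convergent_def by blast
  have "\<bar>f R - L\<bar> \<le> K * R"
  proof (rule tendsto_upperbound)
    show "(\<lambda>k. \<bar>f R - f (?r k)\<bar>) \<longlonglongrightarrow> \<bar>f R - L\<bar>"
      by (intro tendsto_intros L)
    have "eventually (\<lambda>k. ?r k < R) sequentially"
      using r0 R by (rule order_tendstoD)
    then show "eventually (\<lambda>k. \<bar>f R - f (?r k)\<bar> \<le> K * R) sequentially"
    proof eventually_elim
      case (elim k)
      have "\<bar>f R - f (?r k)\<bar> \<le> K * (R - ?r k)"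
        using elim by (intro lip) auto
      also have "\<dots> \<le> K * R"
        using K by (intro mult_left_mono) auto
      finally show ?case .
    qed
  qed simp
  then show thesis using L that by blast
qed

text \<open>The interface between the variational problem and the regularity theory.
  \<open>U\<close> is integrable over the whole space, so its convolutions are defined and smooth
  everywhere; the inequality gives information only about balls contained in \<Omega>.\<close>

locale almost_biharmonic =
  fixes \<Omega> :: "'a::euclidean_space set" and U :: "'a \<Rightarrow> real"
  assumes open_domain: "open \<Omega>"
    and U: "integrable lborel U"
    and almost_biharmonic: "\<And>\<phi>. test_function \<Omega> \<phi> \<Longrightarrow>
      (LBINT z. U z * laplacian (laplacian \<phi>) z)\<^sup>2 \<le>
      measure lborel {z \<in> \<Omega>. U z = 0 \<and> \<phi> z \<noteq> 0} * (LBINT z. (laplacian \<phi> z)\<^sup>2)"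
begin

text \<open>The inequality is applied to the kernel rescaled to the ball of radius r. With V the
  volume of the unit ball and M a bound for \<open>laplacian \<kappa>\<close>, the measure is at
  most V r^n and the squared Laplacian integrates to at most (M / r^2)^2 V r^n. The square root is V
  M r^(n - 2), and the bilaplacian of the rescaled kernel accounts for the other r^4.\<close>

lemma rconv_bilaplacian_bound:
  assumes \<kappa>: "unit_kernel \<kappa>"
  obtains C where "C \<ge> 0" "\<And>x r. r > 0 \<Longrightarrow> cball x r \<subseteq> \<Omega> \<Longrightarrow>
    \<bar>rconv U (laplacian (laplacian \<kappa>)) r x\<bar> \<le> C * r ^ (DIM('a) + 2)"
proof -
  have \<kappa>t: "test_function UNIV \<kappa>" using \<kappa> by (rule unit_kernel_test)
  obtain M where M: "M > 0" "\<And>y. \<bar>laplacian \<kappa> y\<bar> \<le> M"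
    using test_function_laplacian[OF \<kappa>t] by (rule test_function_bounded) blast
  define V where "V = unit_ball_vol (real DIM('a))"
  have V: "V \<ge> 0" by (simp add: V_def)
  show thesis
  proof (rule that[of "V * M"])
    show "V * M \<ge> 0" using V M by simp
    fix x :: 'a and r :: real assume r: "r > 0" and x: "cball x r \<subseteq> \<Omega>"
    define \<phi> where "\<phi> z = \<kappa> ((1 / r) *\<^sub>R (x - z))" for z
    have \<phi>: "test_function \<Omega> \<phi>"
      unfolding \<phi>_def by (rule test_function_rescaled[OF \<kappa> r x])
    have \<phi>0: "z \<in> cball x r" if "\<phi> z \<noteq> 0" for z
      using test_function_zero_outside[OF test_function_rescaled[OF \<kappa> r order_refl]] that unfolding \<phi>_def by blast
    have lap: "laplacian \<phi> z = (1 / r)\<^sup>2 * laplacian \<kappa> ((1 / r) *\<^sub>R (x - z))" for z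
      unfolding \<phi>_def by (rule laplacian_rescaled[OF \<kappa>t])
    have lap0: "laplacian \<phi> z = 0" if "z \<notin> cball x r" for z
      using test_function_zero_outside[OF test_function_laplacian[OF test_function_rescaled[OF \<kappa> r order_refl]] that]
      unfolding \<phi>_def .
    note [measurable] = test_function_measurable[OF \<phi>] borel_open[OF open_domain]
      test_function_measurable[OF test_function_laplacian[OF \<phi>]]
    have [measurable]: "U \<in> borel_measurable borel" using U by auto
    have ball: "measure lborel (cball x r) = V * r ^ DIM('a)"
      using r by (simp add: content_cball V_def)
    have m: "measure lborel {z \<in> \<Omega>. U z = 0 \<and> \<phi> z \<noteq> 0} \<le> V * r ^ DIM('a)"
      unfolding ball[symmetric]
    proof (rule measure_mono_fmeasurable)
      show "{z \<in> \<Omega>. U z = 0 \<and> \<phi> z \<noteq> 0} \<subseteq> cball x r" using \<phi>0 by blast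
      show "{z \<in> \<Omega>. U z = 0 \<and> \<phi> z \<noteq> 0} \<in> sets lborel" by measurable
      show "cball x r \<in> fmeasurable lborel"
        using emeasure_compact_finite[OF compact_cball, of x r] by (intro fmeasurableI) auto
    qed
    have I: "(LBINT z. (laplacian \<phi> z)\<^sup>2) \<le> (M / r\<^sup>2)\<^sup>2 * (V * r ^ DIM('a))"
    proof -
      have ic: "integrable lborel (\<lambda>z. (M / r\<^sup>2)\<^sup>2 * indicator (cball x r) z)"
        by (intro integrable_mult_right integrable_indicator_compact compact_cball)
      have le: "(laplacian \<phi> z)\<^sup>2 \<le> (M / r\<^sup>2)\<^sup>2 * indicator (cball x r) z" for z
      proof (cases "z \<in> cball x r")
        case True
        have "\<bar>laplacian \<phi> z\<bar> \<le> M / r\<^sup>2"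
          using M(2)[of "(1 / r) *\<^sub>R (x - z)"] r by (simp add: lap abs_mult power_divide divide_right_mono)
        then have "(laplacian \<phi> z)\<^sup>2 \<le> (M / r\<^sup>2)\<^sup>2"
          using M(1) by (simp add: abs_le_square_iff[symmetric])
        then show ?thesis using True by simp
      qed (simp add: lap0)
      have "(LBINT z. (laplacian \<phi> z)\<^sup>2) \<le> (LBINT z. (M / r\<^sup>2)\<^sup>2 * indicator (cball x r) z)"
      proof (rule integral_mono[OF _ ic le])
        show "integrable lborel (\<lambda>z. (laplacian \<phi> z)\<^sup>2)"
          by (rule Bochner_Integration.integrable_bound[OF ic]) (use le in \<open>auto intro!: AE_I2\<close>)
      qed
      then show ?thesis by (simp add: ball)
    qed
    have "((1 / r) ^ 4 * rconv U (laplacian (laplacian \<kappa>)) r x)\<^sup>2 \<le> (V * r ^ DIM('a) * (M / r\<^sup>2))\<^sup>2"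
    proof -
      have "(1 / r) ^ 4 * rconv U (laplacian (laplacian \<kappa>)) r x = (LBINT z. U z * laplacian (laplacian \<phi>) z)"
        unfolding \<phi>_def bilaplacian_rescaled[OF \<kappa>t] rconv_def integral_mult_right_zero[symmetric]
        by (simp only: mult.left_commute)
      then have "((1 / r) ^ 4 * rconv U (laplacian (laplacian \<kappa>)) r x)\<^sup>2 \<le>
          measure lborel {z \<in> \<Omega>. U z = 0 \<and> \<phi> z \<noteq> 0} * (LBINT z. (laplacian \<phi> z)\<^sup>2)"
        using almost_biharmonic[OF \<phi>] by simp
      also have "\<dots> \<le> (V * r ^ DIM('a)) * ((M / r\<^sup>2)\<^sup>2 * (V * r ^ DIM('a)))"
        using m I V r by (intro mult_mono) auto
      finally show ?thesis by (simp add: power2_eq_square mult_ac)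
    qed
    then have "\<bar>(1 / r) ^ 4 * rconv U (laplacian (laplacian \<kappa>)) r x\<bar> \<le> \<bar>V * r ^ DIM('a) * (M / r\<^sup>2)\<bar>"
      by (simp only: abs_le_square_iff)
    then have "\<bar>rconv U (laplacian (laplacian \<kappa>)) r x\<bar> / r ^ 4 \<le> V * r ^ DIM('a) * (M / r\<^sup>2)"
      using V M r by (simp add: abs_mult power_one_over)
    then have "\<bar>rconv U (laplacian (laplacian \<kappa>)) r x\<bar> \<le> V * r ^ DIM('a) * (M / r\<^sup>2) * r ^ 4"
      using r by (simp add: divide_le_eq)
    also have "\<dots> = V * M * r ^ (DIM('a) + 2)"
      using r by (simp add: power_add power2_eq_square power4_eq_xxxx)
    finally show "\<bar>rconv U (laplacian (laplacian \<kappa>)) r x\<bar> \<le> V * M * r ^ (DIM('a) + 2)" .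
  qed
qed

text \<open>The radius derivative at t is bounded by C t^(n + 2) / t^(c + 1). The condition on c
  makes the resulting exponent n + 1 - c nonnegative, so the value at the larger radius r bounds it
  on the whole interval.\<close>

lemma rconv_pair_increment:
  assumes p: "mollifier_pair c \<kappa> \<zeta>" and c: "c \<le> DIM('a) + 1"
  obtains C where "C \<ge> 0" "\<And>x s r. 0 < s \<Longrightarrow> s \<le> r \<Longrightarrow> cball x r \<subseteq> \<Omega> \<Longrightarrow>
    \<bar>rconv U \<kappa> r x / r ^ c - rconv U \<kappa> s x / s ^ c\<bar> \<le> C * r ^ (DIM('a) + 1 - c) * (r - s)"
proof -
  have "unit_kernel \<zeta>" using p by (simp add: mollifier_pair_def)
  then obtain C where C: "C \<ge> 0" "\<And>x r. r > 0 \<Longrightarrow> cball x r \<subseteq> \<Omega> \<Longrightarrow>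
      \<bar>rconv U (laplacian (laplacian \<zeta>)) r x\<bar> \<le> C * r ^ (DIM('a) + 2)"
    using rconv_bilaplacian_bound by blast
  show thesis
  proof (rule that[OF C(1)])
    fix x s r assume s: "0 < s" "s \<le> r" and x: "cball x r \<subseteq> \<Omega>"
    show "\<bar>rconv U \<kappa> r x / r ^ c - rconv U \<kappa> s x / s ^ c\<bar> \<le> C * r ^ (DIM('a) + 1 - c) * (r - s)"
    proof (cases "s = r")
      case False
      then have "s < r" using s by simp
      have "((\<lambda>r. rconv U \<kappa> r x / r ^ c) has_real_derivative - rconv U (laplacian (laplacian \<zeta>)) t x / t ^ Suc c) (at t)"
        if "s \<le> t" for t
        using rconv_pair_has_derivative[OF U p, of t x] that s by simp
      from MVT2[OF \<open>s < r\<close> this] obtain t where t: "s < t" "t < r"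
        "rconv U \<kappa> r x / r ^ c - rconv U \<kappa> s x / s ^ c = (r - s) * (- rconv U (laplacian (laplacian \<zeta>)) t x / t ^ Suc c)"
        by blast
      have t0: "t > 0" using t s by simp
      have "cball x t \<subseteq> \<Omega>" using x t(2) by (meson less_imp_le order_trans subset_cball)
      then have "\<bar>rconv U (laplacian (laplacian \<zeta>)) t x\<bar> / t ^ Suc c \<le> C * t ^ (DIM('a) + 2) / t ^ Suc c"
        using C(2) t0 by (intro divide_right_mono) auto
      also have "\<dots> = C * t ^ (DIM('a) + 1 - c)"
      proof -
        have "t ^ (DIM('a) + 2) = t ^ (DIM('a) + 1 - c) * t ^ Suc c"
          using c by (simp add: power_add[symmetric])
        then show ?thesis using t0 by simp
      qed
      also have "\<dots> \<le> C * r ^ (DIM('a) + 1 - c)"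
        using t t0 C(1) by (intro mult_left_mono power_mono) auto
      finally have "(r - s) * (\<bar>rconv U (laplacian (laplacian \<zeta>)) t x\<bar> / t ^ Suc c) \<le> (r - s) * (C * r ^ (DIM('a) + 1 - c))"
        using \<open>s < r\<close> by (intro mult_left_mono) auto
      then show ?thesis
        unfolding t(3) using \<open>s < r\<close> t0 by (simp add: abs_mult abs_divide mult_ac)
    qed simp
  qed
qed

text \<open>For c = n + 2 the radius derivative is only bounded by C / t. Adding or subtracting C ln
  t therefore makes the function nondecreasing or nonincreasing, which replaces the mean value
  estimate.\<close>

lemma rconv_pair_log_increment:
  assumes p: "mollifier_pair (DIM('a) + 2) \<kappa> \<zeta>"
  obtains C where "C \<ge> 0" "\<And>x s r. 0 < s \<Longrightarrow> s \<le> r \<Longrightarrow> cball x r \<subseteq> \<Omega> \<Longrightarrow>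
    \<bar>rconv U \<kappa> r x / r ^ (DIM('a) + 2) - rconv U \<kappa> s x / s ^ (DIM('a) + 2)\<bar> \<le> C * (ln r - ln s)"
proof -
  let ?c = "DIM('a) + 2"
  have "unit_kernel \<zeta>" using p by (simp add: mollifier_pair_def)
  then obtain C where C: "C \<ge> 0" "\<And>x r. r > 0 \<Longrightarrow> cball x r \<subseteq> \<Omega> \<Longrightarrow>
      \<bar>rconv U (laplacian (laplacian \<zeta>)) r x\<bar> \<le> C * r ^ ?c"
    using rconv_bilaplacian_bound by blast
  show thesis
  proof (rule that[OF C(1)])
    fix x s r assume s: "0 < s" "s \<le> r" and x: "cball x r \<subseteq> \<Omega>"
    define q where "q t = rconv U \<kappa> t x / t ^ ?c" for t
    define q' where "q' t = - rconv U (laplacian (laplacian \<zeta>)) t x / t ^ Suc ?c" for t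
    have der: "(q has_real_derivative q' t) (at t)" and bd: "\<bar>q' t\<bar> \<le> C / t" if t: "s \<le> t" "t \<le> r" for t
    proof -
      have t0: "t > 0" using s t by simp
      show "(q has_real_derivative q' t) (at t)"
        unfolding q_def q'_def by (rule rconv_pair_has_derivative[OF U p t0])
      have "cball x t \<subseteq> \<Omega>" using x t(2) by (meson order_trans subset_cball)
      then have "\<bar>rconv U (laplacian (laplacian \<zeta>)) t x\<bar> / t ^ Suc ?c \<le> C * t ^ ?c / t ^ Suc ?c"
        using C(2) t0 by (intro divide_right_mono) auto
      then show "\<bar>q' t\<bar> \<le> C / t"
        using t0 by (simp add: q'_def abs_divide)
    qed
    have "q s + C * ln s \<le> q r + C * ln r"
    proof (rule DERIV_nonneg_imp_nondecreasing[OF s(2)])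
      fix t assume t: "s \<le> t" "t \<le> r"
      have "((\<lambda>t. q t + C * ln t) has_real_derivative q' t + C * inverse t) (at t)"
        using s t by (intro DERIV_add der DERIV_cmult DERIV_ln) auto
      then show "\<exists>y. ((\<lambda>t. q t + C * ln t) has_real_derivative y) (at t) \<and> 0 \<le> y"
        using bd[OF t] by (intro exI[of _ "q' t + C * inverse t"]) (auto simp: divide_inverse)
    qed
    moreover have "q s - C * ln s \<ge> q r - C * ln r"
    proof (rule DERIV_nonpos_imp_nonincreasing[OF s(2)])
      fix t assume t: "s \<le> t" "t \<le> r"
      have "((\<lambda>t. q t - C * ln t) has_real_derivative q' t - C * inverse t) (at t)"
        using s t by (intro DERIV_diff der DERIV_cmult DERIV_ln) auto
      then show "\<exists>y. ((\<lambda>t. q t - C * ln t) has_real_derivative y) (at t) \<and> y \<le> 0"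
        using bd[OF t] by (intro exI[of _ "q' t - C * inverse t"]) (auto simp: divide_inverse)
    qed
    ultimately have "\<bar>q r - q s\<bar> \<le> C * (ln r - ln s)"
      by (simp add: right_diff_distrib)
    then show "\<bar>rconv U \<kappa> r x / r ^ ?c - rconv U \<kappa> s x / s ^ ?c\<bar> \<le> C * (ln r - ln s)"
      by (simp add: q_def)
  qed
qed

end

lemma cball_half_subset:
  assumes "dist x y \<le> e / 2" shows "cball y (e / 2) \<subseteq> cball x e"
proof
  fix z assume "z \<in> cball y (e / 2)"
  then show "z \<in> cball x e"
    using assms dist_triangle[of x z y] by simp
qed

lemma abs_sum_inner_le:
  assumes "\<And>i. i \<in> Basis \<Longrightarrow> \<bar>f i\<bar> \<le> C i"
  shows "\<bar>\<Sum>i\<in>Basis. (h \<bullet> i) * f i\<bar> \<le> (\<Sum>i\<in>Basis. C i) * norm (h::'b::euclidean_space)"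
proof -
  have "\<bar>\<Sum>i\<in>Basis. (h \<bullet> i) * f i\<bar> \<le> (\<Sum>i\<in>Basis. \<bar>(h \<bullet> i) * f i\<bar>)"
    by (rule sum_abs)
  also have "\<dots> \<le> (\<Sum>i\<in>Basis. norm h * C i)"
    unfolding abs_mult by (intro sum_mono mult_mono Basis_le_norm assms) auto
  finally show ?thesis
    by (simp add: sum_distrib_left mult.commute)
qed

text \<open>Turns the logarithmic modulus of continuity into a power. The source is ln x <= x^a / a
  for x >= 1, used with x = R / \<rho> and a = 1 - \<alpha>.\<close>

lemma mult_ln_le_powr:
  fixes \<rho> R \<alpha> :: real
  assumes "0 < \<rho>" "\<rho> \<le> R" "0 < \<alpha>" "\<alpha> < 1"
  shows "\<rho> * ln (R / \<rho>) \<le> R powr (1 - \<alpha>) / (1 - \<alpha>) * \<rho> powr \<alpha>" "\<rho> \<le> R powr (1 - \<alpha>) * \<rho> powr \<alpha>"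
proof -
  have eq: "\<rho> = \<rho> powr (1 - \<alpha>) * \<rho> powr \<alpha>"
    using assms by (simp add: powr_add[symmetric])
  have "\<rho> powr (1 - \<alpha>) \<le> R powr (1 - \<alpha>)"
    using assms by (intro powr_mono2) auto
  then have "\<rho> powr (1 - \<alpha>) * \<rho> powr \<alpha> \<le> R powr (1 - \<alpha>) * \<rho> powr \<alpha>"
    by (rule mult_right_mono) simp
  then show "\<rho> \<le> R powr (1 - \<alpha>) * \<rho> powr \<alpha>"
    using eq by simp
  have "ln (R / \<rho>) \<le> (R / \<rho>) powr (1 - \<alpha>) / (1 - \<alpha>)"
    using assms by (intro ln_powr_bound) (auto simp: field_simps)
  then have "\<rho> * ln (R / \<rho>) \<le> \<rho> * ((R / \<rho>) powr (1 - \<alpha>) / (1 - \<alpha>))"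
    using assms by (intro mult_left_mono) auto
  also have "\<dots> = R powr (1 - \<alpha>) / (1 - \<alpha>) * (\<rho> / \<rho> powr (1 - \<alpha>))"
    using assms by (simp add: powr_divide mult.commute)
  also have "\<rho> / \<rho> powr (1 - \<alpha>) = \<rho> powr \<alpha>"
    using assms by (simp add: powr_diff)
  finally show "\<rho> * ln (R / \<rho>) \<le> R powr (1 - \<alpha>) / (1 - \<alpha>) * \<rho> powr \<alpha>" .
qed

section \<open>The C^1 limit of the mollifications and the Hoelder estimate for its gradient\<close>

context almost_biharmonic
begin

definition mass :: real where
  "mass = (LBINT y. mker (y::'a))"

lemma mass_pos: "mass > 0"
  unfolding mass_def by (rule integral_mker_pos)

definition mol :: "real \<Rightarrow> 'a \<Rightarrow> real" where
  "mol r x = rconv U mker r x / r ^ DIM('a)"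

text \<open>\<open>mol1\<close> and \<open>mol2\<close> are the first and second partial derivatives
  of \<open>mol r\<close>. Derivatives fall on the kernel, and each produces a factor 1 / r; this
  explains the increasing powers.\<close>

definition mol1 :: "'a \<Rightarrow> real \<Rightarrow> 'a \<Rightarrow> real" where
  "mol1 i r x = rconv U (partial_deriv i mker) r x / r ^ (DIM('a) + 1)"

definition mol2 :: "'a \<Rightarrow> 'a \<Rightarrow> real \<Rightarrow> 'a \<Rightarrow> real" where
  "mol2 i j r x = rconv U (partial_deriv j (partial_deriv i mker)) r x / r ^ (DIM('a) + 2)"

text \<open>A pointwise limit along the radii 1 / (k + 1). It is controlled inside \<Omega>, where
  the limit exists; elsewhere \<open>lim\<close> may be an arbitrary value.\<close>

definition repr :: "'a \<Rightarrow> real" where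
  "repr x = lim (\<lambda>k. mol (inverse (real (Suc k))) x) / mass"

definition repr_deriv :: "'a \<Rightarrow> 'a \<Rightarrow> real" where
  "repr_deriv i x = lim (\<lambda>k. mol1 i (inverse (real (Suc k))) x) / mass"

lemma mol_has_derivative:
  "(mol r has_derivative (\<lambda>h. \<Sum>i\<in>Basis. (h \<bullet> i) * mol1 i r x)) (at x)"
  using rconv_quotient_has_derivative[OF U test_function_mker, of r "DIM('a)" x]
  by (simp add: mol_def[abs_def] mol1_def)

lemma mol1_has_derivative:
  assumes "i \<in> Basis"
  shows "(mol1 i r has_derivative (\<lambda>h. \<Sum>j\<in>Basis. (h \<bullet> j) * mol2 i j r x)) (at x)"
  using rconv_quotient_has_derivative[OF U test_function_partial[OF test_function_mker assms], of r "DIM('a) + 1" x]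
  by (simp add: mol1_def[abs_def] mol2_def)

text \<open>For c = n the increment bound carries a factor r. On radii up to r the mollification is
  thus Lipschitz in the radius with constant C r, and the distance to the limit is
  quadratic.\<close>

lemma mol_approx:
  obtains C where "C \<ge> 0"
    "\<And>x r. r > 0 \<Longrightarrow> cball x r \<subseteq> \<Omega> \<Longrightarrow> \<bar>mol r x - mass * repr x\<bar> \<le> C * r * r"
    "\<And>x r. r > 0 \<Longrightarrow> cball x r \<subseteq> \<Omega> \<Longrightarrow> (\<lambda>k. mol (inverse (real (Suc k))) x) \<longlonglongrightarrow> mass * repr x"
proof -
  obtain C where C: "C \<ge> 0" "\<And>x s r. 0 < s \<Longrightarrow> s \<le> r \<Longrightarrow> cball x r \<subseteq> \<Omega> \<Longrightarrow>
    \<bar>mol r x - mol s x\<bar> \<le> C * r ^ (DIM('a) + 1 - DIM('a)) * (r - s)"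
    using rconv_pair_increment[OF mollifier_pair_kernel] unfolding mol_def by (metis le_add1)
  have main: "(\<lambda>k. mol (inverse (real (Suc k))) x) \<longlonglongrightarrow> mass * repr x \<and> \<bar>mol r x - mass * repr x\<bar> \<le> C * r * r"
    if r: "r > 0" and x: "cball x r \<subseteq> \<Omega>" for x r
  proof -
    have lip: "\<bar>mol t x - mol s x\<bar> \<le> C * r * (t - s)" if "0 < s" "s \<le> t" "t \<le> r" for s t
    proof -
      have "cball x t \<subseteq> \<Omega>" using x that(3) by (meson order_trans subset_cball)
      then have "\<bar>mol t x - mol s x\<bar> \<le> C * t * (t - s)"
        using C(2)[OF that(1,2)] by simp
      also have "\<dots> \<le> C * r * (t - s)"
        using that C(1) by (intro mult_right_mono mult_left_mono) auto
      finally show ?thesis .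
    qed
    have "C * r \<ge> 0" using C(1) r by simp
    from limit_at_zero_of_Lipschitz[OF r this, of "\<lambda>t. mol t x", OF lip]
    obtain L where L: "(\<lambda>k. mol (inverse (real (Suc k))) x) \<longlonglongrightarrow> L" "\<bar>mol r x - L\<bar> \<le> C * r * r"
      by blast
    moreover have "mass * repr x = L"
      using limI[OF L(1)] mass_pos by (simp add: repr_def)
    ultimately show ?thesis by simp
  qed
  show thesis
    by (rule that[OF C(1)]) (use main in blast)+
qed

text \<open>For c = n + 1 the power of r in the increment bound is r^0, so the Lipschitz constant
  does not improve for small radii and the error is linear.\<close>

lemma mol1_approx:
  assumes i: "i \<in> Basis"
  obtains C where "C \<ge> 0"
    "\<And>x r. r > 0 \<Longrightarrow> cball x r \<subseteq> \<Omega> \<Longrightarrow> \<bar>mol1 i r x - mass * repr_deriv i x\<bar> \<le> C * r"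
proof -
  obtain C where C: "C \<ge> 0" "\<And>x s r. 0 < s \<Longrightarrow> s \<le> r \<Longrightarrow> cball x r \<subseteq> \<Omega> \<Longrightarrow>
    \<bar>rconv U (partial_deriv i mker) r x / r ^ Suc DIM('a) - rconv U (partial_deriv i mker) s x / s ^ Suc DIM('a)\<bar>
      \<le> C * r ^ (DIM('a) + 1 - Suc DIM('a)) * (r - s)"
    using rconv_pair_increment[OF mollifier_pair_partial[OF mollifier_pair_kernel i]] by (metis Suc_eq_plus1 order_refl)
  have main: "\<bar>mol1 i r x - mass * repr_deriv i x\<bar> \<le> C * r"
    if r: "r > 0" and x: "cball x r \<subseteq> \<Omega>" for x r
  proof -
    have lip: "\<bar>mol1 i t x - mol1 i s x\<bar> \<le> C * (t - s)" if "0 < s" "s \<le> t" "t \<le> r" for s t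
    proof -
      have "cball x t \<subseteq> \<Omega>" using x that(3) by (meson order_trans subset_cball)
      then show ?thesis
        using C(2)[OF that(1,2)] by (simp add: mol1_def)
    qed
    from limit_at_zero_of_Lipschitz[OF r C(1), of "\<lambda>t. mol1 i t x", OF lip]
    obtain L where L: "(\<lambda>k. mol1 i (inverse (real (Suc k))) x) \<longlonglongrightarrow> L" "\<bar>mol1 i r x - L\<bar> \<le> C * r"
      by blast
    moreover have "mass * repr_deriv i x = L"
      using limI[OF L(1)] mass_pos by (simp add: repr_deriv_def)
    ultimately show ?thesis by simp
  qed
  show thesis
    by (rule that[OF C(1)]) (use main in blast)
qed

text \<open>At the fixed radius R the integral of |U| gives a bound independent of the centre.
  Moving down from R to r costs the logarithm.\<close>

lemma mol2_bound:
  assumes i: "i \<in> Basis" and j: "j \<in> Basis" and R: "R > 0"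
  obtains A B where "A \<ge> 0" "B \<ge> 0"
    "\<And>x r. 0 < r \<Longrightarrow> r \<le> R \<Longrightarrow> cball x R \<subseteq> \<Omega> \<Longrightarrow> \<bar>mol2 i j r x\<bar> \<le> A + B * ln (R / r)"
proof -
  let ?\<kappa> = "partial_deriv j (partial_deriv i mker) :: 'a \<Rightarrow> real"
  have t: "test_function UNIV ?\<kappa>"
    by (intro test_function_partial test_function_mker i j)
  obtain M where M: "M > 0" "\<And>y. \<bar>?\<kappa> y\<bar> \<le> M"
    using t by (rule test_function_bounded) blast
  define A where "A = M * (LBINT z. \<bar>U z\<bar>) / R ^ (DIM('a) + 2)"
  have A: "A \<ge> 0" using M R by (simp add: A_def)
  have AR: "\<bar>mol2 i j R x\<bar> \<le> A" for x
    using rconv_bound[OF U M(2) t, of R x] R by (simp add: mol2_def A_def abs_divide divide_right_mono)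
  have p: "mollifier_pair (DIM('a) + 2) ?\<kappa> (partial_deriv j (partial_deriv i rker))"
    using mollifier_pair_partial[OF mollifier_pair_partial[OF mollifier_pair_kernel i] j] by simp
  obtain B where B: "B \<ge> 0" "\<And>x s r. 0 < s \<Longrightarrow> s \<le> r \<Longrightarrow> cball x r \<subseteq> \<Omega> \<Longrightarrow>
    \<bar>rconv U ?\<kappa> r x / r ^ (DIM('a) + 2) - rconv U ?\<kappa> s x / s ^ (DIM('a) + 2)\<bar> \<le> B * (ln r - ln s)"
    using rconv_pair_log_increment[OF p] by blast
  show thesis
  proof (rule that[OF A B(1)])
    fix x r assume r: "0 < r" "r \<le> R" and x: "cball x R \<subseteq> \<Omega>"
    have "\<bar>mol2 i j R x - mol2 i j r x\<bar> \<le> B * (ln R - ln r)"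
      using B(2)[OF r x] by (simp add: mol2_def)
    then show "\<bar>mol2 i j r x\<bar> \<le> A + B * ln (R / r)"
      using AR[of x] r R by (simp add: ln_div)
  qed
qed

text \<open>The gradients of the mollifications converge uniformly near \<open>x0\<close> by the
  linear error bound, and their values converge at \<open>x0\<close>; this permits exchanging limit
  and derivative.\<close>

lemma repr_has_derivative:
  assumes x0: "x0 \<in> \<Omega>"
  shows "(repr has_derivative (\<lambda>h. \<Sum>i\<in>Basis. (h \<bullet> i) * repr_deriv i x0)) (at x0)"
proof -
  let ?r = "\<lambda>k. inverse (real (Suc k))"
  obtain e where e: "e > 0" "cball x0 e \<subseteq> \<Omega>"
    using open_domain x0 open_contains_cball by blast
  \<comment> \<open>Half the radius, so that every ball of radius R centred in
    \<open>ball x0 R\<close> stays in \<Omega> and the estimates are uniform.\<close>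
  define R where "R = e / 2"
  have R: "R > 0" using e by (simp add: R_def)
  have sub: "cball y R \<subseteq> \<Omega>" if "y \<in> ball x0 R" for y
    using cball_half_subset[of x0 y e] that e by (auto simp: R_def)
  have "\<exists>C. C \<ge> 0 \<and> (\<forall>x r. r > 0 \<longrightarrow> cball x r \<subseteq> \<Omega> \<longrightarrow> \<bar>mol1 i r x - mass * repr_deriv i x\<bar> \<le> C * r)"
    if "i \<in> Basis" for i
    using mol1_approx[OF that] by metis
  then obtain C where C: "\<And>i. i \<in> Basis \<Longrightarrow> C i \<ge> 0"
    "\<And>i x r. i \<in> Basis \<Longrightarrow> r > 0 \<Longrightarrow> cball x r \<subseteq> \<Omega> \<Longrightarrow> \<bar>mol1 i r x - mass * repr_deriv i x\<bar> \<le> C i * r"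
    by metis
  define D where "D = (\<Sum>i\<in>Basis. C i)"
  obtain C0 where lim: "\<And>x r. r > 0 \<Longrightarrow> cball x r \<subseteq> \<Omega> \<Longrightarrow> (\<lambda>k. mol (?r k) x) \<longlonglongrightarrow> mass * repr x"
    using mol_approx by metis
  have "\<exists>g. \<forall>x\<in>ball x0 R. (\<lambda>k. mol (?r k) x) \<longlonglongrightarrow> g x \<and>
      (g has_derivative (\<lambda>h. \<Sum>i\<in>Basis. (h \<bullet> i) * (mass * repr_deriv i x))) (at x within ball x0 R)"
  proof (rule has_derivative_sequence)
    show "convex (ball x0 R)" by simp
    show "(mol (?r k) has_derivative (\<lambda>h. \<Sum>i\<in>Basis. (h \<bullet> i) * mol1 i (?r k) x)) (at x within ball x0 R)" for k x
      by (rule has_derivative_at_withinI[OF mol_has_derivative])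
    show "x0 \<in> ball x0 R" using R by simp
    show "(\<lambda>k. mol (?r k) x0) \<longlonglongrightarrow> mass * repr x0"
      using lim[OF R sub] R by simp
    fix \<epsilon> :: real assume \<epsilon>: "\<epsilon> > 0"
    have "(\<lambda>k. D * ?r k) \<longlonglongrightarrow> D * 0" by (intro tendsto_intros LIMSEQ_inverse_real_of_nat)
    then have "eventually (\<lambda>k. D * ?r k < \<epsilon>) sequentially"
      using \<epsilon> by (intro order_tendstoD) simp_all
    moreover have "eventually (\<lambda>k. ?r k < R) sequentially"
      using LIMSEQ_inverse_real_of_nat R by (rule order_tendstoD)
    ultimately show "\<forall>\<^sub>F k in sequentially. \<forall>x\<in>ball x0 R. \<forall>h.
        norm ((\<Sum>i\<in>Basis. (h \<bullet> i) * mol1 i (?r k) x) - (\<Sum>i\<in>Basis. (h \<bullet> i) * (mass * repr_deriv i x))) \<le> \<epsilon> * norm h"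
    proof eventually_elim
      case (elim k)
      show ?case
      proof (intro ballI allI)
        fix x h assume x: "x \<in> ball x0 R"
        have "cball x (?r k) \<subseteq> \<Omega>"
          using sub[OF x] elim(2) by (meson less_imp_le order_trans subset_cball)
        then have "\<bar>\<Sum>i\<in>Basis. (h \<bullet> i) * (mol1 i (?r k) x - mass * repr_deriv i x)\<bar> \<le> (\<Sum>i\<in>Basis. C i * ?r k) * norm h"
          by (intro abs_sum_inner_le C(2)) auto
        also have "(\<Sum>i\<in>Basis. C i * ?r k) = D * ?r k"
          by (simp add: D_def sum_distrib_right)
        also have "\<dots> * norm h \<le> \<epsilon> * norm h"
          using elim(1) by (intro mult_right_mono) auto
        finally show "norm ((\<Sum>i\<in>Basis. (h \<bullet> i) * mol1 i (?r k) x) - (\<Sum>i\<in>Basis. (h \<bullet> i) * (mass * repr_deriv i x))) \<le> \<epsilon> * norm h"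
          by (simp add: sum_subtractf right_diff_distrib)
      qed
    qed
  qed
  then obtain g where g: "\<And>x. x \<in> ball x0 R \<Longrightarrow> (\<lambda>k. mol (?r k) x) \<longlonglongrightarrow> g x"
    "\<And>x. x \<in> ball x0 R \<Longrightarrow> (g has_derivative (\<lambda>h. \<Sum>i\<in>Basis. (h \<bullet> i) * (mass * repr_deriv i x))) (at x within ball x0 R)"
    by blast
  have geq: "g x = mass * repr x" if "x \<in> ball x0 R" for x
    using LIMSEQ_unique[OF g(1)[OF that] lim[OF R sub[OF that]]] .
  have x0': "x0 \<in> ball x0 R" using R by simp
  have "(g has_derivative (\<lambda>h. \<Sum>i\<in>Basis. (h \<bullet> i) * (mass * repr_deriv i x0))) (at x0)"
    using g(2)[OF x0'] at_within_open[OF x0' open_ball] by simp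
  then have "((\<lambda>x. mass * repr x) has_derivative (\<lambda>h. \<Sum>i\<in>Basis. (h \<bullet> i) * (mass * repr_deriv i x0))) (at x0)"
    by (rule has_derivative_transform_within_open[OF _ open_ball x0']) (simp add: geq)
  then have "((\<lambda>x. (1 / mass) * (mass * repr x)) has_derivative
      (\<lambda>h. (1 / mass) * (\<Sum>i\<in>Basis. (h \<bullet> i) * (mass * repr_deriv i x0)))) (at x0)"
    by (rule has_derivative_mult_right)
  then show ?thesis
    using mass_pos by (simp add: sum_distrib_left)
qed

lemma partial_deriv_repr:
  assumes "x \<in> \<Omega>" and j: "j \<in> Basis"
  shows "partial_deriv j repr x = repr_deriv j x"
proof -
  have "partial_deriv j repr x = (\<Sum>i\<in>Basis. (j \<bullet> i) * repr_deriv i x)"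
    by (rule partial_deriv_eq[OF repr_has_derivative[OF assms(1)]])
  also have "\<dots> = (\<Sum>i\<in>Basis. if i = j then repr_deriv i x else 0)"
    using j by (intro sum.cong) (auto simp: inner_Basis)
  finally show ?thesis using j by simp
qed

text \<open>For close points the mollification radius is chosen as \<rho> = |x - y|. Replacing the
  gradient by that of the mollification costs C1 \<rho> at each point, and the Hessian bound A' + B'
  ln(R / \<rho>) controls the remaining difference after multiplication by \<rho>. For distant
  points a bound on the gradient is enough.\<close>

lemma repr_deriv_Holder:
  assumes i: "i \<in> Basis" and K: "compact K" "K \<subseteq> \<Omega>" and \<alpha>: "0 < \<alpha>" "\<alpha> < 1"
  obtains C where "\<And>x y. x \<in> K \<Longrightarrow> y \<in> K \<Longrightarrow> \<bar>repr_deriv i x - repr_deriv i y\<bar> \<le> C * norm (x - y) powr \<alpha>"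
proof -
  obtain e where e: "e > 0" "(\<Union>x\<in>K. cball x e) \<subseteq> \<Omega>"
    using compact_subset_open_imp_cball_epsilon_subset[OF K(1) open_domain K(2)] by blast
  define R where "R = e / 2"
  have R: "R > 0" using e by (simp add: R_def)
  have sub: "cball p R \<subseteq> \<Omega>" if "x \<in> K" "p \<in> cball x R" for x p
    using cball_half_subset[of x p e] that e by (auto simp: R_def)
  obtain C1 where C1: "C1 \<ge> 0"
    "\<And>x r. r > 0 \<Longrightarrow> cball x r \<subseteq> \<Omega> \<Longrightarrow> \<bar>mol1 i r x - mass * repr_deriv i x\<bar> \<le> C1 * r"
    using mol1_approx[OF i] by metis
  have "\<exists>A B. A \<ge> 0 \<and> B \<ge> 0 \<and> (\<forall>x r. 0 < r \<longrightarrow> r \<le> R \<longrightarrow> cball x R \<subseteq> \<Omega> \<longrightarrow> \<bar>mol2 i j r x\<bar> \<le> A + B * ln (R / r))"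
    if "j \<in> Basis" for j
    using mol2_bound[OF i that R] by metis
  then obtain A B where AB: "\<And>j. j \<in> Basis \<Longrightarrow> A j \<ge> 0" "\<And>j. j \<in> Basis \<Longrightarrow> B j \<ge> 0"
    "\<And>j x r. j \<in> Basis \<Longrightarrow> 0 < r \<Longrightarrow> r \<le> R \<Longrightarrow> cball x R \<subseteq> \<Omega> \<Longrightarrow> \<bar>mol2 i j r x\<bar> \<le> A j + B j * ln (R / r)"
    by metis
  define A' where "A' = (\<Sum>j\<in>Basis. A j)"
  define B' where "B' = (\<Sum>j\<in>Basis. B j)"
  have A': "A' \<ge> 0" and B': "B' \<ge> 0"
    using AB(1,2) by (auto simp: A'_def B'_def intro: sum_nonneg)
  define P where "P = R powr (1 - \<alpha>)"
  define near where "near = (2 * C1 * P + A' * P + B' * (P / (1 - \<alpha>))) / mass"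
  have near: "\<bar>repr_deriv i x - repr_deriv i y\<bar> \<le> near * norm (x - y) powr \<alpha>"
    if x: "x \<in> K" and y: "y \<in> K" and xy: "0 < norm (x - y)" "norm (x - y) \<le> R" for x y
  proof -
    define \<rho> where "\<rho> = norm (x - y)"
    have \<rho>: "0 < \<rho>" "\<rho> \<le> R" using xy by (auto simp: \<rho>_def)
    have subx: "cball x \<rho> \<subseteq> \<Omega>" using sub[OF x, of x] R \<rho> by (meson centre_in_cball less_imp_le order_trans subset_cball)
    have suby: "cball y \<rho> \<subseteq> \<Omega>" using sub[OF y, of y] R \<rho> by (meson centre_in_cball less_imp_le order_trans subset_cball)
    have ln0: "ln (R / \<rho>) \<ge> 0" using \<rho> by simp
    have "norm (mol1 i \<rho> y - mol1 i \<rho> x) \<le> (A' + B' * ln (R / \<rho>)) * norm (y - x)"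
    proof (rule differentiable_bound[OF convex_cball])
      show "x \<in> cball x \<rho>" "y \<in> cball x \<rho>"
        using \<rho> by (auto simp: \<rho>_def dist_norm)
      fix p assume p: "p \<in> cball x \<rho>"
      show "(mol1 i \<rho> has_derivative (\<lambda>h. \<Sum>j\<in>Basis. (h \<bullet> j) * mol2 i j \<rho> p)) (at p within cball x \<rho>)"
        by (rule has_derivative_at_withinI[OF mol1_has_derivative[OF i]])
      have "p \<in> cball x R" using p \<rho> by simp
      then have "cball p R \<subseteq> \<Omega>" using sub x by blast
      then have "\<bar>\<Sum>j\<in>Basis. (h \<bullet> j) * mol2 i j \<rho> p\<bar> \<le> (\<Sum>j\<in>Basis. A j + B j * ln (R / \<rho>)) * norm h" for h
        using \<rho> by (intro abs_sum_inner_le AB(3)) auto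
      moreover have "(\<Sum>j\<in>Basis. A j + B j * ln (R / \<rho>)) = A' + B' * ln (R / \<rho>)"
        by (simp add: A'_def B'_def sum.distrib sum_distrib_right)
      ultimately show "onorm (\<lambda>h. \<Sum>j\<in>Basis. (h \<bullet> j) * mol2 i j \<rho> p) \<le> A' + B' * ln (R / \<rho>)"
        using A' B' ln0 by (intro onorm_bound) auto
    qed
    then have "\<bar>mol1 i \<rho> x - mol1 i \<rho> y\<bar> \<le> (A' + B' * ln (R / \<rho>)) * \<rho>"
      by (simp add: \<rho>_def norm_minus_commute abs_minus_commute)
    then have "\<bar>mass * repr_deriv i x - mass * repr_deriv i y\<bar> \<le> C1 * \<rho> + (A' + B' * ln (R / \<rho>)) * \<rho> + C1 * \<rho>"
      using C1(2)[OF \<rho>(1) subx] C1(2)[OF \<rho>(1) suby] by linarith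
    also have "\<dots> = 2 * C1 * \<rho> + A' * \<rho> + B' * (\<rho> * ln (R / \<rho>))"
      by (simp add: algebra_simps)
    also have "\<dots> \<le> 2 * C1 * (P * \<rho> powr \<alpha>) + A' * (P * \<rho> powr \<alpha>) + B' * (P / (1 - \<alpha>) * \<rho> powr \<alpha>)"
      unfolding P_def using mult_ln_le_powr[OF \<rho> \<alpha>] C1(1) A' B'
      by (intro add_mono mult_left_mono) auto
    also have "\<dots> = (2 * C1 * P + A' * P + B' * (P / (1 - \<alpha>))) * \<rho> powr \<alpha>"
      by (simp add: distrib_right)
    also have "\<dots> = mass * (near * \<rho> powr \<alpha>)"
      using mass_pos by (simp add: near_def)
    finally have "mass * \<bar>repr_deriv i x - repr_deriv i y\<bar> \<le> mass * (near * \<rho> powr \<alpha>)"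
      using mass_pos by (simp add: right_diff_distrib[symmetric] abs_mult)
    then show ?thesis
      using mass_pos by (simp add: \<rho>_def)
  qed
  \<comment> \<open>Pairs at distance more than R: the gradient is bounded on K by comparison with
    the mollification at radius R.\<close>
  obtain M1 where M1: "M1 > 0" "\<And>y. \<bar>partial_deriv i (mker :: 'a \<Rightarrow> real) y\<bar> \<le> M1"
    using test_function_partial[OF test_function_mker i] by (rule test_function_bounded) blast
  define S where "S = M1 * (LBINT z. \<bar>U z\<bar>) / R ^ (DIM('a) + 1) + C1 * R"
  have bd: "\<bar>mass * repr_deriv i x\<bar> \<le> S" if "x \<in> K" for x
  proof -
    have "\<bar>mol1 i R x\<bar> \<le> M1 * (LBINT z. \<bar>U z\<bar>) / R ^ (DIM('a) + 1)"
      using rconv_bound[OF U M1(2) test_function_partial[OF test_function_mker i], of R x] R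
      by (simp add: mol1_def abs_divide divide_right_mono)
    moreover have "cball x R \<subseteq> \<Omega>" using sub[OF that, of x] R by simp
    ultimately show ?thesis
      using C1(2)[OF R, of x] unfolding S_def by linarith
  qed
  \<comment> \<open>Dividing by R^\<alpha> turns the constant bound into one by |x - y|^\<alpha>,
    since |x - y| > R.\<close>
  define far where "far = 2 * S / mass / R powr \<alpha>"
  have far: "\<bar>repr_deriv i x - repr_deriv i y\<bar> \<le> far * norm (x - y) powr \<alpha>"
    if x: "x \<in> K" and y: "y \<in> K" and xy: "R < norm (x - y)" for x y
  proof -
    have S0: "S \<ge> 0" using bd[OF x] by linarith
    have "\<bar>mass * repr_deriv i x - mass * repr_deriv i y\<bar> \<le> 2 * S"
      using bd[OF x] bd[OF y] by linarith
    then have "mass * \<bar>repr_deriv i x - repr_deriv i y\<bar> \<le> 2 * S"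
      using mass_pos by (simp add: right_diff_distrib[symmetric] abs_mult)
    then have "\<bar>repr_deriv i x - repr_deriv i y\<bar> \<le> 2 * S / mass"
      using mass_pos by (simp add: pos_le_divide_eq mult.commute)
    also have "\<dots> = far * R powr \<alpha>"
      using R by (simp add: far_def)
    also have "\<dots> \<le> far * norm (x - y) powr \<alpha>"
      using xy R \<alpha> S0 mass_pos by (intro mult_left_mono powr_mono2) (auto simp: far_def)
    finally show ?thesis .
  qed
  show thesis
  proof (rule that[of "max near far"])
    fix x y assume x: "x \<in> K" and y: "y \<in> K"
    consider "x = y" | "0 < norm (x - y)" "norm (x - y) \<le> R" | "R < norm (x - y)"
      by force
    then show "\<bar>repr_deriv i x - repr_deriv i y\<bar> \<le> max near far * norm (x - y) powr \<alpha>"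
    proof cases
      case 2
      have "near * norm (x - y) powr \<alpha> \<le> max near far * norm (x - y) powr \<alpha>"
        by (intro mult_right_mono) auto
      then show ?thesis using near[OF x y 2] by linarith
    next
      case 3
      have "far * norm (x - y) powr \<alpha> \<le> max near far * norm (x - y) powr \<alpha>"
        by (intro mult_right_mono) auto
      then show ?thesis using far[OF x y 3] by linarith
    qed simp
  qed
qed

lemma continuous_on_repr_deriv:
  assumes i: "i \<in> Basis"
  shows "continuous_on \<Omega> (repr_deriv i)"
proof (rule continuous_at_imp_continuous_on, rule ballI)
  fix x assume x: "x \<in> \<Omega>"
  then obtain e where e: "e > 0" "cball x e \<subseteq> \<Omega>"
    using open_domain open_contains_cball by blast
  obtain C where C: "\<And>y z. y \<in> cball x e \<Longrightarrow> z \<in> cball x e \<Longrightarrow>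
      \<bar>repr_deriv i y - repr_deriv i z\<bar> \<le> C * norm (y - z) powr (1 / 2)"
    using repr_deriv_Holder[OF i compact_cball e(2), of "1 / 2"] by auto
  have "((\<lambda>y. C * norm (y - x) powr (1 / 2)) \<longlongrightarrow> C * norm (x - x) powr (1 / 2)) (at x)"
    by (intro tendsto_intros) auto
  then have "((\<lambda>y. C * norm (y - x) powr (1 / 2)) \<longlongrightarrow> 0) (at x)"
    by simp
  then have "((\<lambda>y. repr_deriv i y - repr_deriv i x) \<longlongrightarrow> 0) (at x)"
  proof (rule Lim_null_comparison[rotated])
    have "eventually (\<lambda>y. y \<in> ball x e) (at x)"
      using e by (intro eventually_at_in_open') auto
    then show "eventually (\<lambda>y. norm (repr_deriv i y - repr_deriv i x) \<le> C * norm (y - x) powr (1 / 2)) (at x)"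
      by eventually_elim (use C e in auto)
  qed
  then show "isCont (repr_deriv i) x"
    by (simp add: isCont_def LIM_zero_iff)
qed

lemma continuous_on_repr: "continuous_on \<Omega> repr"
  by (intro continuous_at_imp_continuous_on ballI has_derivative_continuous[OF repr_has_derivative])

theorem C1_holder_on_repr:
  assumes \<alpha>: "0 < \<alpha>" "\<alpha> < 1"
  shows "C1_holder_on \<alpha> \<Omega> repr"
  unfolding C1_holder_on_def
proof
  have "repr differentiable (at x)" if "x \<in> \<Omega>" for x
    using repr_has_derivative[OF that] by (rule differentiableI)
  moreover have "continuous_on \<Omega> (partial_deriv i repr)" if "i \<in> Basis" for i
    using continuous_on_repr_deriv[OF that] by (simp add: partial_deriv_repr that cong: continuous_on_cong)
  ultimately show "Ck_on 1 \<Omega> repr" by simp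
  have grad: "grad repr x = (\<Sum>i\<in>Basis. repr_deriv i x *\<^sub>R i)" if "x \<in> \<Omega>" for x
    using that by (simp add: grad_def partial_deriv_repr)
  show "locally_holder_on \<alpha> \<Omega> (grad repr)"
    unfolding locally_holder_on_def
  proof (intro allI impI)
    fix K assume K: "compact K \<and> K \<subseteq> \<Omega>"
    have "\<exists>C. \<forall>x\<in>K. \<forall>y\<in>K. \<bar>repr_deriv i x - repr_deriv i y\<bar> \<le> C * norm (x - y) powr \<alpha>" if "i \<in> Basis" for i
      using repr_deriv_Holder[OF that _ _ \<alpha>] K by metis
    then obtain C where C: "\<And>i x y. i \<in> Basis \<Longrightarrow> x \<in> K \<Longrightarrow> y \<in> K \<Longrightarrow>
        \<bar>repr_deriv i x - repr_deriv i y\<bar> \<le> C i * norm (x - y) powr \<alpha>"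
      by metis
    show "\<exists>C. \<forall>x\<in>K. \<forall>y\<in>K. norm (grad repr x - grad repr y) \<le> C * norm (x - y) powr \<alpha>"
    proof (intro exI ballI)
      fix x y assume xy: "x \<in> K" "y \<in> K"
      have "grad repr x - grad repr y = (\<Sum>i\<in>Basis. (repr_deriv i x - repr_deriv i y) *\<^sub>R i)"
        using xy K by (auto simp: grad sum_subtractf scaleR_diff_left subset_iff)
      also have "norm \<dots> \<le> (\<Sum>i\<in>Basis. norm ((repr_deriv i x - repr_deriv i y) *\<^sub>R i))"
        by (rule norm_sum)
      also have "\<dots> \<le> (\<Sum>i\<in>Basis. C i * norm (x - y) powr \<alpha>)"
        using C[OF _ xy] by (intro sum_mono) simp
      finally show "norm (grad repr x - grad repr y) \<le> (\<Sum>i\<in>Basis. C i) * norm (x - y) powr \<alpha>"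
        by (simp add: sum_distrib_right)
    qed
  qed
qed

end

section \<open>The regular part of a zero set\<close>

text \<open>
  Near a point of the set, Rolle's theorem makes small translates of the zero set along \<open>i\<close> pairwise
  disjoint. A ball contains infinitely many of them, so they have measure zero.
\<close>

lemma negligible_zero_set_regular:
  fixes f :: "'a::euclidean_space \<Rightarrow> real"
  assumes S: "open S" and C1: "Ck_on 1 S f" and i: "i \<in> Basis"
  shows "negligible {x \<in> S. f x = 0 \<and> partial_deriv i f x \<noteq> 0}"
proof -
  define N where "N = {x \<in> S. f x = 0 \<and> partial_deriv i f x \<noteq> 0}"
  have diff: "\<And>x. x \<in> S \<Longrightarrow> f differentiable (at x)" and cont: "continuous_on S (partial_deriv i f)"
    using C1 i by auto
  have contf: "continuous_on S f"
    using Ck_on_SucD[of 0 S f] C1 by simp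
  have "negligible N"
  proof (rule locally_negligible_alt[THEN iffD2], intro ballI)
    fix x0 assume x0: "x0 \<in> N"
    have "open (S \<inter> partial_deriv i f -` (- {0}))"
      by (rule continuous_open_preimage[OF cont S]) auto
    moreover have "x0 \<in> S \<inter> partial_deriv i f -` (- {0})"
      using x0 by (auto simp: N_def)
    ultimately obtain e where e: "e > 0" "ball x0 e \<subseteq> S \<inter> partial_deriv i f -` (- {0})"
      using open_contains_ball by blast
    \<comment> \<open>Points of E lie within \<delta> of \<open>x0\<close>, and the translations
      below move them by at most \<delta>, so all translates stay in
      \<open>ball x0 e\<close>.\<close>
    define \<delta> where "\<delta> = e / 2"
    have \<delta>: "\<delta> > 0" using e by (simp add: \<delta>_def)
    define E where "E = ball x0 \<delta> \<inter> {x \<in> S. f x = 0}"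
    have sub: "ball x0 \<delta> \<subseteq> S" using e by (auto simp: \<delta>_def)
    \<comment> \<open>Measurability of E comes from continuity on S alone: E is relatively closed in
      an open ball, hence Borel.\<close>
    have "E = ball x0 \<delta> \<inter> f -` {0}" using sub by (auto simp: E_def)
    then have "closedin (top_of_set (ball x0 \<delta>)) E"
      using continuous_closedin_preimage[OF continuous_on_subset[OF contf sub]] by simp
    then have "E \<in> sets borel"
      by (metis borel_closed closedin_closed open_ball borel_open sets.Int)
    then have Esets: "E \<in> sets lebesgue" by simp
    have Em: "E \<in> lmeasurable"
      by (rule bounded_set_imp_lmeasurable[OF _ Esets]) (auto simp: E_def intro: bounded_subset[OF bounded_ball])
    have disj: "x + s *\<^sub>R i \<noteq> y + t *\<^sub>R i" if x: "x \<in> E" and y: "y \<in> E" and st: "s < t" for x y s t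
    proof
      assume eq: "x + s *\<^sub>R i = y + t *\<^sub>R i"
      have xy: "x = y + (t - s) *\<^sub>R i" using eq by (simp add: algebra_simps)
      have inb: "y + u *\<^sub>R i \<in> ball x0 \<delta>" if u: "0 \<le> u" "u \<le> t - s" for u
      proof -
        have "closed_segment y x \<subseteq> ball x0 \<delta>"
          using x y by (intro closed_segment_subset) (auto simp: E_def)
        moreover have "y + u *\<^sub>R i \<in> closed_segment y x"
          unfolding closed_segment_image_interval
        proof (rule image_eqI[of _ _ "u / (t - s)"])
          have "(1 - l) *\<^sub>R y + l *\<^sub>R (y + c *\<^sub>R i) = y + (l * c) *\<^sub>R i" for l c
            by (simp add: algebra_simps)
          then have "(1 - u / (t - s)) *\<^sub>R y + (u / (t - s)) *\<^sub>R x = y + (u / (t - s) * (t - s)) *\<^sub>R i"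
            unfolding xy .
          then show "y + u *\<^sub>R i = (1 - u / (t - s)) *\<^sub>R y + (u / (t - s)) *\<^sub>R x"
            using st by simp
        qed (use u st in auto)
        ultimately show ?thesis by blast
      qed
      have der: "((\<lambda>u. f (y + u *\<^sub>R i)) has_real_derivative partial_deriv i f (y + u *\<^sub>R i)) (at u)"
        if u: "0 \<le> u" "u \<le> t - s" for u
        using diff inb[OF u] sub by (intro has_real_derivative_along_line) blast
      from MVT2[of 0 "t - s", OF _ der] st obtain u where u: "0 < u" "u < t - s"
        "f (y + (t - s) *\<^sub>R i) - f (y + 0 *\<^sub>R i) = (t - s - 0) * partial_deriv i f (y + u *\<^sub>R i)"
        by auto
      have "f x = 0" "f y = 0" using x y by (auto simp: E_def)
      then have "partial_deriv i f (y + u *\<^sub>R i) = 0"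
        using u(3) st xy by simp
      moreover have "y + u *\<^sub>R i \<in> ball x0 e"
        using inb[of u] u \<delta> by (auto simp: \<delta>_def)
      ultimately show False using e(2) by blast
    qed
    define A where "A k = (+) ((\<delta> / real (Suc k)) *\<^sub>R i) ` E" for k
    have Am: "A k \<in> lmeasurable" and Ameas: "measure lebesgue (A k) = measure lebesgue E" for k
      using Em by (auto simp: A_def measurable_translation measure_translation)
    have Adisj: "A k \<inter> A l = {}" if "k \<noteq> l" for k l
    proof -
      have *: "A k \<inter> A l = {}" if "k < l" for k l
      proof -
        have "\<delta> / real (Suc l) < \<delta> / real (Suc k)"
          using that \<delta> by (intro divide_strict_left_mono) auto
        then show ?thesis
          using disj by (auto simp: A_def add.commute) metis
      qed
      show ?thesis using that *[of k l] *[of l k] by (cases "k < l") auto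
    qed
    have Asub: "A k \<subseteq> ball x0 e" for k
    proof
      fix z assume "z \<in> A k"
      then obtain x where x: "x \<in> E" "z = (\<delta> / real (Suc k)) *\<^sub>R i + x" by (auto simp: A_def)
      have "\<delta> / real (Suc k) \<le> \<delta>" using \<delta> by (simp add: divide_le_eq)
      then have "norm ((\<delta> / real (Suc k)) *\<^sub>R i) \<le> \<delta>"
        using i \<delta> by simp
      moreover have "dist x0 x < \<delta>" using x by (simp add: E_def)
      moreover have "dist x0 z \<le> dist x0 x + norm ((\<delta> / real (Suc k)) *\<^sub>R i)"
        unfolding x(2) dist_norm by (metis (no_types) add.commute diff_diff_eq norm_triangle_ineq4)
      ultimately have "dist x0 z < e" using \<delta>_def by linarith
      then show "z \<in> ball x0 e" by simp
    qed
    have bound: "real n * measure lebesgue E \<le> measure lebesgue (ball x0 e)" for n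
    proof -
      have "real n * measure lebesgue E = (\<Sum>k<n. measure lebesgue (A k))"
        by (simp add: Ameas)
      also have "\<dots> = measure lebesgue (\<Union>k<n. A k)"
      proof (rule measure_finite_Union[symmetric])
        show "A ` {..<n} \<subseteq> sets lebesgue" using Am by blast
        show "disjoint_family_on A {..<n}" using Adisj by (auto simp: disjoint_family_on_def)
        show "emeasure lebesgue (A k) \<noteq> \<infinity>" for k
          using fmeasurableD2[OF Am[of k]] by simp
      qed simp
      also have "\<dots> \<le> measure lebesgue (ball x0 e)"
        by (rule measure_mono_fmeasurable) (use Am Asub in \<open>auto intro!: sets.finite_UN\<close>)
      finally show ?thesis .
    qed
    have "measure lebesgue E = 0"
    proof (rule ccontr)
      assume "measure lebesgue E \<noteq> 0"
      then have "measure lebesgue E > 0" by (simp add: less_le)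
      then obtain n where "measure lebesgue (ball x0 e) < real n * measure lebesgue E"
        using reals_Archimedean3 by blast
      then show False using bound[of n] by linarith
    qed
    then have "negligible E" using negligible_iff_measure Em by blast
    then have "negligible (N \<inter> ball x0 \<delta>)"
      by (rule negligible_subset) (auto simp: N_def E_def)
    moreover have "openin (top_of_set N) (N \<inter> ball x0 \<delta>)"
      by (rule openin_open_Int[OF open_ball])
    ultimately show "\<exists>V. openin (top_of_set N) V \<and> x0 \<in> V \<and> negligible V"
      using x0 \<delta> by (metis IntI centre_in_ball)
  qed
  then show ?thesis by (simp add: N_def)
qed

section \<open>Identification of the representative\<close>

lemma integral_lborel_affine:
  fixes f :: "'a::euclidean_space \<Rightarrow> real"
  assumes [measurable]: "f \<in> borel_measurable borel" and c: "c > 0"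
  shows "(LBINT x. f x) = c ^ DIM('a) * (LBINT y. f (t + c *\<^sub>R y))"
proof -
  have "(LBINT x. f x) = (\<integral>x. f x \<partial>density (distr lborel borel (\<lambda>x. t + c *\<^sub>R x)) (\<lambda>_. \<bar>c\<bar> ^ DIM('a)))"
    using lborel_affine[of c t] c by simp
  also have "\<dots> = (\<integral>x. \<bar>c\<bar> ^ DIM('a) *\<^sub>R f x \<partial>distr lborel borel (\<lambda>x. t + c *\<^sub>R x))"
    by (rule integral_density) auto
  also have "\<dots> = (LBINT y. \<bar>c\<bar> ^ DIM('a) *\<^sub>R f (t + c *\<^sub>R y))"
    by (rule integral_distr) auto
  finally show ?thesis using c by simp
qed

context almost_biharmonic
begin

text \<open>Fubini and the substitution x = z + r y move the averaging from U to the smooth function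
  \<theta>; the Jacobian r^n cancels the normalisation of \<open>mol\<close>.\<close>

lemma integral_mol:
  assumes \<theta>: "test_function UNIV \<theta>" and r: "r > 0"
  shows "(LBINT x. \<theta> x * mol r x) = (LBINT z. U z * (LBINT y. \<theta> (z + r *\<^sub>R y) * mker y))"
proof -
  define h where "h x z = \<theta> x * (U z * mker ((1 / r) *\<^sub>R (x - z))) / r ^ DIM('a)" for x z
  have [measurable]: "\<theta> \<in> borel_measurable borel" "U \<in> borel_measurable borel"
    and mm [measurable]: "(mker :: 'a \<Rightarrow> real) \<in> borel_measurable borel"
    using U test_function_measurable[OF \<theta>] test_function_measurable[OF test_function_mker] by auto
  obtain M where M: "M > 0" "\<And>y. \<bar>mker (y::'a)\<bar> \<le> M"
    using test_function_mker by (rule test_function_bounded) blast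
  have \<theta>int: "integrable lborel \<theta>" by (rule test_function_integrable[OF \<theta>])
  have prod: "integrable (lborel \<Otimes>\<^sub>M lborel) (\<lambda>(x, z). \<theta> x * U z)"
  proof (rule lborel_pair.Fubini_integrable)
    show "(\<lambda>(x, z). \<theta> x * U z) \<in> borel_measurable (lborel \<Otimes>\<^sub>M lborel)" by measurable
    show "integrable lborel (\<lambda>x. LBINT z. norm (case (x, z) of (x, z) \<Rightarrow> \<theta> x * U z))"
      using \<theta>int by (simp add: abs_mult)
    show "AE x in lborel. integrable lborel (\<lambda>z. case (x, z) of (x, z) \<Rightarrow> \<theta> x * U z)"
      using U by simp
  qed
  have "integrable (lborel \<Otimes>\<^sub>M lborel) (case_prod h)"
  proof (rule Bochner_Integration.integrable_bound)
    show "integrable (lborel \<Otimes>\<^sub>M lborel) (\<lambda>p. (M / r ^ DIM('a)) * (case p of (x, z) \<Rightarrow> \<theta> x * U z))"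
      using prod by simp
    have "(\<lambda>p::'a \<times> 'a. mker ((1 / r) *\<^sub>R (fst p - snd p))) \<in> borel_measurable (lborel \<Otimes>\<^sub>M lborel)"
      by (rule measurable_compose[OF _ mm]) measurable
    then show "case_prod h \<in> borel_measurable (lborel \<Otimes>\<^sub>M lborel)"
      unfolding h_def case_prod_beta' by measurable
    show "AE p in lborel \<Otimes>\<^sub>M lborel. norm (case_prod h p) \<le> norm ((M / r ^ DIM('a)) * (case p of (x, z) \<Rightarrow> \<theta> x * U z))"
    proof (intro AE_I2)
      fix p :: "'a \<times> 'a"
      obtain x z where p: "p = (x, z)" by fastforce
      have "\<bar>\<theta> x * U z\<bar> * \<bar>mker ((1 / r) *\<^sub>R (x - z))\<bar> / r ^ DIM('a) \<le> \<bar>\<theta> x * U z\<bar> * M / r ^ DIM('a)"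
        using M r by (intro divide_right_mono mult_left_mono) auto
      then show "norm (case_prod h p) \<le> norm ((M / r ^ DIM('a)) * (case p of (x, z) \<Rightarrow> \<theta> x * U z))"
        using M r by (simp add: p h_def abs_mult abs_divide mult_ac)
    qed
  qed
  from lborel_pair.Fubini_integral[OF this]
  have F: "(LBINT z. (LBINT x. h x z)) = (LBINT x. (LBINT z. h x z))" .
  have l: "(LBINT z. h x z) = \<theta> x * mol r x" for x
    unfolding h_def mol_def rconv_def by simp
  have r': "(LBINT x. h x z) = U z * (LBINT y. \<theta> (z + r *\<^sub>R y) * mker y)" for z
  proof -
    have m: "(\<lambda>x. mker ((1 / r) *\<^sub>R (x - z))) \<in> borel_measurable borel"
      by (rule measurable_compose[OF _ mm]) measurable
    have "(LBINT x. h x z) = r ^ DIM('a) * (LBINT y. h (z + r *\<^sub>R y) z)"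
      by (rule integral_lborel_affine[OF _ r]) (use m in \<open>unfold h_def, measurable\<close>)
    also have "(\<lambda>y. h (z + r *\<^sub>R y) z) = (\<lambda>y. (U z / r ^ DIM('a)) * (\<theta> (z + r *\<^sub>R y) * mker y))"
      using r by (simp add: h_def mult.left_commute)
    finally show ?thesis using r by simp
  qed
  show ?thesis using F by (simp only: l r')
qed

text \<open>U is merely integrable, so the limit is taken on the other factor: the averages of
  \<theta> converge pointwise by continuity and are bounded, and dominated convergence applies
  twice.\<close>

lemma tendsto_integral_mol:
  assumes \<theta>: "test_function UNIV \<theta>"
  shows "(\<lambda>k. LBINT x. \<theta> x * mol (inverse (real (Suc k))) x) \<longlonglongrightarrow> (LBINT z. U z * (\<theta> z * mass))"
proof -
  let ?r = "\<lambda>k. inverse (real (Suc k))"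
  have [measurable]: "\<theta> \<in> borel_measurable borel" "U \<in> borel_measurable borel"
    "(mker :: 'a \<Rightarrow> real) \<in> borel_measurable borel"
    using U test_function_measurable[OF \<theta>] test_function_measurable[OF test_function_mker] by auto
  obtain M where M: "M > 0" "\<And>y. \<bar>\<theta> y\<bar> \<le> M"
    using \<theta> by (rule test_function_bounded) blast
  have mint: "integrable lborel (mker :: 'a \<Rightarrow> real)"
    by (rule test_function_integrable[OF test_function_mker])
  have bd: "norm (\<theta> (z + r *\<^sub>R y) * mker y) \<le> M * \<bar>mker y\<bar>" for z r and y :: 'a
    using M by (simp add: abs_mult mult_right_mono)
  have int: "integrable lborel (\<lambda>y. \<theta> (z + r *\<^sub>R y) * mker y)" for z r
    by (rule Bochner_Integration.integrable_bound[where f="\<lambda>y. M * \<bar>mker y\<bar>"])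
      (use mint bd M in \<open>auto intro!: AE_I2 simp: abs_mult mult_right_mono\<close>)
  have inner: "(\<lambda>k. LBINT y. \<theta> (z + ?r k *\<^sub>R y) * mker y) \<longlonglongrightarrow> \<theta> z * mass" for z
  proof -
    have "(\<lambda>k. LBINT y. \<theta> (z + ?r k *\<^sub>R y) * mker y) \<longlonglongrightarrow> (LBINT y. \<theta> z * mker (y::'a))"
    proof (rule integral_dominated_convergence[where w="\<lambda>y. M * \<bar>mker y\<bar>"])
      show "integrable lborel (\<lambda>y::'a. M * \<bar>mker y\<bar>)" using mint by simp
      show "AE y in lborel. (\<lambda>k. \<theta> (z + ?r k *\<^sub>R y) * mker y) \<longlonglongrightarrow> \<theta> z * mker y"
      proof (intro AE_I2 tendsto_mult tendsto_const)
        fix y :: 'a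
        have "(\<lambda>k. z + ?r k *\<^sub>R y) \<longlonglongrightarrow> z + 0 *\<^sub>R y"
          by (intro tendsto_intros LIMSEQ_inverse_real_of_nat)
        then have "(\<lambda>k. z + ?r k *\<^sub>R y) \<longlonglongrightarrow> z" by simp
        moreover have "isCont \<theta> z"
          using test_function_continuous[OF \<theta>, of UNIV] by (simp add: continuous_on_eq_continuous_at)
        ultimately show "(\<lambda>k. \<theta> (z + ?r k *\<^sub>R y)) \<longlonglongrightarrow> \<theta> z"
          using isCont_tendsto_compose by blast
      qed
      show "AE y in lborel. norm (\<theta> (z + ?r k *\<^sub>R y) * mker y) \<le> M * \<bar>mker y\<bar>" for k
        by (intro AE_I2 bd)
    qed measurable
    then show ?thesis by (simp add: mass_def)
  qed
  have "(\<lambda>k. LBINT z. U z * (LBINT y. \<theta> (z + ?r k *\<^sub>R y) * mker y)) \<longlonglongrightarrow> (LBINT z. U z * (\<theta> z * mass))"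
  proof (rule integral_dominated_convergence[where w="\<lambda>z. \<bar>U z\<bar> * (M * (LBINT y. \<bar>mker (y::'a)\<bar>))"])
    show "AE z in lborel. (\<lambda>k. U z * (LBINT y. \<theta> (z + ?r k *\<^sub>R y) * mker y)) \<longlonglongrightarrow> U z * (\<theta> z * mass)"
      by (intro AE_I2 tendsto_mult tendsto_const inner)
    show "integrable lborel (\<lambda>z. \<bar>U z\<bar> * (M * (LBINT y. \<bar>mker (y::'a)\<bar>)))"
      using U by simp
    show "AE z in lborel. norm (U z * (LBINT y. \<theta> (z + ?r k *\<^sub>R y) * mker y)) \<le> \<bar>U z\<bar> * (M * (LBINT y. \<bar>mker (y::'a)\<bar>))" for k
    proof (intro AE_I2)
      fix z
      have "norm (LBINT y. \<theta> (z + ?r k *\<^sub>R y) * mker y) \<le> (LBINT y. norm (\<theta> (z + ?r k *\<^sub>R y) * mker y))"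
        by (rule integral_norm_bound)
      also have "\<dots> \<le> (LBINT y. M * \<bar>mker (y::'a)\<bar>)"
        by (rule integral_mono) (use int mint bd in auto)
      finally show "norm (U z * (LBINT y. \<theta> (z + ?r k *\<^sub>R y) * mker y)) \<le> \<bar>U z\<bar> * (M * (LBINT y. \<bar>mker (y::'a)\<bar>))"
        by (simp add: abs_mult mult_left_mono)
    qed
  qed measurable
  then show ?thesis
    by (simp add: integral_mol[OF \<theta>])
qed

text \<open>The integrals of \<open>\<theta> x * mol r x\<close> have two limits, which must agree:
  one from the uniform convergence of \<open>mol\<close> on the compact set K, one from moving the
  mollification onto \<theta>. The common factor \<open>mass\<close> cancels because it is
  positive.\<close>

lemma integral_repr_test:
  assumes \<theta>: "test_function \<Omega> \<theta>" and K: "compact K" "K \<subseteq> \<Omega>" "\<And>x. x \<notin> K \<Longrightarrow> \<theta> x = 0"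
  shows "(LBINT x. (indicator K x * repr x) * \<theta> x) = (LBINT x. U x * \<theta> x)"
    and "integrable lborel (\<lambda>x. (indicator K x * repr x) * \<theta> x)"
proof -
  let ?r = "\<lambda>k. inverse (real (Suc k))"
  have \<theta>': "test_function UNIV \<theta>" by (rule test_function_UNIV[OF \<theta>])
  have rint: "integrable lborel (\<lambda>x. indicator K x * repr x)"
    using borel_integrable_compact[OF K(1) continuous_on_subset[OF continuous_on_repr K(2)]]
    by simp
  show R: "integrable lborel (\<lambda>x. (indicator K x * repr x) * \<theta> x)"
    by (rule test_function_integrable_mult[OF \<theta> rint])
  obtain e where e: "e > 0" "(\<Union>x\<in>K. cball x e) \<subseteq> \<Omega>"
    using compact_subset_open_imp_cball_epsilon_subset[OF K(1) open_domain K(2)] by blast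
  obtain C where C: "C \<ge> 0"
    "\<And>x r. r > 0 \<Longrightarrow> cball x r \<subseteq> \<Omega> \<Longrightarrow> \<bar>mol r x - mass * repr x\<bar> \<le> C * r * r"
    using mol_approx by metis
  have molint: "integrable lborel (\<lambda>x. \<theta> x * mol r x)" for r
  proof -
    have "smooth_on UNIV (\<lambda>x. mol r x * 1)"
      using smooth_on_mult[OF smooth_on_rconv[OF U test_function_mker] smooth_on_const[of UNIV "1 / r ^ DIM('a)"]]
      by (simp add: mol_def)
    then have "test_function \<Omega> (\<lambda>x. mol r x * \<theta> x)"
      using test_function_mult[OF \<theta>] by simp
    then show ?thesis using test_function_integrable by (simp add: mult.commute)
  qed
  have diff: "\<bar>(LBINT x. \<theta> x * mol r x) - mass * (LBINT x. (indicator K x * repr x) * \<theta> x)\<bar> \<le> C * r * r * (LBINT x. \<bar>\<theta> x\<bar>)"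
    if r: "0 < r" "r \<le> e" for r
  proof -
    have "(LBINT x. \<theta> x * mol r x) - mass * (LBINT x. (indicator K x * repr x) * \<theta> x) =
        (LBINT x. \<theta> x * mol r x - mass * ((indicator K x * repr x) * \<theta> x))"
      using molint R by simp
    also have "norm \<dots> \<le> (LBINT x. norm (\<theta> x * mol r x - mass * ((indicator K x * repr x) * \<theta> x)))"
      by (rule integral_norm_bound)
    also have "\<dots> \<le> (LBINT x. C * r * r * \<bar>\<theta> x\<bar>)"
    proof (rule integral_mono)
      show "integrable lborel (\<lambda>x. norm (\<theta> x * mol r x - mass * ((indicator K x * repr x) * \<theta> x)))"
        using molint R by (intro integrable_norm Bochner_Integration.integrable_diff integrable_mult_right)
      show "integrable lborel (\<lambda>x. C * r * r * \<bar>\<theta> x\<bar>)"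
        using test_function_integrable[OF \<theta>] by simp
      fix x
      show "norm (\<theta> x * mol r x - mass * ((indicator K x * repr x) * \<theta> x)) \<le> C * r * r * \<bar>\<theta> x\<bar>"
      proof (cases "x \<in> K")
        case True
        then have "cball x r \<subseteq> \<Omega>" using e r by (meson UN_upper order_trans subset_cball)
        then have "\<bar>mol r x - mass * repr x\<bar> * \<bar>\<theta> x\<bar> \<le> C * r * r * \<bar>\<theta> x\<bar>"
          using C(2) r by (intro mult_right_mono) auto
        then show ?thesis using True by (simp add: abs_mult[symmetric] algebra_simps)
      qed (simp add: K(3))
    qed
    finally show ?thesis by simp
  qed
  have "(\<lambda>k. (LBINT x. \<theta> x * mol (?r k) x)) \<longlonglongrightarrow> mass * (LBINT x. (indicator K x * repr x) * \<theta> x)"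
  proof -
    have "(\<lambda>k. C * ?r k * ?r k * (LBINT x. \<bar>\<theta> x\<bar>)) \<longlonglongrightarrow> C * 0 * 0 * (LBINT x. \<bar>\<theta> x\<bar>)"
      by (intro tendsto_intros LIMSEQ_inverse_real_of_nat)
    then have z: "(\<lambda>k. C * ?r k * ?r k * (LBINT x. \<bar>\<theta> x\<bar>)) \<longlonglongrightarrow> 0" by simp
    have "eventually (\<lambda>k. ?r k < e) sequentially"
      using LIMSEQ_inverse_real_of_nat e(1) by (rule order_tendstoD)
    then have "eventually (\<lambda>k. norm ((LBINT x. \<theta> x * mol (?r k) x) - mass * (LBINT x. (indicator K x * repr x) * \<theta> x))
        \<le> C * ?r k * ?r k * (LBINT x. \<bar>\<theta> x\<bar>)) sequentially"
      by eventually_elim (use diff in simp)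
    from Lim_null_comparison[OF this z] show ?thesis
      by (simp only: LIM_zero_iff)
  qed
  from LIMSEQ_unique[OF this tendsto_integral_mol[OF \<theta>']]
  have "mass * (LBINT x. (indicator K x * repr x) * \<theta> x) = (LBINT z. mass * (U z * \<theta> z))"
    by (simp add: mult_ac)
  then show "(LBINT x. (indicator K x * repr x) * \<theta> x) = (LBINT x. U x * \<theta> x)"
    using mass_pos by simp
qed

lemma AE_eq_repr: "AE x in lebesgue. x \<in> \<Omega> \<longrightarrow> U x - repr x = 0"
proof (rule AE_zero_of_test_functions[OF open_domain])
  have Um: "U \<in> borel_measurable borel" using U by auto
  show "locally_integrable_on \<Omega> (\<lambda>x. U x - repr x)"
    unfolding locally_integrable_on_def
  proof (intro allI impI)
    fix K assume K: "compact K \<and> K \<subseteq> \<Omega>"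
    have "integrable lebesgue U"
      using U integrable_completion[of U lborel] Um by simp
    then have "set_integrable lebesgue K U"
      unfolding set_integrable_def
      using K by (intro integrable_mult_indicator) (auto simp: compact_imp_closed)
    moreover have "set_integrable lebesgue K repr"
    proof -
      have i: "integrable lborel (\<lambda>x. indicator K x *\<^sub>R repr x)"
        using borel_integrable_compact continuous_on_subset[OF continuous_on_repr] K by blast
      then show ?thesis
        unfolding set_integrable_def
        using integrable_completion[of "\<lambda>x. indicator K x *\<^sub>R repr x" lborel] by auto
    qed
    ultimately show "set_integrable lebesgue K (\<lambda>x. U x - repr x)"
      by (rule set_integral_diff)
  qed
  fix \<theta> assume \<theta>: "test_function \<Omega> \<theta>"
  obtain K where K: "compact K" "K \<subseteq> \<Omega>" "\<And>x. x \<notin> K \<Longrightarrow> \<theta> x = 0"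
    using \<theta> by (rule test_functionE) blast
  note R = integral_repr_test[OF \<theta> K]
  have Ui: "integrable lborel (\<lambda>x. U x * \<theta> x)"
    by (rule test_function_integrable_mult[OF \<theta> U])
  have "(LINT x:\<Omega>|lebesgue. (U x - repr x) * \<theta> x) = (\<integral>x. U x * \<theta> x - (indicator K x * repr x) * \<theta> x \<partial>lebesgue)"
    unfolding set_lebesgue_integral_def
  proof (rule Bochner_Integration.integral_cong[OF refl])
    fix x
    show "indicator \<Omega> x *\<^sub>R ((U x - repr x) * \<theta> x) = U x * \<theta> x - (indicator K x * repr x) * \<theta> x"
      using K by (cases "x \<in> K") (auto simp: left_diff_distrib)
  qed
  also have "\<dots> = (LBINT x. U x * \<theta> x - (indicator K x * repr x) * \<theta> x)"
    by (rule integral_completion) (use Ui R(2) in \<open>auto intro!: borel_measurable_diff\<close>)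
  also have "\<dots> = 0"
    using Ui R by simp
  finally show "(LINT x:\<Omega>|lebesgue. (U x - repr x) * \<theta> x) = 0" .
qed

section \<open>Regularity away from the singular zero set\<close>

definition regular_set :: "'a set" where
  "regular_set = \<Omega> - {x\<in>\<Omega>. repr x = 0 \<and> grad repr x = 0}"

lemma Ck_on_1_repr: "Ck_on 1 \<Omega> repr"
  using C1_holder_on_repr[of "1 / 2"] by (simp add: C1_holder_on_def)

lemma regular_set_subset: "regular_set \<subseteq> \<Omega>"
  by (auto simp: regular_set_def)

lemma open_regular_set: "open regular_set"
proof -
  have eq: "regular_set = (\<Omega> \<inter> repr -` (- {0})) \<union> (\<Union>i\<in>Basis. \<Omega> \<inter> partial_deriv i repr -` (- {0}))"
    by (auto simp: regular_set_def grad_eq_0_iff)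
  have 1: "open (\<Omega> \<inter> repr -` (- {0}))"
    by (rule continuous_open_preimage[OF continuous_on_repr open_domain]) auto
  have 2: "open (\<Omega> \<inter> partial_deriv i repr -` (- {0}))" if "i \<in> Basis" for i
    using Ck_on_1_repr that by (intro continuous_open_preimage[OF _ open_domain]) auto
  show ?thesis unfolding eq by (intro open_Un open_UN ballI 1 2)
qed

lemma negligible_zeros_regular_set: "negligible {x \<in> regular_set. repr x = 0}"
proof (rule negligible_subset)
  show "negligible (\<Union>i\<in>Basis. {x \<in> \<Omega>. repr x = 0 \<and> partial_deriv i repr x \<noteq> 0})"
    by (rule negligible_Union) (auto intro: negligible_zero_set_regular[OF open_domain Ck_on_1_repr])
  show "{x \<in> regular_set. repr x = 0} \<subseteq> (\<Union>i\<in>Basis. {x \<in> \<Omega>. repr x = 0 \<and> partial_deriv i repr x \<noteq> 0})"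
    by (auto simp: regular_set_def grad_eq_0_iff)
qed

lemma integral_bilaplacian_eq_0:
  assumes \<phi>: "test_function regular_set \<phi>"
  shows "(LBINT z. U z * laplacian (laplacian \<phi>) z) = 0"
proof -
  have \<phi>': "test_function \<Omega> \<phi>"
    using \<phi> regular_set_subset by (rule test_function_mono)
  let ?S = "{z \<in> \<Omega>. U z = 0 \<and> \<phi> z \<noteq> 0}"
  note [measurable] = test_function_measurable[OF \<phi>] borel_open[OF open_domain]
  have [measurable]: "U \<in> borel_measurable borel" using U by auto
  have Sb: "?S \<in> sets lborel" by measurable
  \<comment> \<open>Where \<phi> is nonzero, a zero of U is up to a null set a zero of
    \<open>repr\<close> in \<open>regular_set\<close>; the two exceptional sets are collected
    here.\<close>
  have "negligible ({x. \<not> (x \<in> \<Omega> \<longrightarrow> U x - repr x = 0)} \<union> {x \<in> regular_set. repr x = 0})"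
    using AE_eq_repr negligible_zeros_regular_set AE_lebesgue_iff_negligible negligible_Un by blast
  then have "negligible ?S"
    by (rule negligible_subset) (use test_function_zero_outside[OF \<phi>] in auto)
  then have "measure lebesgue ?S = 0"
    using negligible_imp_measure0 by blast
  then have "measure lborel ?S = 0"
    using Sb by (simp add: measure_completion)
  then have "(LBINT z. U z * laplacian (laplacian \<phi>) z)\<^sup>2 \<le> 0"
    using almost_biharmonic[OF \<phi>'] by (simp only: mult_zero_left)
  then show ?thesis by simp
qed

lemma rconv_bilaplacian_eq_0:
  assumes \<kappa>: "unit_kernel \<kappa>" and r: "r > 0" and x: "cball x r \<subseteq> regular_set"
  shows "rconv U (laplacian (laplacian \<kappa>)) r x = 0"
proof -
  have "(LBINT z. U z * laplacian (laplacian (\<lambda>z. \<kappa> ((1 / r) *\<^sub>R (x - z)))) z) = 0"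
    by (rule integral_bilaplacian_eq_0[OF test_function_rescaled[OF \<kappa> r x]])
  moreover have "(LBINT z. U z * laplacian (laplacian (\<lambda>z. \<kappa> ((1 / r) *\<^sub>R (x - z)))) z) =
      (1 / r) ^ 4 * rconv U (laplacian (laplacian \<kappa>)) r x"
    unfolding bilaplacian_rescaled[OF unit_kernel_test[OF \<kappa>]] rconv_def integral_mult_right_zero[symmetric]
    by (simp only: mult.left_commute)
  ultimately show ?thesis using r by simp
qed

text \<open>The radius derivative of \<open>mol\<close> vanishes on such balls, so the limit at
  radius 0 is attained at radius R without any error term.\<close>

lemma mass_repr_eq_mol:
  assumes R: "R > 0" and x: "cball x R \<subseteq> regular_set"
  shows "mass * repr x = mol R x"
proof -
  let ?r = "\<lambda>k. inverse (real (Suc k))"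
  have x': "cball x R \<subseteq> \<Omega>" using x regular_set_subset by blast
  have const: "mol s x = mol R x" if s: "0 < s" "s < R" for s
  proof -
    have "((\<lambda>r. mol r x) has_real_derivative 0) (at t)" if t: "s \<le> t" "t \<le> R" for t
    proof -
      have t0: "t > 0" using s t by simp
      have "cball x t \<subseteq> regular_set" using x t by (meson order_trans subset_cball)
      then have "rconv U (laplacian (laplacian rker)) t x = 0"
        using t0 mollifier_pair_kernel by (intro rconv_bilaplacian_eq_0) (auto simp: mollifier_pair_def)
      then show ?thesis
        using rconv_pair_has_derivative[OF U mollifier_pair_kernel t0, of x] by (simp add: mol_def)
    qed
    from MVT2[OF s(2) this] show ?thesis by auto
  qed
  have lim: "(\<lambda>k. mol (?r k) x) \<longlonglongrightarrow> mass * repr x"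
    using mol_approx R x' by metis
  have "eventually (\<lambda>k. ?r k < R) sequentially"
    using LIMSEQ_inverse_real_of_nat R by (rule order_tendstoD)
  then have "eventually (\<lambda>k. mol (?r k) x = mol R x) sequentially"
    by eventually_elim (simp add: const)
  then have "(\<lambda>k. mol (?r k) x) \<longlonglongrightarrow> mol R x"
    by (rule tendsto_eventually)
  then show ?thesis
    using LIMSEQ_unique[OF lim] by simp
qed

text \<open>One radius serves all centres near \<open>x0\<close>. This is what turns the pointwise
  identity into a formula that can be differentiated in x; the factor c is 1 / (\<open>mass\<close>
  R^n).\<close>

lemma repr_local_form:
  assumes x0: "x0 \<in> regular_set"
  obtains R c where "R > 0" "ball x0 R \<subseteq> regular_set"
    "\<And>x. x \<in> ball x0 R \<Longrightarrow> cball x R \<subseteq> regular_set"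
    "\<And>x. x \<in> ball x0 R \<Longrightarrow> c * rconv U mker R x = repr x"
proof -
  obtain e where e: "e > 0" "cball x0 e \<subseteq> regular_set"
    using open_regular_set x0 open_contains_cball by blast
  define R where "R = e / 2"
  have R: "R > 0" using e by (simp add: R_def)
  have sub: "cball y R \<subseteq> regular_set" if "y \<in> ball x0 R" for y
    using cball_half_subset[of x0 y e] that e by (auto simp: R_def)
  show thesis
  proof (rule that[OF R _ sub])
    show "ball x0 R \<subseteq> regular_set"
      using sub R by (meson centre_in_ball order_trans ball_subset_cball)
    show "(1 / (mass * R ^ DIM('a))) * rconv U mker R x = repr x" if "x \<in> ball x0 R" for x
    proof -
      have "rconv U mker R x = mass * repr x * R ^ DIM('a)"
        using mass_repr_eq_mol[OF R sub[OF that]] R by (simp add: mol_def)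
      then show ?thesis using mass_pos R by simp
    qed
  qed
qed

lemma bilaplacian_cmult_rconv:
  "laplacian (laplacian (\<lambda>x. c * rconv U mker R x)) x = c * ((1 / R) ^ 4 * rconv U (laplacian (laplacian mker)) R x)"
proof -
  have t: "test_function UNIV (laplacian (mker :: 'a \<Rightarrow> real))"
    by (rule test_function_laplacian[OF test_function_mker])
  have 1: "laplacian (\<lambda>x. c * rconv U mker R x) = (\<lambda>x. (c * (1 / R)\<^sup>2) * rconv U (laplacian mker) R x)"
    using laplacian_cmult[OF smooth_on_rconv[OF U test_function_mker]] laplacian_rconv[OF U test_function_mker]
    by (auto simp: fun_eq_iff)
  show ?thesis
    unfolding 1 laplacian_cmult[OF smooth_on_rconv[OF U t]] laplacian_rconv[OF U t]
    by (simp add: power2_eq_square power4_eq_xxxx)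
qed

theorem smooth_on_repr: "smooth_on regular_set repr"
  unfolding smooth_on_def
proof (intro allI Ck_on_local)
  fix k x0 assume "x0 \<in> regular_set"
  then obtain R c where R: "R > 0" "\<And>x. x \<in> ball x0 R \<Longrightarrow> c * rconv U mker R x = repr x"
    using repr_local_form by metis
  have "Ck_on k (ball x0 R) (\<lambda>x. c * rconv U mker R x)"
    using Ck_on_subset[OF smooth_onD[OF smooth_on_rconv[OF U test_function_mker]]]
    by (intro Ck_on_mult) auto
  then have "Ck_on k (ball x0 R) repr"
    by (rule Ck_on_cong[OF open_ball, rotated]) (rule R(2))
  then show "\<exists>T. open T \<and> x0 \<in> T \<and> Ck_on k T repr"
    using R(1) by (intro exI[of _ "ball x0 R"]) auto
qed

text \<open>The bilaplacian of the local formula convolves U with the bilaplacian of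
  \<open>mker\<close>. That kernel is itself supported in the unit ball, so the vanishing result
  used for \<open>rker\<close> in the radius derivative applies to \<open>mker\<close> as
  well.\<close>

theorem biharmonic_on_repr: "biharmonic_on regular_set repr"
  unfolding biharmonic_on_def
proof (intro conjI ballI)
  show "Ck_on 4 regular_set repr"
    using smooth_on_repr by (rule smooth_onD)
  fix x0 assume "x0 \<in> regular_set"
  then obtain R c where R: "R > 0" "\<And>x. x \<in> ball x0 R \<Longrightarrow> cball x R \<subseteq> regular_set"
    "\<And>x. x \<in> ball x0 R \<Longrightarrow> c * rconv U mker R x = repr x"
    using repr_local_form by metis
  let ?v = "\<lambda>x. c * rconv U mker R x"
  have v: "smooth_on UNIV ?v"
    by (intro smooth_on_mult smooth_on_const smooth_on_rconv[OF U test_function_mker])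
  have x0: "x0 \<in> ball x0 R" using R by simp
  have "laplacian repr x = laplacian ?v x" if "x \<in> ball x0 R" for x
  proof (rule laplacian_cong[OF open_ball that])
    show "?v y = repr y" if "y \<in> ball x0 R" for y using R(3)[OF that] .
    show "Ck_on 2 (ball x0 R) ?v" using Ck_on_subset[OF smooth_onD[OF v]] by blast
  qed
  then have "laplacian (laplacian repr) x0 = laplacian (laplacian ?v) x0"
    using Ck_on_subset[OF smooth_onD[OF smooth_on_laplacian[OF v]] subset_UNIV]
    by (intro laplacian_cong[OF open_ball x0]) auto
  also have "\<dots> = 0"
  proof -
    have "unit_kernel (mker :: 'a \<Rightarrow> real)"
      using mollifier_pair_kernel[where 'a='a] unfolding mollifier_pair_def by blast
    from rconv_bilaplacian_eq_0[OF this R(1) R(2)[OF x0]] show ?thesis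
      by (simp add: bilaplacian_cmult_rconv)
  qed
  finally show "laplacian (laplacian repr) x0 = 0" .
qed

end

section \<open>Weak derivatives\<close>

lemma locally_integrable_mult_test:
  assumes u: "locally_integrable_on \<Omega> u" and \<psi>: "test_function \<Omega> \<psi>"
  shows "set_integrable lebesgue \<Omega> (\<lambda>x. u x * \<psi> x)"
proof -
  obtain K where K: "compact K" "K \<subseteq> \<Omega>" "\<And>x. x \<notin> K \<Longrightarrow> \<psi> x = 0"
    using \<psi> by (rule test_functionE) blast
  obtain C where C: "C > 0" "\<And>x. \<bar>\<psi> x\<bar> \<le> C"
    using \<psi> by (rule test_function_bounded) blast
  have uK: "integrable lebesgue (\<lambda>x. indicator K x *\<^sub>R u x)"
    using u K by (simp add: locally_integrable_on_def set_integrable_def)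
  have "integrable lebesgue (\<lambda>x. (indicator K x *\<^sub>R u x) * \<psi> x)"
    using test_function_measurable[OF \<psi>] C(2)
    by (intro integrable_mult_bounded[OF uK]) (simp_all add: measurable_completion)
  moreover have "(\<lambda>x. (indicator K x *\<^sub>R u x) * \<psi> x) = (\<lambda>x. indicator \<Omega> x *\<^sub>R (u x * \<psi> x))"
  proof
    fix x
    show "(indicator K x *\<^sub>R u x) * \<psi> x = indicator \<Omega> x *\<^sub>R (u x * \<psi> x)"
      using K by (cases "x \<in> K") auto
  qed
  ultimately show ?thesis
    by (simp add: set_integrable_def)
qed

lemma integrable_lebesgue_of_lborel:
  fixes f :: "'a::euclidean_space \<Rightarrow> real"
  assumes "integrable lborel f"
  shows "integrable lebesgue f"
proof -
  have "f \<in> borel_measurable lborel" using assms by (rule borel_measurable_integrable)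
  then show ?thesis using integrable_completion[of f lborel] assms by simp
qed

lemma locally_integrable_test:
  assumes "test_function \<Omega>' \<phi>"
  shows "locally_integrable_on \<Omega> \<phi>"
  unfolding locally_integrable_on_def set_integrable_def
proof (intro allI impI integrable_mult_indicator)
  show "integrable lebesgue \<phi>"
    by (rule integrable_lebesgue_of_lborel[OF test_function_integrable[OF assms]])
qed (auto simp: compact_imp_closed)

lemma locally_integrable_add:
  "locally_integrable_on \<Omega> u \<Longrightarrow> locally_integrable_on \<Omega> v \<Longrightarrow> locally_integrable_on \<Omega> (\<lambda>x. u x + v x)"
  unfolding locally_integrable_on_def by (auto intro: set_integral_add)

lemma locally_integrable_diff:
  "locally_integrable_on \<Omega> u \<Longrightarrow> locally_integrable_on \<Omega> v \<Longrightarrow> locally_integrable_on \<Omega> (\<lambda>x. u x - v x)"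
  unfolding locally_integrable_on_def by (auto intro: set_integral_diff)

text \<open>Passes from the weak formulation, with Lebesgue integrals over \<Omega>, to Borel
  functions on the whole space. The test function kills everything outside \<Omega>.\<close>

lemma set_integral_AE_eq_lborel:
  assumes \<psi>: "test_function \<Omega> \<psi>" and v: "v \<in> borel_measurable borel"
    and uv: "AE x in lebesgue. x \<in> \<Omega> \<longrightarrow> u x = v x"
  shows "(LINT x:\<Omega>|lebesgue. u x * \<psi> x) = (LBINT x. v x * \<psi> x)"
proof -
  have ae: "AE x in lebesgue. v x * \<psi> x = indicator \<Omega> x *\<^sub>R (u x * \<psi> x)"
    using uv by eventually_elim (use test_function_zero_outside[OF \<psi>] in \<open>auto simp: indicator_def\<close>)
  have m: "(\<lambda>x. v x * \<psi> x) \<in> borel_measurable lborel"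
    using v test_function_measurable[OF \<psi>] by simp
  have m': "(\<lambda>x. v x * \<psi> x) \<in> borel_measurable lebesgue"
    by (rule measurable_completion[OF m])
  have "(LINT x:\<Omega>|lebesgue. u x * \<psi> x) = (\<integral>x. v x * \<psi> x \<partial>lebesgue)"
    unfolding set_lebesgue_integral_def
  proof (rule integral_cong_AE[OF borel_measurable_AE[OF m' ae] m'])
    show "AE x in lebesgue. indicator \<Omega> x *\<^sub>R (u x * \<psi> x) = v x * \<psi> x"
      using ae by eventually_elim (erule sym)
  qed
  also have "\<dots> = (LBINT x. v x * \<psi> x)"
    by (rule integral_completion[OF m])
  finally show ?thesis .
qed

text \<open>The product of the two functions is a test function, so the integral of its partial
  derivative vanishes.\<close>

lemma integral_by_parts_test:
  fixes \<phi> \<psi> :: "'a::euclidean_space \<Rightarrow> real"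
  assumes \<phi>: "test_function UNIV \<phi>" and \<psi>: "test_function \<Omega> \<psi>" and i: "i \<in> Basis"
  shows "(LINT x:\<Omega>|lebesgue. \<phi> x * partial_deriv i \<psi> x) = - (LINT x:\<Omega>|lebesgue. partial_deriv i \<phi> x * \<psi> x)"
proof -
  have \<phi>i: "test_function UNIV (partial_deriv i \<phi>)" and \<psi>i: "test_function \<Omega> (partial_deriv i \<psi>)"
    using \<phi> \<psi> i test_function_partial by auto
  have "0 = (LBINT x. partial_deriv i (\<lambda>x. \<phi> x * \<psi> x) x)"
    using integral_partial_deriv_test[OF test_function_mult[OF \<psi> test_function_smooth[OF \<phi>]] i] by simp
  also have "\<dots> = (LBINT x. \<phi> x * partial_deriv i \<psi> x + partial_deriv i \<phi> x * \<psi> x)"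
    by (simp add: partial_deriv_mult[OF test_function_differentiable[OF \<phi>] test_function_differentiable[OF \<psi>]])
  also have "\<dots> = (LBINT x. \<phi> x * partial_deriv i \<psi> x) + (LBINT x. partial_deriv i \<phi> x * \<psi> x)"
    by (intro Bochner_Integration.integral_add test_function_integrable_mult[OF \<psi>i] test_function_integrable_mult[OF \<psi>]
        test_function_integrable[OF \<phi>] test_function_integrable[OF \<phi>i])
  finally show ?thesis
    using set_integral_AE_eq_lborel[OF \<psi>i test_function_measurable[OF \<phi>], of \<phi>]
      set_integral_AE_eq_lborel[OF \<psi> test_function_measurable[OF \<phi>i], of "partial_deriv i \<phi>"] by simp
qed

lemma has_weak_partial_add_test:
  fixes u :: "'a::euclidean_space \<Rightarrow> real"
  assumes u: "has_weak_partial \<Omega> i u g" and \<phi>: "test_function UNIV \<phi>" and i: "i \<in> Basis"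
  shows "has_weak_partial \<Omega> i (\<lambda>x. u x + \<phi> x) (\<lambda>x. g x + partial_deriv i \<phi> x)"
proof -
  have \<phi>i: "test_function UNIV (partial_deriv i \<phi>)"
    using \<phi> i by (rule test_function_partial)
  have li: "locally_integrable_on \<Omega> u" "locally_integrable_on \<Omega> g"
    "locally_integrable_on \<Omega> \<phi>" "locally_integrable_on \<Omega> (partial_deriv i \<phi>)"
    using u locally_integrable_test[OF \<phi>] locally_integrable_test[OF \<phi>i] by (auto simp: has_weak_partial_def)
  have "(LINT x:\<Omega>|lebesgue. (u x + \<phi> x) * partial_deriv i \<psi> x) = - (LINT x:\<Omega>|lebesgue. (g x + partial_deriv i \<phi> x) * \<psi> x)"
    if \<psi>: "test_function \<Omega> \<psi>" for \<psi>
  proof -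
    have \<psi>i: "test_function \<Omega> (partial_deriv i \<psi>)"
      using \<psi> i by (rule test_function_partial)
    have "(LINT x:\<Omega>|lebesgue. (u x + \<phi> x) * partial_deriv i \<psi> x) =
        (LINT x:\<Omega>|lebesgue. u x * partial_deriv i \<psi> x) + (LINT x:\<Omega>|lebesgue. \<phi> x * partial_deriv i \<psi> x)"
      unfolding distrib_right by (intro set_integral_add locally_integrable_mult_test[OF _ \<psi>i] li)
    also have "\<dots> = - (LINT x:\<Omega>|lebesgue. g x * \<psi> x) - (LINT x:\<Omega>|lebesgue. partial_deriv i \<phi> x * \<psi> x)"
      using u \<psi> integral_by_parts_test[OF \<phi> \<psi> i] by (simp add: has_weak_partial_def)
    also have "\<dots> = - (LINT x:\<Omega>|lebesgue. (g x + partial_deriv i \<phi> x) * \<psi> x)"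
      unfolding distrib_right
      using set_integral_add(2)[OF locally_integrable_mult_test[OF li(2) \<psi>] locally_integrable_mult_test[OF li(4) \<psi>]]
      by simp
    finally show ?thesis .
  qed
  then show ?thesis
    using li by (auto simp: has_weak_partial_def intro: locally_integrable_add)
qed

lemma has_weak_partial_unique:
  assumes \<Omega>: "open \<Omega>" and g: "has_weak_partial \<Omega> i u g" and h: "has_weak_partial \<Omega> i u h"
  shows "AE x in lebesgue. x \<in> \<Omega> \<longrightarrow> g x = h x"
proof -
  have "AE x in lebesgue. x \<in> \<Omega> \<longrightarrow> g x - h x = 0"
  proof (rule AE_zero_of_test_functions[OF \<Omega>])
    show "locally_integrable_on \<Omega> (\<lambda>x. g x - h x)"
      using g h by (auto simp: has_weak_partial_def intro: locally_integrable_diff)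
    fix \<psi> assume \<psi>: "test_function \<Omega> \<psi>"
    have gi: "set_integrable lebesgue \<Omega> (\<lambda>x. g x * \<psi> x)" and hi: "set_integrable lebesgue \<Omega> (\<lambda>x. h x * \<psi> x)"
      using g h \<psi> by (auto simp: has_weak_partial_def intro: locally_integrable_mult_test)
    have "(LINT x:\<Omega>|lebesgue. g x * \<psi> x) = (LINT x:\<Omega>|lebesgue. h x * \<psi> x)"
      using g h \<psi> unfolding has_weak_partial_def by (metis neg_equal_iff_equal)
    then show "(LINT x:\<Omega>|lebesgue. (g x - h x) * \<psi> x) = 0"
      unfolding left_diff_distrib set_integral_diff(2)[OF gi hi] by simp
  qed
  then show ?thesis by eventually_elim auto
qed

lemma has_weak_partial_cong_AE:
  assumes u: "has_weak_partial \<Omega> i u g" and v: "locally_integrable_on \<Omega> v" and i: "i \<in> Basis"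
    and ae: "AE x in lebesgue. x \<in> \<Omega> \<longrightarrow> u x = v x"
  shows "has_weak_partial \<Omega> i v g"
proof -
  have "(LINT x:\<Omega>|lebesgue. u x * partial_deriv i \<psi> x) = (LINT x:\<Omega>|lebesgue. v x * partial_deriv i \<psi> x)"
    if \<psi>: "test_function \<Omega> \<psi>" for \<psi>
  proof -
    have \<psi>i: "test_function \<Omega> (partial_deriv i \<psi>)"
      using \<psi> i by (rule test_function_partial)
    have "set_integrable lebesgue \<Omega> (\<lambda>x. u x * partial_deriv i \<psi> x)"
      "set_integrable lebesgue \<Omega> (\<lambda>x. v x * partial_deriv i \<psi> x)"
      using u v \<psi>i by (auto simp: has_weak_partial_def intro: locally_integrable_mult_test)
    then show ?thesis
      unfolding set_lebesgue_integral_def set_integrable_def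
    proof (intro integral_cong_AE borel_measurable_integrable)
      show "AE x in lebesgue. indicator \<Omega> x *\<^sub>R (u x * partial_deriv i \<psi> x) = indicator \<Omega> x *\<^sub>R (v x * partial_deriv i \<psi> x)"
        using ae by eventually_elim (auto simp: indicator_def)
    qed
  qed
  then show ?thesis
    using u v by (auto simp: has_weak_partial_def)
qed

lemma has_weak_partial_weak_partial:
  "has_weak_partial \<Omega> i u g \<Longrightarrow> has_weak_partial \<Omega> i u (weak_partial \<Omega> i u)"
  unfolding weak_partial_def by (rule someI[of "has_weak_partial \<Omega> i u"])

text \<open>\<open>weak_laplacian\<close> nests two choices, the inner one deciding which function
  the outer one differentiates. Uniqueness up to null sets identifies the chosen first derivative
  with \<open>g i\<close>, after which \<open>h i\<close> is also a weak derivative of the chosen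
  one.\<close>

lemma weak_laplacian_AE:
  assumes \<Omega>: "open \<Omega>"
    and g: "\<And>i. i \<in> Basis \<Longrightarrow> has_weak_partial \<Omega> i u (g i)"
    and h: "\<And>i. i \<in> Basis \<Longrightarrow> has_weak_partial \<Omega> i (g i) (h i)"
  shows "AE x in lebesgue. x \<in> \<Omega> \<longrightarrow> weak_laplacian \<Omega> u x = (\<Sum>i\<in>Basis. h i x)"
proof -
  have "AE x in lebesgue. x \<in> \<Omega> \<longrightarrow> weak_partial \<Omega> i (weak_partial \<Omega> i u) x = h i x" if i: "i \<in> Basis" for i
  proof -
    let ?w = "weak_partial \<Omega> i u"
    have w: "has_weak_partial \<Omega> i u ?w"
      using g[OF i] by (rule has_weak_partial_weak_partial)
    have "locally_integrable_on \<Omega> ?w"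
      using w by (simp add: has_weak_partial_def)
    then have wh: "has_weak_partial \<Omega> i ?w (h i)"
      using has_weak_partial_cong_AE[OF h[OF i] _ i has_weak_partial_unique[OF \<Omega> g[OF i] w]] by blast
    show ?thesis
      by (rule has_weak_partial_unique[OF \<Omega> has_weak_partial_weak_partial[OF wh] wh])
  qed
  then have "AE x in lebesgue. \<forall>i\<in>Basis. x \<in> \<Omega> \<longrightarrow> weak_partial \<Omega> i (weak_partial \<Omega> i u) x = h i x"
    by (intro AE_finite_allI finite_Basis)
  then show ?thesis
    by eventually_elim (auto simp: weak_laplacian_def intro!: sum.cong)
qed

section \<open>Admissible variations\<close>

lemma L2_on_add:
  assumes u: "L2_on \<Omega> u" and v: "L2_on \<Omega> v"
  shows "L2_on \<Omega> (\<lambda>x. u x + v x)"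
proof -
  have [measurable]: "(\<lambda>x. indicator \<Omega> x *\<^sub>R u x) \<in> borel_measurable lebesgue"
    "(\<lambda>x. indicator \<Omega> x *\<^sub>R v x) \<in> borel_measurable lebesgue"
    using u v by (auto simp: L2_on_def set_borel_measurable_def)
  have m: "(\<lambda>x. indicator \<Omega> x *\<^sub>R (u x + v x)) \<in> borel_measurable lebesgue"
    unfolding scaleR_add_right by measurable
  have eq: "(\<lambda>x. indicator \<Omega> x *\<^sub>R (u x + v x)\<^sup>2) = (\<lambda>x. (indicator \<Omega> x *\<^sub>R (u x + v x))\<^sup>2)"
    by (auto simp: indicator_def)
  have "integrable lebesgue (\<lambda>x. indicator \<Omega> x *\<^sub>R (u x + v x)\<^sup>2)"
  proof (rule Bochner_Integration.integrable_bound)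
    show "integrable lebesgue (\<lambda>x. 2 * (indicator \<Omega> x *\<^sub>R (u x)\<^sup>2) + 2 * (indicator \<Omega> x *\<^sub>R (v x)\<^sup>2))"
      using u v unfolding L2_on_def set_integrable_def
      by (intro Bochner_Integration.integrable_add integrable_mult_right) auto
    show "(\<lambda>x. indicator \<Omega> x *\<^sub>R (u x + v x)\<^sup>2) \<in> borel_measurable lebesgue"
      unfolding eq using m by (rule borel_measurable_power)
    show "AE x in lebesgue. norm (indicator \<Omega> x *\<^sub>R (u x + v x)\<^sup>2)
        \<le> norm (2 * (indicator \<Omega> x *\<^sub>R (u x)\<^sup>2) + 2 * (indicator \<Omega> x *\<^sub>R (v x)\<^sup>2))"
    proof (intro AE_I2)
      fix x
      have "(u x + v x)\<^sup>2 \<le> 2 * (u x)\<^sup>2 + 2 * (v x)\<^sup>2"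
        using sum_squares_bound[of "u x" "v x"] by (simp add: power2_sum)
      then show "norm (indicator \<Omega> x *\<^sub>R (u x + v x)\<^sup>2)
        \<le> norm (2 * (indicator \<Omega> x *\<^sub>R (u x)\<^sup>2) + 2 * (indicator \<Omega> x *\<^sub>R (v x)\<^sup>2))"
        by (simp add: indicator_def)
    qed
  qed
  then show ?thesis
    using m by (simp add: L2_on_def set_borel_measurable_def set_integrable_def)
qed

lemma L2_on_test:
  assumes \<phi>: "test_function UNIV \<phi>" and \<Omega>: "open \<Omega>"
  shows "L2_on \<Omega> \<phi>"
proof -
  have s: "\<Omega> \<in> sets lebesgue" using \<Omega> by simp
  have "\<phi> \<in> borel_measurable lebesgue"
    using test_function_measurable[OF \<phi>] by (simp add: measurable_completion)
  moreover have "integrable lebesgue (\<lambda>x. (\<phi> x)\<^sup>2)"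
    unfolding power2_eq_square
    by (rule integrable_lebesgue_of_lborel[OF test_function_integrable[OF test_function_mult[OF \<phi> test_function_smooth[OF \<phi>]]]])
  ultimately show ?thesis
    using s unfolding L2_on_def set_borel_measurable_def set_integrable_def
    by (intro conjI borel_measurable_scaleR borel_measurable_indicator integrable_mult_indicator)
qed

lemma H_add_test:
  assumes \<Omega>: "open \<Omega>"
  shows "u \<in> H k \<Omega> \<Longrightarrow> test_function UNIV \<phi> \<Longrightarrow> (\<lambda>x. u x + \<phi> x) \<in> H k \<Omega>"
proof (induction k arbitrary: u \<phi>)
  case 0
  then show ?case using L2_on_add L2_on_test[OF _ \<Omega>] by auto
next
  case (Suc k)
  have "\<exists>g. has_weak_partial \<Omega> i (\<lambda>x. u x + \<phi> x) g \<and> g \<in> H k \<Omega>" if i: "i \<in> Basis" for i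
  proof -
    obtain g where g: "has_weak_partial \<Omega> i u g" "g \<in> H k \<Omega>"
      using Suc.prems(1) i by auto
    show ?thesis
      using has_weak_partial_add_test[OF g(1) Suc.prems(2) i]
        Suc.IH[OF g(2) test_function_partial[OF Suc.prems(2) i]] by blast
  qed
  moreover have "L2_on \<Omega> (\<lambda>x. u x + \<phi> x)"
    using Suc.prems(1) L2_on_add[OF _ L2_on_test[OF Suc.prems(2) \<Omega>], of u] by simp
  ultimately show ?case by simp
qed

text \<open>The approximating test function is shifted together with v, so the difference is
  literally unchanged and its norm needs no estimate.\<close>

lemma H0_add_test:
  assumes \<Omega>: "open \<Omega>" and v: "v \<in> H0 k \<Omega>" and \<phi>: "test_function \<Omega> \<phi>"
  shows "(\<lambda>x. v x + \<phi> x) \<in> H0 k \<Omega>"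
  unfolding H0_def
proof (intro CollectI conjI allI impI)
  show "(\<lambda>x. v x + \<phi> x) \<in> H k \<Omega>"
    using H_add_test[OF \<Omega> _ test_function_UNIV[OF \<phi>]] v by (simp add: H0_def)
  fix \<epsilon> :: real assume "\<epsilon> > 0"
  then obtain \<psi> where \<psi>: "test_function \<Omega> \<psi>" "H_norm k \<Omega> (\<lambda>x. v x - \<psi> x) < \<epsilon>"
    using v by (auto simp: H0_def)
  show "\<exists>\<psi>. test_function \<Omega> \<psi> \<and> H_norm k \<Omega> (\<lambda>x. v x + \<phi> x - \<psi> x) < \<epsilon>"
  proof (intro exI conjI)
    show "test_function \<Omega> (\<lambda>x. \<psi> x + \<phi> x)" by (rule test_function_add[OF \<psi>(1) \<phi>])
    have "(\<lambda>x. v x + \<phi> x - (\<psi> x + \<phi> x)) = (\<lambda>x. v x - \<psi> x)" by auto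
    then show "H_norm k \<Omega> (\<lambda>x. v x + \<phi> x - (\<psi> x + \<phi> x)) < \<epsilon>" using \<psi>(2) by simp
  qed
qed

lemma navier_class_add_test:
  assumes \<Omega>: "open \<Omega>" and v: "v \<in> navier_class \<Omega> g" and \<phi>: "test_function \<Omega> \<phi>"
  shows "(\<lambda>x. v x + \<phi> x) \<in> navier_class \<Omega> g"
proof -
  have "(\<lambda>x. v x + \<phi> x - g x) = (\<lambda>x. (v x - g x) + \<phi> x)" by auto
  then show ?thesis
    using v H_add_test[OF \<Omega> _ test_function_UNIV[OF \<phi>]] H0_add_test[OF \<Omega> _ \<phi>, of "\<lambda>x. v x - g x"]
    by (simp add: navier_class_def)
qed

lemma dirichlet_class_add_test:
  assumes \<Omega>: "open \<Omega>" and v: "v \<in> dirichlet_class \<Omega> g" and \<phi>: "test_function \<Omega> \<phi>"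
  shows "(\<lambda>x. v x + \<phi> x) \<in> dirichlet_class \<Omega> g"
proof -
  have "(\<lambda>x. v x + \<phi> x - g x) = (\<lambda>x. (v x - g x) + \<phi> x)" by auto
  then show ?thesis
    using v H_add_test[OF \<Omega> _ test_function_UNIV[OF \<phi>]] H0_add_test[OF \<Omega> _ \<phi>, of "\<lambda>x. v x - g x"]
    by (simp add: dirichlet_class_def)
qed

section \<open>Minimisers are almost biharmonic\<close>

text \<open>Sobolev functions are given up to null sets of \<Omega> and are only Lebesgue
  measurable. A Borel version extended by zero permits convolution over the whole space, and |v| <=
  1 + v^2 on the bounded set \<Omega> makes it integrable.\<close>

lemma borel_representative:
  assumes u: "L2_on \<Omega> u" and \<Omega>: "open \<Omega>" "bounded \<Omega>"
  obtains v where "v \<in> borel_measurable borel" "\<And>x. x \<notin> \<Omega> \<Longrightarrow> v x = 0"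
    "AE x in lebesgue. x \<in> \<Omega> \<longrightarrow> u x = v x" "integrable lborel (\<lambda>x. (v x)\<^sup>2)" "integrable lborel v"
proof -
  let ?u = "\<lambda>x. indicator \<Omega> x *\<^sub>R u x"
  have "?u \<in> borel_measurable lebesgue"
    using u by (simp add: L2_on_def set_borel_measurable_def)
  then obtain v0 where v0 [measurable]: "v0 \<in> borel_measurable borel" and ae0: "AE x in lborel. ?u x = v0 x"
    using completion_ex_borel_measurable_real[of ?u lborel] by auto
  define v where "v x = indicator \<Omega> x * v0 x" for x
  note [measurable] = borel_open[OF \<Omega>(1)]
  have vm [measurable]: "v \<in> borel_measurable borel"
    unfolding v_def[abs_def] by measurable
  have ae: "AE x in lebesgue. x \<in> \<Omega> \<longrightarrow> u x = v x"
    using AE_completion[OF ae0] by eventually_elim (auto simp: v_def)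
  have "integrable lebesgue (\<lambda>x. indicator \<Omega> x *\<^sub>R (u x)\<^sup>2)"
    using u by (simp add: L2_on_def set_integrable_def)
  then have "integrable lebesgue (\<lambda>x. (v x)\<^sup>2)"
  proof (rule integrable_cong_AE_imp)
    show "(\<lambda>x. (v x)\<^sup>2) \<in> borel_measurable lebesgue"
      by (intro measurable_completion) measurable
    show "AE x in lebesgue. indicator \<Omega> x *\<^sub>R (u x)\<^sup>2 = (v x)\<^sup>2"
      using ae by eventually_elim (auto simp: v_def indicator_def)
  qed
  then have v2: "integrable lborel (\<lambda>x. (v x)\<^sup>2)"
    using integrable_completion[of "\<lambda>x. (v x)\<^sup>2" lborel] by simp
  have "integrable lborel v"
  proof (rule Bochner_Integration.integrable_bound)
    show "integrable lborel (\<lambda>x. indicator \<Omega> x + (v x)\<^sup>2)"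
      using v2 emeasure_bounded_finite[OF \<Omega>(2)] \<Omega>(1)
      by (intro Bochner_Integration.integrable_add integrable_real_indicator) auto
    show "AE x in lborel. norm (v x) \<le> norm (indicator \<Omega> x + (v x)\<^sup>2)"
    proof (intro AE_I2)
      fix x
      have "\<bar>v x\<bar> \<le> 1 + (v x)\<^sup>2"
        using sum_squares_bound[of 1 "\<bar>v x\<bar>"] by simp
      then show "norm (v x) \<le> norm (indicator \<Omega> x + (v x)\<^sup>2)"
        by (cases "x \<in> \<Omega>") (auto simp: v_def)
    qed
  qed measurable
  moreover have "v x = 0" if "x \<notin> \<Omega>" for x
    using that by (simp add: v_def)
  ultimately show thesis
    using that[OF vm _ ae v2] by blast
qed

text \<open>Replaces the chosen weak Laplacian and the function itself by Borel versions, so that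
  \<open>F\<close> splits into two finite terms. It is used for the minimiser and for its
  variations.\<close>

lemma F_eq:
  assumes \<Omega>: "open \<Omega>" "bounded \<Omega>"
    and f [measurable]: "f \<in> borel_measurable borel" and f0: "\<And>x. x \<notin> \<Omega> \<Longrightarrow> f x = 0"
    and f2: "integrable lborel (\<lambda>x. (f x)\<^sup>2)"
    and lap: "AE x in lebesgue. x \<in> \<Omega> \<longrightarrow> weak_laplacian \<Omega> u x = f x"
    and v [measurable]: "v \<in> borel_measurable borel" and uv: "AE x in lebesgue. x \<in> \<Omega> \<longrightarrow> u x = v x"
  shows "F \<Omega> u = (LBINT x. (f x)\<^sup>2) + measure lborel {x \<in> \<Omega>. v x \<noteq> 0}"
proof -
  note [measurable] = borel_open[OF \<Omega>(1)]
  let ?S = "{x \<in> \<Omega>. v x \<noteq> 0}"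
  have S [measurable]: "?S \<in> sets borel" by measurable
  have ae: "AE x in lebesgue. (f x)\<^sup>2 + indicator ?S x =
      indicator \<Omega> x *\<^sub>R (\<bar>weak_laplacian \<Omega> u x\<bar>\<^sup>2 + indicator {x \<in> \<Omega>. u x \<noteq> 0} x)"
    using lap uv by eventually_elim (auto simp: indicator_def f0)
  have m: "(\<lambda>x. (f x)\<^sup>2 + indicator ?S x) \<in> borel_measurable lborel"
    by measurable
  have m': "(\<lambda>x. (f x)\<^sup>2 + indicator ?S x) \<in> borel_measurable lebesgue"
    by (rule measurable_completion[OF m])
  have Sfin: "emeasure lborel ?S < \<infinity>"
    by (rule emeasure_bounded_finite) (rule bounded_subset[OF \<Omega>(2)], auto)
  have "F \<Omega> u = (\<integral>x. (f x)\<^sup>2 + indicator ?S x \<partial>lebesgue)"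
    unfolding F_def set_lebesgue_integral_def
  proof (rule integral_cong_AE[OF borel_measurable_AE[OF m' ae] m'])
    show "AE x in lebesgue. indicator \<Omega> x *\<^sub>R (\<bar>weak_laplacian \<Omega> u x\<bar>\<^sup>2 + indicator {x \<in> \<Omega>. u x \<noteq> 0} x) =
        (f x)\<^sup>2 + indicator ?S x"
      using ae by eventually_elim simp
  qed
  also have "\<dots> = (LBINT x. (f x)\<^sup>2 + indicator ?S x)"
    by (rule integral_completion[OF m])
  also have "\<dots> = (LBINT x. (f x)\<^sup>2) + (LBINT x. indicator ?S x)"
    using f2 Sfin by (intro Bochner_Integration.integral_add integrable_real_indicator) auto
  finally show ?thesis by simp
qed

lemma discriminant_bound:
  fixes A B M :: real
  assumes nonneg: "\<And>t. 0 \<le> M + 2 * t * A + t\<^sup>2 * B" and B: "B \<ge> 0"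
  shows "A\<^sup>2 \<le> M * B"
proof (cases "B = 0")
  case True
  have "A = 0"
  proof (rule ccontr)
    assume "A \<noteq> 0"
    then show False
      \<comment> \<open>With B = 0 the polynomial is linear in t, and this t gives it the value
        -1.\<close>
      using nonneg[of "- (M + 1) / (2 * A)"] True by (simp add: field_simps)
  qed
  then show ?thesis using True by simp
next
  case False
  then have B: "B > 0" using B by simp
  \<comment> \<open>The minimum point of the quadratic polynomial.\<close>
  have "0 \<le> M + 2 * (- A / B) * A + (- A / B)\<^sup>2 * B"
    by (rule nonneg)
  also have "\<dots> = M - A\<^sup>2 / B"
    using B by (simp add: power2_eq_square field_simps)
  finally show ?thesis using B by (simp add: field_simps)
qed

lemma set_integral_sum:
  fixes f :: "'i \<Rightarrow> 'b \<Rightarrow> real"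
  assumes "\<And>i. i \<in> I \<Longrightarrow> set_integrable M A (f i)"
  shows "(LINT x:A|M. (\<Sum>i\<in>I. f i x)) = (\<Sum>i\<in>I. LINT x:A|M. f i x)"
  unfolding set_lebesgue_integral_def scaleR_sum_right
  by (rule Bochner_Integration.integral_sum) (use assms in \<open>simp add: set_integrable_def\<close>)

text \<open>With f a Borel version of the Laplacian of u, minimality against all multiples of \<phi>
  gives 0 <= M + 2 t A + t^2 B for every real t. The discriminant bound is the required inequality
  once A is rewritten as an integral of U against a bilaplacian.\<close>

lemma minimiser_almost_biharmonic:
  fixes \<Omega> :: "'a::euclidean_space set"
  assumes \<Omega>: "open \<Omega>" "bounded \<Omega>" and u: "u \<in> H 2 \<Omega>"
    and min: "\<And>\<phi>. test_function \<Omega> \<phi> \<Longrightarrow> F \<Omega> u \<le> F \<Omega> (\<lambda>x. u x + \<phi> x)"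
  obtains U where "almost_biharmonic \<Omega> U" "AE x in lebesgue. x \<in> \<Omega> \<longrightarrow> u x = U x"
proof -
  have L2u: "L2_on \<Omega> u" using u by (simp add: numeral_2_eq_2)
  obtain U where Um [measurable]: "U \<in> borel_measurable borel" and U0: "\<And>x. x \<notin> \<Omega> \<Longrightarrow> U x = 0"
    and uU: "AE x in lebesgue. x \<in> \<Omega> \<longrightarrow> u x = U x" and "integrable lborel (\<lambda>x. (U x)\<^sup>2)" and Uint: "integrable lborel U"
    by (rule borel_representative[OF L2u \<Omega>]) blast
  have "\<exists>g h. has_weak_partial \<Omega> i u g \<and> has_weak_partial \<Omega> i g h \<and> L2_on \<Omega> h" if i: "i \<in> Basis" for i
  proof -
    obtain g where g: "has_weak_partial \<Omega> i u g" "g \<in> H 1 \<Omega>"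
      using u i unfolding numeral_2_eq_2 One_nat_def H.simps(2) by blast
    obtain h where "has_weak_partial \<Omega> i g h" "h \<in> H 0 \<Omega>"
      using g(2) i unfolding One_nat_def H.simps(2) by blast
    then show ?thesis using g(1) by auto
  qed
  then obtain g h where gh: "\<And>i. i \<in> Basis \<Longrightarrow> has_weak_partial \<Omega> i u (g i)"
    "\<And>i. i \<in> Basis \<Longrightarrow> has_weak_partial \<Omega> i (g i) (h i)" "\<And>i. i \<in> Basis \<Longrightarrow> L2_on \<Omega> (h i)"
    by metis
  have "L2_on \<Omega> (\<lambda>x. \<Sum>i\<in>I. h i x)" if "finite I" "I \<subseteq> Basis" for I
    using that
  proof (induction I rule: finite_induct)
    case empty
    show ?case by (simp add: L2_on_def set_borel_measurable_def set_integrable_def)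
  next
    case (insert j I)
    then show ?case using L2_on_add[OF gh(3)] by simp
  qed
  then have L2h: "L2_on \<Omega> (\<lambda>x. \<Sum>i\<in>Basis. h i x)" by simp
  obtain f where fm [measurable]: "f \<in> borel_measurable borel" and f0: "\<And>x. x \<notin> \<Omega> \<Longrightarrow> f x = 0"
    and hf: "AE x in lebesgue. x \<in> \<Omega> \<longrightarrow> (\<Sum>i\<in>Basis. h i x) = f x"
    and f2: "integrable lborel (\<lambda>x. (f x)\<^sup>2)" and fint: "integrable lborel f"
    by (rule borel_representative[OF L2h \<Omega>]) blast
  note [measurable] = borel_open[OF \<Omega>(1)]
  \<comment> \<open>Here \<open>laplacian \<phi>\<close> itself is the test function and its second
    partial derivatives are moved onto u. This expresses the coefficient of t through U
    alone.\<close>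
  have weak: "(LBINT x. U x * laplacian (laplacian \<phi>) x) = (LBINT x. f x * laplacian \<phi> x)"
    if \<phi>: "test_function \<Omega> \<phi>" for \<phi>
  proof -
    let ?L = "laplacian \<phi>"
    have L: "test_function \<Omega> ?L" by (rule test_function_laplacian[OF \<phi>])
    have Li: "test_function \<Omega> (partial_deriv i ?L)" and Lii: "test_function \<Omega> (partial_deriv i (partial_deriv i ?L))"
      if "i \<in> Basis" for i
      using L that by (auto intro: test_function_partial)
    have "(LBINT x. U x * laplacian ?L x) = (LINT x:\<Omega>|lebesgue. u x * laplacian ?L x)"
      by (rule set_integral_AE_eq_lborel[OF test_function_laplacian[OF L] Um uU, symmetric])
    also have "\<dots> = (LINT x:\<Omega>|lebesgue. (\<Sum>i\<in>Basis. u x * partial_deriv i (partial_deriv i ?L) x))"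
      by (simp add: laplacian_def[of ?L] sum_distrib_left)
    also have "\<dots> = (\<Sum>i\<in>Basis. LINT x:\<Omega>|lebesgue. u x * partial_deriv i (partial_deriv i ?L) x)"
    proof (rule set_integral_sum)
      show "set_integrable lebesgue \<Omega> (\<lambda>x. u x * partial_deriv i (partial_deriv i ?L) x)" if "i \<in> Basis" for i
        using gh(1)[OF that] by (intro locally_integrable_mult_test Lii that) (simp add: has_weak_partial_def)
    qed
    also have "\<dots> = (\<Sum>i\<in>Basis. LINT x:\<Omega>|lebesgue. h i x * ?L x)"
    proof (rule sum.cong[OF refl])
      fix i :: 'a assume i: "i \<in> Basis"
      show "(LINT x:\<Omega>|lebesgue. u x * partial_deriv i (partial_deriv i ?L) x) = (LINT x:\<Omega>|lebesgue. h i x * ?L x)"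
        using gh(1,2)[OF i] Li[OF i] L unfolding has_weak_partial_def by simp
    qed
    also have "\<dots> = (LINT x:\<Omega>|lebesgue. (\<Sum>i\<in>Basis. h i x * ?L x))"
    proof (rule set_integral_sum[symmetric])
      show "set_integrable lebesgue \<Omega> (\<lambda>x. h i x * ?L x)" if "i \<in> Basis" for i
        using gh(2)[OF that] by (intro locally_integrable_mult_test L) (simp add: has_weak_partial_def)
    qed
    also have "\<dots> = (LINT x:\<Omega>|lebesgue. (\<Sum>i\<in>Basis. h i x) * ?L x)"
      by (simp add: sum_distrib_right)
    also have "\<dots> = (LBINT x. f x * ?L x)"
      by (rule set_integral_AE_eq_lborel[OF L fm hf])
    finally show ?thesis .
  qed
  have lapu: "AE x in lebesgue. x \<in> \<Omega> \<longrightarrow> weak_laplacian \<Omega> u x = f x"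
  proof -
    have "AE x in lebesgue. x \<in> \<Omega> \<longrightarrow> weak_laplacian \<Omega> u x = (\<Sum>i\<in>Basis. h i x)"
      by (rule weak_laplacian_AE[OF \<Omega>(1) gh(1,2)])
    then show ?thesis using hf by eventually_elim simp
  qed
  have Fu: "F \<Omega> u = (LBINT x. (f x)\<^sup>2) + measure lborel {x \<in> \<Omega>. U x \<noteq> 0}"
    by (rule F_eq[OF \<Omega> fm f0 f2 lapu Um uU])
  have fin: "emeasure lborel S < \<infinity>" if "S \<subseteq> \<Omega>" for S
    using that \<Omega>(2) by (intro emeasure_bounded_finite) (rule bounded_subset)
  have "almost_biharmonic \<Omega> U"
  proof
    fix \<phi> assume \<phi>: "test_function \<Omega> \<phi>"
    let ?L = "laplacian \<phi>"
    have L: "test_function \<Omega> ?L" by (rule test_function_laplacian[OF \<phi>])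
    note [measurable] = test_function_measurable[OF \<phi>] test_function_measurable[OF L]
    define M where "M = measure lborel {z \<in> \<Omega>. U z = 0 \<and> \<phi> z \<noteq> 0}"
    define A where "A = (LBINT x. f x * ?L x)"
    define B where "B = (LBINT x. (?L x)\<^sup>2)"
    have fL: "integrable lborel (\<lambda>x. f x * ?L x)"
      by (rule test_function_integrable_mult[OF L fint])
    have LL: "integrable lborel (\<lambda>x. (?L x)\<^sup>2)"
      unfolding power2_eq_square
      by (rule test_function_integrable[OF test_function_mult[OF L test_function_smooth[OF L]]])
    have "0 \<le> M + 2 * t * A + t\<^sup>2 * B" for t
    proof -
      let ?\<phi> = "\<lambda>x. t * \<phi> x"
      have t\<phi>: "test_function \<Omega> ?\<phi>" by (rule test_function_cmult[OF \<phi>])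
      have t\<phi>': "test_function UNIV ?\<phi>" by (rule test_function_UNIV[OF t\<phi>])
      let ?f = "\<lambda>x. f x + t * ?L x"
      have sq: "(?f x)\<^sup>2 = (f x)\<^sup>2 + (2 * t) * (f x * ?L x) + t\<^sup>2 * (?L x)\<^sup>2" for x
        by (simp add: power2_sum power_mult_distrib mult_ac)
      have int: "integrable lborel (\<lambda>x. (?f x)\<^sup>2)"
        unfolding sq using f2 fL LL by (intro Bochner_Integration.integrable_add integrable_mult_right)
      have "laplacian ?\<phi> x = t * ?L x" for x
        by (rule laplacian_cmult[OF test_function_smooth[OF \<phi>]])
      moreover have "AE x in lebesgue. x \<in> \<Omega> \<longrightarrow> weak_laplacian \<Omega> (\<lambda>x. u x + ?\<phi> x) x =
          (\<Sum>i\<in>Basis. h i x + partial_deriv i (partial_deriv i ?\<phi>) x)"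
        by (rule weak_laplacian_AE[OF \<Omega>(1) has_weak_partial_add_test[OF gh(1) t\<phi>']
              has_weak_partial_add_test[OF gh(2) test_function_partial[OF t\<phi>']]])
      ultimately have lap: "AE x in lebesgue. x \<in> \<Omega> \<longrightarrow> weak_laplacian \<Omega> (\<lambda>x. u x + ?\<phi> x) x = ?f x"
        using hf by (auto elim!: eventually_elim2 simp: sum.distrib laplacian_def[of ?\<phi>])
      have "F \<Omega> (\<lambda>x. u x + ?\<phi> x) = (LBINT x. (?f x)\<^sup>2) + measure lborel {x \<in> \<Omega>. U x + ?\<phi> x \<noteq> 0}"
      proof (rule F_eq[OF \<Omega> _ _ int lap])
        show "?f \<in> borel_measurable borel" "(\<lambda>x. U x + ?\<phi> x) \<in> borel_measurable borel" by measurable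
        show "?f x = 0" if "x \<notin> \<Omega>" for x
          using f0[OF that] test_function_zero_outside[OF L that] by simp
        show "AE x in lebesgue. x \<in> \<Omega> \<longrightarrow> u x + ?\<phi> x = U x + ?\<phi> x"
          using uU by eventually_elim simp
      qed
      moreover have "(LBINT x. (?f x)\<^sup>2) = (LBINT x. (f x)\<^sup>2) + 2 * t * A + t\<^sup>2 * B"
        unfolding sq A_def B_def using f2 fL LL by simp
      \<comment> \<open>The bound does not depend on t: new nonzero points can appear only where U
        vanishes and \<phi> does not. This keeps the comparison quadratic in t.\<close>
      moreover have "measure lborel {x \<in> \<Omega>. U x + ?\<phi> x \<noteq> 0} \<le> measure lborel {x \<in> \<Omega>. U x \<noteq> 0} + M"
      proof -
        have "measure lborel {x \<in> \<Omega>. U x + ?\<phi> x \<noteq> 0} \<le>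
            measure lborel ({x \<in> \<Omega>. U x \<noteq> 0} \<union> {z \<in> \<Omega>. U z = 0 \<and> \<phi> z \<noteq> 0})"
          using fin[of "{x \<in> \<Omega>. U x \<noteq> 0} \<union> {z \<in> \<Omega>. U z = 0 \<and> \<phi> z \<noteq> 0}"]
          by (intro measure_mono_fmeasurable fmeasurableI) auto
        also have "\<dots> \<le> measure lborel {x \<in> \<Omega>. U x \<noteq> 0} + M"
          unfolding M_def by (rule measure_Un_le) auto
        finally show ?thesis .
      qed
      ultimately show ?thesis
        using min[OF t\<phi>] Fu by linarith
    qed
    then have "A\<^sup>2 \<le> M * B"
      by (rule discriminant_bound) (simp add: B_def)
    then show "(LBINT z. U z * laplacian ?L z)\<^sup>2 \<le> measure lborel {z \<in> \<Omega>. U z = 0 \<and> \<phi> z \<noteq> 0} * (LBINT z. (?L z)\<^sup>2)"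
      by (simp add: weak[OF \<phi>] A_def B_def M_def)
  qed (fact \<Omega>(1) Uint)+
  then show thesis using that uU by blast
qed

theorem theorem2:
  fixes \<Omega> :: "(real ^ 'n) set" and \<phi> u :: "real ^ 'n \<Rightarrow> real"
  assumes "bounded_C2_domain \<Omega>"
    and "\<phi> \<in> H 2 \<Omega>"
    and "is_arg_min (F \<Omega>) (\<lambda>v. v \<in> navier_class \<Omega> \<phi>) u \<or>
         is_arg_min (F \<Omega>) (\<lambda>v. v \<in> dirichlet_class \<Omega> \<phi>) u"
  shows "\<exists>w. ae_eq_on \<Omega> u w \<and>
           (\<forall>\<alpha>\<in>{0<..<1}. C1_holder_on \<alpha> \<Omega> w) \<and>
           open (\<Omega> - {x\<in>\<Omega>. w x = 0 \<and> grad w x = 0}) \<and>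
           smooth_on (\<Omega> - {x\<in>\<Omega>. w x = 0 \<and> grad w x = 0}) w \<and>
           biharmonic_on (\<Omega> - {x\<in>\<Omega>. w x = 0 \<and> grad w x = 0}) w"
proof -
  have \<Omega>: "open \<Omega>" "bounded \<Omega>"
    using assms(1) by (auto simp: bounded_C2_domain_def)
  have "u \<in> H 2 \<Omega>"
    using assms(3) by (auto simp: is_arg_min_def navier_class_def dirichlet_class_def)
  \<comment> \<open>Adding a test function preserves either boundary condition, so the two cases
    merge at this point.\<close>
  moreover have "F \<Omega> u \<le> F \<Omega> (\<lambda>x. u x + \<psi> x)" if "test_function \<Omega> \<psi>" for \<psi>
    using assms(3) navier_class_add_test[OF \<Omega>(1) _ that] dirichlet_class_add_test[OF \<Omega>(1) _ that]
    unfolding is_arg_min_def by (meson not_le)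
  ultimately obtain U where U: "almost_biharmonic \<Omega> U" and uU: "AE x in lebesgue. x \<in> \<Omega> \<longrightarrow> u x = U x"
    using minimiser_almost_biharmonic[OF \<Omega>] by blast
  interpret almost_biharmonic \<Omega> U by (rule U)
  show ?thesis
  proof (intro exI conjI)
    show "ae_eq_on \<Omega> u repr"
      unfolding ae_eq_on_def using uU AE_eq_repr by eventually_elim auto
    show "\<forall>\<alpha>\<in>{0<..<1}. C1_holder_on \<alpha> \<Omega> repr"
      using C1_holder_on_repr by auto
    show "open (\<Omega> - {x\<in>\<Omega>. repr x = 0 \<and> grad repr x = 0})"
      using open_regular_set by (simp add: regular_set_def)
    show "smooth_on (\<Omega> - {x\<in>\<Omega>. repr x = 0 \<and> grad repr x = 0}) repr"
      using smooth_on_repr by (simp add: regular_set_def)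
    show "biharmonic_on (\<Omega> - {x\<in>\<Omega>. repr x = 0 \<and> grad repr x = 0}) repr"
      using biharmonic_on_repr by (simp add: regular_set_def)
  qed
qed

end
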